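(* Every factor-compatible small cover over a product of polygons is, after the combinatorial regrouping of its square factors and, for the resulting product of polygons, up to Davis--Januszkiewicz equivalence, an iterated equivariant bundle whose fibers are orientable small covers over polygons.
   Context: Conventions. $\mathbb Z_2=\mathbb Z/2\mathbb Z$. $P_k$ denotes the polygon with $k\ge 3$ sides. $P=P_{m_1}\times\cdots\times P_{m_n}$ is a simple polytope of dimension $2n$ with $m=m_1+\cdots+m_n$ facets. If $E_{i,1},\dots,E_{i,m_i}$ are the sides of $P_{m_i}$ in cyclic order (second index modulo $m_i$), the facets of $P$ are $F_{i,j}=P_{m_1}\times\cdots\times P_{m_{i-1}}\times E_{i,j}\times P_{m_{i+1}}\times\cdots\times P_{m_n}$. The standard basis of $\mathbb Z_2^m$ is indexed by the facets, and $F_{i,j}$ also denotes the corresponding basis vector. Small covers. The real moment-angle manifold of a simple polytope $P$ with $m$ facets $F_1,\dots,F_m$ is $\mathbb R\mathcal Z_P=(\mathbb Z_2^m\times P)/\sim$, where $(g,p)\sim(h,p)$ iff $g+h$ lies in the span of the basis vectors $e_i$ of the facets $F_i$ containing $p$; $\mathbb Z_2^m$ acts by $h\cdot[g,p]=[h+g,p]$. A mod 2 characteristic map over $P$ (with $\dim P=d$) is a linear map $\lambda:\mathbb Z_2^m\to\mathbb Z_2^d$ such that whenever $F_{i_1}\cap\cdots\cap F_{i_k}\ne\varnothing$, the vectors $\lambda(e_{i_1}),\dots,\lambda(e_{i_k})$ are linearly independent. Then $G=\ker\lambda$ acts freely on $\mathbb R\mathcal Z_P$, and the small cover is $M(P,\lambda)=\mathbb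 R\mathcal Z_P/G$, with the locally standard action of $\mathbb Z_2^d\cong\mathbb Z_2^m/G$ and orbit space $P$. $\operatorname{row}(\lambda)\subset\mathbb Z_2^m$ is the row space of the matrix of $\lambda$. Two small covers over the same $P$ are Davis--Januszkiewicz equivalent if there is a weakly $\mathbb Z_2^d$-equivariant homeomorphism (equivariant up to an automorphism of $\mathbb Z_2^d$) between them covering the identity map of $P$. Factor-compatibility. Put $\chi_i=F_{i,1}+\cdots+F_{i,m_i}\in\mathbb Z_2^m$. Let $i_1,\dots,i_r$ be the indices with $m_i=4$, and put $\delta_a^+=F_{i_a,1}+F_{i_a,3}$, $\delta_a^-=F_{i_a,2}+F_{i_a,4}$ for $a=1,\dots,r$; these correspond to the $2r$ interval directions of the cube part $\prod_{m_i=4}P_4\cong(\Delta^1)^{2r}$. $M(P,\lambda)$ is factor-compatible if, after permuting the interval directions of the cube part and regrouping them into $r$ square factors, the total facet weight (sum of the basis vectors of all facets coming from the factor) of every resulting polygon factor lies in $\operatorname{row}(\lambda)$. Explicitly: $\chi_i\in\operatorname{row}(\lambda)$ whenever $m_i\ne4$, and the weights $\delta_1^\pm,\dots,\delta_r^\pm$ can be partitioned into $r$ pairs $\{\omega_\ell,\omega_\ell'\}$ with $\omega_\ell+\omega'_\ell\in\operatorname{row}(\lambda)$ for all $\ell$; the two opposite pairs of facets recorded by $\omega_\ell,\omega'_\ell$ then form the two interval directions of the $\ell$th new square factor. Such a regrouping is fixed once and for all; it changes only the decomposition of the cube part into squares, not the underlying smooth manifold. Bundles. An equivariant bundle between small covers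 is a fiber bundle compatible with the locally standard $\mathbb Z_2$-torus actions, with respect to a surjective homomorphism of the acting groups. That a small cover over the (regrouped) product of $n$ polygons is, up to Davis--Januszkiewicz equivalence, an iterated equivariant bundle whose fibers are orientable small covers over polygons means: after permuting the polygon factors of the regrouped product (again written $P_{m_1}\times\cdots\times P_{m_n}$), there is a tower $M_n\to M_{n-1}\to\cdots\to M_1\to\{\mathrm{pt}\}$ of equivariant bundles between small covers, where $M_n$ is Davis--Januszkiewicz equivalent to the regrouped small cover, $M_i$ is a small cover over $P_{m_1}\times\cdots\times P_{m_i}$, and the fiber of $M_i\to M_{i-1}$ is an orientable small cover over the $i$th polygon $P_{m_i}$. *)

theory Defs
  imports
    "HOL-Analysis.Analysis"
    "HOL-Library.Z2"
    "HOL-Library.Function_Algebras"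
    "HOL-Combinatorics.Permutations"
begin

section \<open>Linear algebra over the field with two elements\<close>

definition bscale :: "bit \<Rightarrow> ('a \<Rightarrow> bit) \<Rightarrow> 'a \<Rightarrow> bit" where
  "bscale c v = (\<lambda>x. c * v x)"

global_interpretation bitvec: vector_space "bscale :: bit \<Rightarrow> ('a \<Rightarrow> bit) \<Rightarrow> 'a \<Rightarrow> bit"
  by unfold_locales (auto simp: bscale_def fun_eq_iff algebra_simps)

text \<open>The coordinate space with basis indexed by \<open>A\<close>: functions vanishing outside \<open>A\<close>.\<close>

definition bvec :: "'a set \<Rightarrow> ('a \<Rightarrow> bit) set" where
  "bvec A = {v. \<forall>x. x \<notin> A \<longrightarrow> v x = 0}"

definition unit_vec :: "'a \<Rightarrow> 'a \<Rightarrow> bit" where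
  "unit_vec a = indicator {a}"

text \<open>Over the field with two elements, additive maps are the same as linear maps.\<close>

definition bit_linear :: "('a \<Rightarrow> bit) set \<Rightarrow> ('b \<Rightarrow> bit) set \<Rightarrow> (('a \<Rightarrow> bit) \<Rightarrow> 'b \<Rightarrow> bit) \<Rightarrow> bool" where
  "bit_linear V W f \<longleftrightarrow> f ` V \<subseteq> W \<and> (\<forall>x\<in>V. \<forall>y\<in>V. f (x + y) = f x + f y)"


section \<open>Quotient spaces\<close>

definition quotient_topology :: "'a topology \<Rightarrow> ('a \<times> 'a) set \<Rightarrow> 'a set topology" where
  "quotient_topology X r = topology (\<lambda>U. U \<subseteq> topspace X // r \<and> openin X (\<Union>U))"

lemma openin_quotient_topology:
  assumes r: "equiv (topspace X) r"
  shows "openin (quotient_topology X r) U \<longleftrightarrow> U \<subseteq> topspace X // r \<and> openin X (\<Union>U)"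
proof -
  have "\<Union>(S \<inter> T) = \<Union>S \<inter> \<Union>T" if "S \<subseteq> topspace X // r" "T \<subseteq> topspace X // r" for S T
    using that quotient_disj[OF r] by blast
  moreover have "openin X (\<Union>(\<Union>K))" if "\<forall>S\<in>K. openin X (\<Union>S)" for K
  proof -
    have "\<Union>(\<Union>K) = \<Union>(Union ` K)" by blast
    then show ?thesis using that by auto
  qed
  ultimately have "istopology (\<lambda>U. U \<subseteq> topspace X // r \<and> openin X (\<Union>U))"
    unfolding istopology_def by (simp add: Sup_le_iff le_infI1 openin_Int)
  then show ?thesis
    unfolding quotient_topology_def by (simp add: topology_inverse')
qed

lemma topspace_quotient_topology:
  assumes r: "equiv (topspace X) r"
  shows "topspace (quotient_topology X r) = topspace X // r"
proof -
  have "openin (quotient_topology X r) (topspace X // r)"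
    using Union_quotient[OF r] by (simp add: openin_quotient_topology[OF r])
  then show ?thesis
    using openin_quotient_topology[OF r] openin_subset openin_topspace by blast
qed


section \<open>Polygons and their products\<close>

text \<open>A space with an indexed family of facets.\<close>

record ('p, 'f) faceted_space =
  points :: "'p topology"
  facets :: "'f set"
  facet :: "'f \<Rightarrow> 'p set"

text \<open>The regular polygon with \<open>k\<close> sides; side \<open>j\<close> joins the vertices \<open>j\<close> and \<open>j + 1\<close>
  (modulo \<open>k\<close>), so the sides are numbered \<open>0, \<dots>, k - 1\<close> in cyclic order.\<close>

definition polygon_vertex :: "nat \<Rightarrow> nat \<Rightarrow> complex" where
  "polygon_vertex k j = cis (2 * pi * real j / real k)"

definition polygon :: "nat \<Rightarrow> (complex, nat) faceted_space" where
  "polygon k =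
    \<lparr> points = top_of_set (convex hull (polygon_vertex k ` {..<k})),
      facets = {..<k},
      facet = (\<lambda>j. closed_segment (polygon_vertex k j) (polygon_vertex k (Suc j))) \<rparr>"

text \<open>The product of the polygons with \<open>m 0, \<dots>, m (n - 1)\<close> sides. For \<open>n = 0\<close> this is a point
  without facets.\<close>

definition polygon_product :: "nat \<Rightarrow> (nat \<Rightarrow> nat) \<Rightarrow> (nat \<Rightarrow> complex, nat \<times> nat) faceted_space" where
  "polygon_product n m =
    \<lparr> points = product_topology (\<lambda>i. points (polygon (m i))) {..<n},
      facets = (SIGMA i:{..<n}. {..<m i}),
      facet = (\<lambda>(i, j). {x \<in> \<Pi>\<^sub>E i\<in>{..<n}. topspace (points (polygon (m i))).
                           x i \<in> facet (polygon (m i)) j}) \<rparr>"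


section \<open>Small covers\<close>

definition mirror_relation ::
  "('p, 'f) faceted_space \<Rightarrow> ((('f \<Rightarrow> bit) \<times> 'p) \<times> (('f \<Rightarrow> bit) \<times> 'p)) set" where
  "mirror_relation P =
    {((g, p), (h, q)). g \<in> bvec (facets P) \<and> h \<in> bvec (facets P) \<and> p = q \<and> p \<in> topspace (points P) \<and>
       g + h \<in> bitvec.span {unit_vec F |F. F \<in> facets P \<and> p \<in> facet P F}}"

definition real_moment_angle :: "('p, 'f) faceted_space \<Rightarrow> (('f \<Rightarrow> bit) \<times> 'p) set topology" where
  "real_moment_angle P =
    quotient_topology (prod_topology (discrete_topology (bvec (facets P))) (points P)) (mirror_relation P)"

definition moment_angle_act ::
  "('f \<Rightarrow> bit) \<Rightarrow> (('f \<Rightarrow> bit) \<times> 'p) set \<Rightarrow> (('f \<Rightarrow> bit) \<times> 'p) set" where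
  "moment_angle_act h c = (\<lambda>(g, p). (h + g, p)) ` c"

definition characteristic_map ::
  "('p, 'f) faceted_space \<Rightarrow> nat \<Rightarrow> (('f \<Rightarrow> bit) \<Rightarrow> nat \<Rightarrow> bit) \<Rightarrow> bool" where
  "characteristic_map P d lam \<longleftrightarrow>
     bit_linear (bvec (facets P)) (bvec {..<d}) lam \<and>
     (\<forall>S. finite S \<and> S \<subseteq> facets P \<and> topspace (points P) \<inter> (\<Inter>F\<in>S. facet P F) \<noteq> {} \<longrightarrow>
        inj_on (\<lambda>F. lam (unit_vec F)) S \<and> bitvec.independent ((\<lambda>F. lam (unit_vec F)) ` S))"

definition char_kernel ::
  "('p, 'f) faceted_space \<Rightarrow> (('f \<Rightarrow> bit) \<Rightarrow> nat \<Rightarrow> bit) \<Rightarrow> ('f \<Rightarrow> bit) set" where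
  "char_kernel P lam = {g \<in> bvec (facets P). lam g = 0}"

definition small_cover ::
  "('p, 'f) faceted_space \<Rightarrow> (('f \<Rightarrow> bit) \<Rightarrow> nat \<Rightarrow> bit) \<Rightarrow> (('f \<Rightarrow> bit) \<times> 'p) set set topology" where
  "small_cover P lam =
    quotient_topology (real_moment_angle P)
      {(x, y). x \<in> topspace (real_moment_angle P) \<and> (\<exists>g\<in>char_kernel P lam. y = moment_angle_act g x)}"

text \<open>The residual action: \<open>v = lam h\<close> sends the orbit of \<open>c\<close> to the orbit of \<open>h \<cdot> c\<close>. Since the
  preimages of \<open>v\<close> form a coset of the kernel, collecting all of them yields exactly one orbit.\<close>

definition small_cover_act ::
  "('p, 'f) faceted_space \<Rightarrow> (('f \<Rightarrow> bit) \<Rightarrow> nat \<Rightarrow> bit) \<Rightarrow> (nat \<Rightarrow> bit) \<Rightarrow>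
   (('f \<Rightarrow> bit) \<times> 'p) set set \<Rightarrow> (('f \<Rightarrow> bit) \<times> 'p) set set" where
  "small_cover_act P lam v x = {moment_angle_act h c |h c. h \<in> bvec (facets P) \<and> lam h = v \<and> c \<in> x}"

text \<open>The projection of a small cover onto its orbit space: all representatives \<open>(g, p)\<close> of a point
  share the same \<open>p\<close>.\<close>

definition orbit_point :: "(('f \<Rightarrow> bit) \<times> 'p) set set \<Rightarrow> 'p" where
  "orbit_point x = the_elem (snd ` \<Union>x)"

definition row_space ::
  "('p, 'f) faceted_space \<Rightarrow> nat \<Rightarrow> (('f \<Rightarrow> bit) \<Rightarrow> nat \<Rightarrow> bit) \<Rightarrow> ('f \<Rightarrow> bit) set" where
  "row_space P d lam =
    bitvec.span ((\<lambda>r F. if F \<in> facets P then lam (unit_vec F) r else 0) ` {..<d})"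


section \<open>Equivalences of small covers\<close>

text \<open>A homeomorphism \<open>h\<close> of small covers of dimension \<open>d\<close>, equivariant up to an automorphism of the
  acting group, and covering the map \<open>f\<close> of orbit spaces.\<close>

definition weakly_equivariant_homeo ::
  "nat \<Rightarrow> ('p, 'f) faceted_space \<Rightarrow> (('f \<Rightarrow> bit) \<Rightarrow> nat \<Rightarrow> bit) \<Rightarrow>
   ('q, 'e) faceted_space \<Rightarrow> (('e \<Rightarrow> bit) \<Rightarrow> nat \<Rightarrow> bit) \<Rightarrow> ('p \<Rightarrow> 'q) \<Rightarrow>
   ((('f \<Rightarrow> bit) \<times> 'p) set set \<Rightarrow> (('e \<Rightarrow> bit) \<times> 'q) set set) \<Rightarrow> bool" where
  "weakly_equivariant_homeo d P lam Q lam' f h \<longleftrightarrow>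
     homeomorphic_map (small_cover P lam) (small_cover Q lam') h \<and>
     (\<exists>\<alpha>. bit_linear (bvec {..<d}) (bvec {..<d}) \<alpha> \<and> bij_betw \<alpha> (bvec {..<d}) (bvec {..<d}) \<and>
        (\<forall>v\<in>bvec {..<d}. \<forall>x\<in>topspace (small_cover P lam).
           h (small_cover_act P lam v x) = small_cover_act Q lam' (\<alpha> v) (h x))) \<and>
     (\<forall>x\<in>topspace (small_cover P lam). orbit_point (h x) = f (orbit_point x))"

definition DJ_equivalent ::
  "nat \<Rightarrow> ('p, 'f) faceted_space \<Rightarrow> (('f \<Rightarrow> bit) \<Rightarrow> nat \<Rightarrow> bit) \<Rightarrow> (('f \<Rightarrow> bit) \<Rightarrow> nat \<Rightarrow> bit) \<Rightarrow> bool" where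
  "DJ_equivalent d P lam lam' \<longleftrightarrow> (\<exists>h. weakly_equivariant_homeo d P lam P lam' (\<lambda>p. p) h)"

text \<open>Facet \<open>F\<close> of \<open>Q\<close> is renamed \<open>\<tau> F\<close> in \<open>P\<close>; the relabelled map is the linear map taking the
  basis vector of \<open>F\<close> to \<open>lam\<close> of the basis vector of \<open>\<tau> F\<close>.\<close>

definition relabel ::
  "('q, 'e) faceted_space \<Rightarrow> ('e \<Rightarrow> 'f) \<Rightarrow> (('f \<Rightarrow> bit) \<Rightarrow> nat \<Rightarrow> bit) \<Rightarrow> ('e \<Rightarrow> bit) \<Rightarrow> nat \<Rightarrow> bit" where
  "relabel Q \<tau> lam = (\<lambda>g. lam (\<Sum>F\<in>facets Q. bscale (g F) (unit_vec (\<tau> F))))"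

definition facet_homeo ::
  "('p, 'f) faceted_space \<Rightarrow> ('q, 'e) faceted_space \<Rightarrow> ('e \<Rightarrow> 'f) \<Rightarrow> ('p \<Rightarrow> 'q) \<Rightarrow> bool" where
  "facet_homeo P Q \<tau> f \<longleftrightarrow>
     homeomorphic_map (points P) (points Q) f \<and> bij_betw \<tau> (facets Q) (facets P) \<and>
     (\<forall>F\<in>facets Q. f ` facet P (\<tau> F) = facet Q F)"


section \<open>Factor-compatibility\<close>

definition factor_weight :: "(nat \<Rightarrow> nat) \<Rightarrow> nat \<Rightarrow> nat \<times> nat \<Rightarrow> bit" where
  "factor_weight m i = (\<Sum>j<m i. unit_vec (i, j))"

text \<open>The interval directions of the cube part: direction \<open>(i, 0)\<close> of a square factor \<open>i\<close> is bounded
  by its sides \<open>0\<close> and \<open>2\<close>, direction \<open>(i, 1)\<close> by its sides \<open>1\<close> and \<open>3\<close>.\<close>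

definition directions :: "nat \<Rightarrow> (nat \<Rightarrow> nat) \<Rightarrow> (nat \<times> nat) set" where
  "directions n m = {(i, e). i < n \<and> m i = 4 \<and> e < 2}"

definition direction_weight :: "nat \<times> nat \<Rightarrow> nat \<times> nat \<Rightarrow> bit" where
  "direction_weight = (\<lambda>(i, e). unit_vec (i, e) + unit_vec (i, e + 2))"

text \<open>A regrouping is a permutation \<open>s\<close> of the interval directions: the new square at position \<open>i\<close>
  has the interval directions \<open>s (i, 0)\<close> and \<open>s (i, 1)\<close>. Every partition of the directions into
  pairs arises in this way.\<close>

definition compatible_regrouping ::
  "nat \<Rightarrow> (nat \<Rightarrow> nat) \<Rightarrow> ((nat \<times> nat \<Rightarrow> bit) \<Rightarrow> nat \<Rightarrow> bit) \<Rightarrow> (nat \<times> nat \<Rightarrow> nat \<times> nat) \<Rightarrow> bool" where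
  "compatible_regrouping n m lam s \<longleftrightarrow>
     s permutes directions n m \<and>
     (\<forall>i<n. m i \<noteq> 4 \<longrightarrow> factor_weight m i \<in> row_space (polygon_product n m) (2 * n) lam) \<and>
     (\<forall>i<n. m i = 4 \<longrightarrow>
        direction_weight (s (i, 0)) + direction_weight (s (i, 1))
          \<in> row_space (polygon_product n m) (2 * n) lam)"

definition factor_compatible ::
  "nat \<Rightarrow> (nat \<Rightarrow> nat) \<Rightarrow> ((nat \<times> nat \<Rightarrow> bit) \<Rightarrow> nat \<Rightarrow> bit) \<Rightarrow> bool" where
  "factor_compatible n m lam \<longleftrightarrow> (\<exists>s. compatible_regrouping n m lam s)"

text \<open>The old name of facet \<open>(i, j)\<close> of the regrouped product: side \<open>j\<close> of a square is end \<open>j div 2\<close>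
  of its direction \<open>j mod 2\<close>.\<close>

definition regroup_facet ::
  "(nat \<Rightarrow> nat) \<Rightarrow> (nat \<times> nat \<Rightarrow> nat \<times> nat) \<Rightarrow> nat \<times> nat \<Rightarrow> nat \<times> nat" where
  "regroup_facet m s = (\<lambda>(i, j).
     if m i = 4 then (let (a, e) = s (i, j mod 2) in (a, e + 2 * (j div 2))) else (i, j))"

definition regrouped ::
  "nat \<Rightarrow> (nat \<Rightarrow> nat) \<Rightarrow> (nat \<times> nat \<Rightarrow> nat \<times> nat) \<Rightarrow>
   ((nat \<times> nat \<Rightarrow> bit) \<Rightarrow> nat \<Rightarrow> bit) \<Rightarrow> (nat \<times> nat \<Rightarrow> bit) \<Rightarrow> nat \<Rightarrow> bit" where
  "regrouped n m s lam = relabel (polygon_product n m) (regroup_facet m s) lam"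

text \<open>The regrouped small cover is the original one, with the polytope reread through a
  homeomorphism matching the old facets with the new ones.\<close>

definition regrouping_identifies ::
  "nat \<Rightarrow> (nat \<Rightarrow> nat) \<Rightarrow> (nat \<times> nat \<Rightarrow> nat \<times> nat) \<Rightarrow> ((nat \<times> nat \<Rightarrow> bit) \<Rightarrow> nat \<Rightarrow> bit) \<Rightarrow> bool" where
  "regrouping_identifies n m s lam \<longleftrightarrow>
     (\<exists>f h. facet_homeo (polygon_product n m) (polygon_product n m) (regroup_facet m s) f \<and>
        weakly_equivariant_homeo (2 * n) (polygon_product n m) lam
          (polygon_product n m) (regrouped n m s lam) f h)"


section \<open>Orientable surfaces\<close>

text \<open>For open \<open>S\<close> this is the usual notion: all iterated directional derivatives up to order \<open>k\<close>
  exist and are continuous.\<close>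

primrec Ck_on ::
  "nat \<Rightarrow> 'a::real_normed_vector set \<Rightarrow> ('a \<Rightarrow> 'b::real_normed_vector) \<Rightarrow> bool" where
  "Ck_on 0 S f \<longleftrightarrow> continuous_on S f"
| "Ck_on (Suc k) S f \<longleftrightarrow>
     f differentiable_on S \<and> (\<forall>v. Ck_on k S (\<lambda>x. frechet_derivative f (at x) v))"

definition surface_chart :: "'a topology \<Rightarrow> 'a set \<Rightarrow> ('a \<Rightarrow> real ^ 2) \<Rightarrow> bool" where
  "surface_chart X U h \<longleftrightarrow>
     openin X U \<and> open (h ` U) \<and> homeomorphic_map (subtopology X U) (top_of_set (h ` U)) h"

text \<open>The surface has a smooth atlas all of whose transition maps have positive Jacobian. The atlas
  is not tied to a given smooth structure: orientability of a surface depends only on its topology.\<close>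

definition orientable_surface :: "'a topology \<Rightarrow> bool" where
  "orientable_surface X \<longleftrightarrow>
     (\<exists>\<A> :: ('a set \<times> ('a \<Rightarrow> real ^ 2)) set.
        (\<forall>(U, h)\<in>\<A>. surface_chart X U h) \<and>
        topspace X = (\<Union>(U, h)\<in>\<A>. U) \<and>
        (\<forall>(U, h)\<in>\<A>. \<forall>(V, k)\<in>\<A>.
           (\<forall>r. Ck_on r (h ` (U \<inter> V)) (k \<circ> inv_into U h)) \<and>
           (\<forall>x\<in>h ` (U \<inter> V). det (matrix (frechet_derivative (k \<circ> inv_into U h) (at x))) > 0)))"


section \<open>Equivariant bundles\<close>

text \<open>A fiber bundle \<open>q\<close> from the small cover of dimension \<open>d\<close> over \<open>P\<close> to the one of dimension \<open>e\<close>
  over \<open>Q\<close>, with fiber the small cover of dimension \<open>c\<close> over \<open>R\<close>. The projection is equivariant along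
  the surjective homomorphism \<open>\<phi>\<close> of acting groups, and the local trivializations carry the action
  of the kernel of \<open>\<phi>\<close>, which preserves the fibers, to the action on the small cover over \<open>R\<close>.\<close>

definition equivariant_bundle ::
  "nat \<Rightarrow> ('p, 'f) faceted_space \<Rightarrow> (('f \<Rightarrow> bit) \<Rightarrow> nat \<Rightarrow> bit) \<Rightarrow>
   nat \<Rightarrow> ('q, 'e) faceted_space \<Rightarrow> (('e \<Rightarrow> bit) \<Rightarrow> nat \<Rightarrow> bit) \<Rightarrow>
   nat \<Rightarrow> ('r, 'd) faceted_space \<Rightarrow> (('d \<Rightarrow> bit) \<Rightarrow> nat \<Rightarrow> bit) \<Rightarrow>
   ((('f \<Rightarrow> bit) \<times> 'p) set set \<Rightarrow> (('e \<Rightarrow> bit) \<times> 'q) set set) \<Rightarrow> bool" where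
  "equivariant_bundle d P lam e Q mu c R nu q \<longleftrightarrow>
     continuous_map (small_cover P lam) (small_cover Q mu) q \<and>
     q ` topspace (small_cover P lam) = topspace (small_cover Q mu) \<and>
     (\<exists>\<phi> \<theta>.
        bit_linear (bvec {..<d}) (bvec {..<e}) \<phi> \<and> \<phi> ` bvec {..<d} = bvec {..<e} \<and>
        (\<forall>v\<in>bvec {..<d}. \<forall>x\<in>topspace (small_cover P lam).
           q (small_cover_act P lam v x) = small_cover_act Q mu (\<phi> v) (q x)) \<and>
        bit_linear {v \<in> bvec {..<d}. \<phi> v = 0} (bvec {..<c}) \<theta> \<and>
        bij_betw \<theta> {v \<in> bvec {..<d}. \<phi> v = 0} (bvec {..<c}) \<and>
        (\<forall>b\<in>topspace (small_cover Q mu). \<exists>U h.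
           openin (small_cover Q mu) U \<and> b \<in> U \<and>
           homeomorphic_map
             (subtopology (small_cover P lam) {x \<in> topspace (small_cover P lam). q x \<in> U})
             (prod_topology (subtopology (small_cover Q mu) U) (small_cover R nu)) h \<and>
           (\<forall>x\<in>topspace (small_cover P lam). q x \<in> U \<longrightarrow>
              fst (h x) = q x \<and>
              (\<forall>v\<in>bvec {..<d}. \<phi> v = 0 \<longrightarrow>
                 snd (h (small_cover_act P lam v x)) = small_cover_act R nu (\<theta> v) (snd (h x))))))"

text \<open>The permutation \<open>\<pi>\<close> reorders the polygon factors; \<open>L i\<close> defines the \<open>i\<close>-th stage of the tower,
  which for \<open>i = 0\<close> is the small cover over a point, itself a point; \<open>nu i\<close> defines the fiber of
  stage \<open>i + 1\<close> over stage \<open>i\<close>.\<close>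

definition iterated_orientable_bundle ::
  "nat \<Rightarrow> (nat \<Rightarrow> nat) \<Rightarrow> ((nat \<times> nat \<Rightarrow> bit) \<Rightarrow> nat \<Rightarrow> bit) \<Rightarrow> bool" where
  "iterated_orientable_bundle n m lam \<longleftrightarrow>
     (\<exists>\<pi> L nu q. \<pi> permutes {..<n} \<and>
        (\<forall>i\<le>n. characteristic_map (polygon_product i (m \<circ> \<pi>)) (2 * i) (L i)) \<and>
        DJ_equivalent (2 * n) (polygon_product n (m \<circ> \<pi>)) (L n)
          (relabel (polygon_product n (m \<circ> \<pi>)) (\<lambda>(i, j). (\<pi> i, j)) lam) \<and>
        (\<forall>i<n. characteristic_map (polygon (m (\<pi> i))) 2 (nu i) \<and>
           orientable_surface (small_cover (polygon (m (\<pi> i))) (nu i)) \<and>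
           equivariant_bundle
             (2 * Suc i) (polygon_product (Suc i) (m \<circ> \<pi>)) (L (Suc i))
             (2 * i) (polygon_product i (m \<circ> \<pi>)) (L i)
             2 (polygon (m (\<pi> i))) (nu i) (q i)))"

end

theory Submission
  imports Defs
begin

text \<open>Let \<open>v (k, j)\<close> be the value of the characteristic map at facet \<open>(k, j)\<close> of the regrouped product.
  Functionals witnessing that the factor weights lie in the row space kill all differences
  \<open>w (k, j) = v (k, j) + v (k, j + 1)\<close>, and the vertices of the product show that every choice of one
  \<open>w (k, j)\<close> for each factor \<open>k\<close> is a basis of their common kernel. Over the field with two elements
  this forces the factors to admit an order in which, up to later factors, all \<open>w (k, j)\<close> with the
  same \<open>k\<close> agree. In suitable coordinates the characteristic map is therefore block triangular, with
  every polygon coloured alternatingly by two colours, and all polygons have an even number of sides.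
  A block triangular map gives a bundle: over the open star of a point the off-diagonal block is
  absorbed into a translation of the fiber. The small cover of an alternatingly coloured polygon
  has an oriented atlas with one chart per corner, whose coordinates are the signed square roots of
  the distances to the two adjacent sides.\<close>


text \<open>The common kernel has dimension \<open>n\<close>: the functional of factor
  \<open>i\<close> is 1 on all facets of that factor and 0 on all others, so the \<open>n\<close>
  functionals are independent on a space of dimension \<open>2 * n\<close>. The ordering of the
  factors rests on the field having two elements: over a larger field a line contains two different
  nonzero vectors, so already a single factor could have several different \<open>w\<close>; over
  two elements distinct nonzero vectors are independent, and this feeds a counting argument.

  Two obstacles are topological. A product of quotient maps need not be a quotient map, yet a
  trivialization compares a quotient of a product with a product of quotients; hence the maps from
  copies of the polytope onto a small cover are shown to be perfect. And charts made of signed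
  distances would not be smooth across a side, because the distances to other sides depend on
  absolute values of coordinates; with signed square roots they depend on squares.\<close>

declare add_bit_eq_xor [simp del] mult_bit_eq_and [simp del]

section \<open>Vectors over the field with two elements\<close>

lemma bit_add_self [simp]: "(b::bit) + b = 0"
  by (cases b) auto

lemma bit_add_self_left [simp]: "(b::bit) + (b + c) = c"
  by (cases b; cases c) auto

lemma bit_vec_add_self [simp]: "(v :: 'a \<Rightarrow> bit) + v = 0"
  by (simp add: fun_eq_iff)

lemma bit_vec_add_self_left [simp]: "(v :: 'a \<Rightarrow> bit) + (v + w) = w"
  by (simp add: add.assoc[symmetric])

lemma bit_vec_add_self_right [simp]: "(w :: 'a \<Rightarrow> bit) + v + v = w"
  by (simp add: add.assoc)

lemma bit_vec_add_eq_0_iff: "(v :: 'a \<Rightarrow> bit) + w = 0 \<longleftrightarrow> v = w"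
  by (metis bit_vec_add_self bit_vec_add_self_left add.right_neutral)

lemma bit_vec_add_eq_iff: "(u :: 'a \<Rightarrow> bit) + v = w \<longleftrightarrow> u = v + w"
  by (metis bit_vec_add_self_left add.commute)

lemmas bit_vec_ac = ac_simps bit_vec_add_self_left bit_vec_add_self add.right_neutral add.left_neutral

lemma sum_fun_apply: "(\<Sum>i\<in>A. f i) x = (\<Sum>i\<in>A. f i x)"
  by (induction A rule: infinite_finite_induct) auto

lemma bscale_0 [simp]: "bscale 0 v = 0" and bscale_1 [simp]: "bscale 1 v = v"
  by (auto simp: bscale_def)

lemma bscale_apply: "bscale c v x = c * v x"
  by (simp add: bscale_def)

lemma bvec_0 [simp]: "0 \<in> bvec A"
  by (simp add: bvec_def)

lemma bvec_add [simp]: "v \<in> bvec A \<Longrightarrow> w \<in> bvec A \<Longrightarrow> v + w \<in> bvec A"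
  by (simp add: bvec_def)

lemma bvec_bscale [simp]: "v \<in> bvec A \<Longrightarrow> bscale c v \<in> bvec A"
  by (simp add: bvec_def bscale_def)

lemma bvec_sum: "(\<And>i. i \<in> I \<Longrightarrow> f i \<in> bvec A) \<Longrightarrow> sum f I \<in> bvec A"
  by (induction I rule: infinite_finite_induct) auto

lemma bvec_mono: "A \<subseteq> B \<Longrightarrow> bvec A \<subseteq> bvec B"
  by (auto simp: bvec_def)

lemma unit_vec_apply: "unit_vec a x = (if x = a then 1 else 0)"
  by (simp add: unit_vec_def indicator_def)

lemma unit_vec_in_bvec [simp]: "unit_vec a \<in> bvec A \<longleftrightarrow> a \<in> A"
  by (auto simp: bvec_def unit_vec_apply)

lemma sum_bscale_unit_vec:
  assumes "finite A" "g \<in> bvec A"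
  shows "(\<Sum>a\<in>A. bscale (g a) (unit_vec a)) = g"
  using assms by (auto simp: fun_eq_iff sum_fun_apply bscale_def unit_vec_apply bvec_def if_distrib cong: if_cong)

lemma sum_bscale_eq_sum_support:
  fixes f :: "'a \<Rightarrow> 'b \<Rightarrow> bit"
  assumes "finite A"
  shows "(\<Sum>a\<in>A. bscale (g a) (f a)) = (\<Sum>a\<in>{a \<in> A. g a = 1}. f a)"
proof -
  have "(\<Sum>a\<in>A. bscale (g a) (f a)) = (\<Sum>a\<in>A. if g a = 1 then f a else 0)"
    by (rule sum.cong) auto
  then show ?thesis using assms by (simp add: sum.inter_filter)
qed

lemma bvec_subset_sums:
  assumes "finite A" shows "bvec A \<subseteq> (\<lambda>K. \<Sum>a\<in>K. unit_vec a) ` Pow A"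
proof
  fix g assume "g \<in> bvec A"
  then have "g = (\<Sum>a\<in>{a \<in> A. g a = 1}. unit_vec a)"
    using sum_bscale_unit_vec[OF assms] sum_bscale_eq_sum_support[OF assms] by metis
  then show "g \<in> (\<lambda>K. \<Sum>a\<in>K. unit_vec a) ` Pow A" by auto
qed

lemma finite_bvec: "finite A \<Longrightarrow> finite (bvec A)"
  by (rule finite_subset[OF bvec_subset_sums]) simp_all

lemma card_bvec_le: "finite A \<Longrightarrow> card (bvec A) \<le> 2 ^ card A"
  using bvec_subset_sums by (metis surj_card_le card_Pow finite_Pow_iff)

text \<open>Makes the span in \<open>mirror_relation\<close> explicit: the identifications over a
  point are the translations by all vectors supported on the facets through it.\<close>

lemma span_unit_vec: assumes "finite A" shows "bitvec.span (unit_vec ` A) = bvec A"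
proof
  have "bitvec.subspace (bvec A)"
    by (simp add: bitvec.subspace_def)
  then show "bitvec.span (unit_vec ` A) \<subseteq> bvec A"
    by (intro bitvec.span_minimal) auto
next
  show "bvec A \<subseteq> bitvec.span (unit_vec ` A)"
  proof
    fix g assume "g \<in> bvec A"
    then have "g = (\<Sum>a\<in>A. bscale (g a) (unit_vec a))"
      using sum_bscale_unit_vec[OF assms] by metis
    also have "\<dots> \<in> bitvec.span (unit_vec ` A)"
      by (intro bitvec.span_sum bitvec.span_scale bitvec.span_base) auto
    finally show "g \<in> bitvec.span (unit_vec ` A)" .
  qed
qed

text \<open>With coefficients 0 and 1 a linear relation is a subset with sum 0. Injectivity is part
  of the left-hand side because \<open>independent\<close> speaks about the image, in which a
  repeated vector is lost; a repetition is a two-element subset with sum 0.\<close>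

lemma independent_family_iff:
  fixes f :: "'a \<Rightarrow> 'b \<Rightarrow> bit"
  assumes "finite S"
  shows "inj_on f S \<and> bitvec.independent (f ` S) \<longleftrightarrow> (\<forall>T\<subseteq>S. sum f T = 0 \<longrightarrow> T = {})"
proof (intro iffI conjI allI impI)
  fix T assume *: "inj_on f S \<and> bitvec.independent (f ` S)" and T: "T \<subseteq> S" "sum f T = 0"
  have inj: "inj_on f T" using * T inj_on_subset by blast
  have ind: "bitvec.independent (f ` T)" using * T bitvec.independent_mono image_mono by metis
  have fin: "finite (f ` T)" using assms T finite_subset by blast
  have "\<forall>v\<in>f ` T. u v = 0" if "(\<Sum>v\<in>f ` T. bscale (u v) v) = 0" for u
    using ind that unfolding bitvec.dependent_finite[OF fin] by blast
  \<comment> \<open>The constant coefficient 1 turns the subset sum into a linear relation, so a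
    nonempty \<open>T\<close> would force 1 = 0.\<close>
  from this[of "\<lambda>_. 1"] have "\<forall>v\<in>f ` T. (1::bit) = 0"
    unfolding bscale_1 sum.reindex[OF inj] using T by (simp add: comp_def)
  then show "T = {}" by auto
next
  assume *: "\<forall>T\<subseteq>S. sum f T = 0 \<longrightarrow> T = {}"
  show inj: "inj_on f S"
  proof (rule inj_onI, rule ccontr)
    fix x y assume "x \<in> S" "y \<in> S" "f x = f y" "x \<noteq> y"
    then have "sum f {x, y} = 0" "{x, y} \<subseteq> S" by auto
    then show False using * by blast
  qed
  show "bitvec.independent (f ` S)"
  proof
    assume "bitvec.dependent (f ` S)"
    then obtain u v where u: "v \<in> S" "u (f v) \<noteq> 0" "(\<Sum>v\<in>f ` S. bscale (u v) v) = 0"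
      unfolding bitvec.dependent_finite[OF finite_imageI[OF assms]] by blast
    have "(\<Sum>x\<in>S. bscale (u (f x)) (f x)) = 0" using u(3) unfolding sum.reindex[OF inj] by (simp add: comp_def)
    then have "sum f {x \<in> S. u (f x) = 1} = 0"
      by (subst (asm) sum_bscale_eq_sum_support[OF assms])
    moreover have "{x \<in> S. u (f x) = 1} \<subseteq> S" by blast
    ultimately have "{x \<in> S. u (f x) = 1} = {}" using * by blast
    then show False using u by auto
  qed
qed

section \<open>Additive maps of coordinate spaces\<close>

lemma bit_linear_0: "bit_linear (bvec A) W f \<Longrightarrow> f 0 = 0"
  using bvec_0 unfolding bit_linear_def by (metis add.right_neutral bit_vec_add_self)

lemma bit_linear_add:
  "bit_linear (bvec A) W f \<Longrightarrow> x \<in> bvec A \<Longrightarrow> y \<in> bvec A \<Longrightarrow> f (x + y) = f x + f y"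
  by (simp add: bit_linear_def)

lemma bit_linear_in: "bit_linear V W f \<Longrightarrow> x \<in> V \<Longrightarrow> f x \<in> W"
  by (auto simp: bit_linear_def)

lemma bit_linear_bscale:
  "bit_linear (bvec A) W f \<Longrightarrow> x \<in> bvec A \<Longrightarrow> f (bscale c x) = bscale c (f x)"
  by (cases c) (auto simp: bit_linear_0)

lemma bit_linear_sum:
  "bit_linear (bvec A) W f \<Longrightarrow> (\<And>i. i \<in> I \<Longrightarrow> g i \<in> bvec A) \<Longrightarrow> f (\<Sum>i\<in>I. g i) = (\<Sum>i\<in>I. f (g i))"
  by (induction I rule: infinite_finite_induct) (auto simp: bit_linear_0 bit_linear_add bvec_sum)

lemma bit_linear_expand:
  assumes "bit_linear (bvec A) W f" "finite A" "g \<in> bvec A"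
  shows "f g = (\<Sum>a\<in>A. bscale (g a) (f (unit_vec a)))"
proof -
  have "f g = f (\<Sum>a\<in>A. bscale (g a) (unit_vec a))"
    using sum_bscale_unit_vec assms by metis
  then show ?thesis
    using assms by (simp add: bit_linear_sum bit_linear_bscale)
qed

section \<open>Families of transversal bases\<close>

text \<open>Every choice of one element from each \<open>S i\<close> is a basis of \<open>W\<close> modulo \<open>U\<close>.\<close>

definition transversal_bases ::
  "'i set \<Rightarrow> ('i \<Rightarrow> ('a \<Rightarrow> bit) set) \<Rightarrow> ('a \<Rightarrow> bit) set \<Rightarrow> ('a \<Rightarrow> bit) set \<Rightarrow> bool" where
  "transversal_bases I S U W \<longleftrightarrow>
     0 \<in> U \<and> (\<forall>x\<in>U. \<forall>y\<in>U. x + y \<in> U) \<and> (\<forall>i\<in>I. S i \<subseteq> W) \<and>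
     (\<forall>x. (\<forall>i\<in>I. x i \<in> S i) \<longrightarrow>
        (\<forall>K\<subseteq>I. sum x K \<in> U \<longrightarrow> K = {}) \<and> (\<forall>w\<in>W. \<exists>K\<subseteq>I. w + sum x K \<in> U))"

text \<open>Over two elements the subspace spanned by \<open>U\<close> and \<open>u\<close> is
  \<open>U\<close> together with its translate by \<open>u\<close>. A choice on the remaining
  indices is completed by \<open>u\<close> at index \<open>j\<close>; a relation or an expansion
  modulo the larger subspace is one modulo \<open>U\<close> in which \<open>j\<close> may
  occur.\<close>

lemma transversal_bases_quotient:
  assumes fin: "finite I" and T: "transversal_bases I S U W" and j: "j \<in> I" and u: "u \<in> S j"
  shows "transversal_bases (I - {j}) S (U \<union> (+) u ` U) W"
proof -
  have add: "x + y \<in> U" if "x \<in> U" "y \<in> U" for x y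
    using T that by (auto simp: transversal_bases_def)
  have "(\<forall>K\<subseteq>I - {j}. sum x K \<in> U \<union> (+) u ` U \<longrightarrow> K = {}) \<and>
      (\<forall>w\<in>W. \<exists>K\<subseteq>I - {j}. w + sum x K \<in> U \<union> (+) u ` U)"
    if x: "\<forall>i\<in>I - {j}. x i \<in> S i" for x
  proof -
    let ?y = "x(j := u)"
    have y: "\<forall>i\<in>I. ?y i \<in> S i" using x u by auto
    have indep: "K \<subseteq> I \<Longrightarrow> sum ?y K \<in> U \<Longrightarrow> K = {}"
      and spans: "w \<in> W \<Longrightarrow> \<exists>K\<subseteq>I. w + sum ?y K \<in> U" for K w
      using T y unfolding transversal_bases_def by blast+
    have eq: "sum ?y K = sum x K" if "j \<notin> K" for K
      using that by (intro sum.cong) auto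
    have ins: "sum ?y (insert j K) = u + sum x K" if "K \<subseteq> I - {j}" for K
    proof -
      have "finite K" "j \<notin> K" using that fin finite_subset[of K I] by auto
      then show ?thesis using eq by simp
    qed
    show ?thesis
    proof (intro conjI allI impI ballI)
      fix K assume K: "K \<subseteq> I - {j}" "sum x K \<in> U \<union> (+) u ` U"
      then consider "sum x K \<in> U" | z where "z \<in> U" "sum x K = u + z" by auto
      then show "K = {}"
      proof cases
        case 1
        have K': "K \<subseteq> I" "j \<notin> K" using K by auto
        from 1 have "sum ?y K \<in> U" unfolding eq[OF K'(2)] .
        then show ?thesis by (rule indep[OF K'(1)])
      next
        case 2
        then have "sum ?y (insert j K) \<in> U" using ins[of K] K by simp
        then show ?thesis using indep[of "insert j K"] K j by auto
      qed
    next
      fix w assume "w \<in> W"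
      then obtain K where K: "K \<subseteq> I" "w + sum ?y K \<in> U" using spans by blast
      show "\<exists>K\<subseteq>I - {j}. w + sum x K \<in> U \<union> (+) u ` U"
      proof (cases "j \<in> K")
        case True
        then have "sum ?y K = u + sum x (K - {j})"
          using ins[of "K - {j}"] K by (simp add: insert_absorb Diff_mono)
        then have "w + sum x (K - {j}) = u + (w + sum ?y K)" by (simp add: algebra_simps)
        then show ?thesis using K by (intro exI[of _ "K - {j}"]) auto
      next
        case False
        then show ?thesis using K eq[of K] by (intro exI[of _ K]) auto
      qed
    qed
  qed
  moreover have "x + y \<in> U \<union> (+) u ` U" if "x \<in> U \<union> (+) u ` U" "y \<in> U \<union> (+) u ` U" for x y
  proof -
    from that consider "x \<in> U" "y \<in> U" | z where "z \<in> U" "y \<in> U" "x = u + z"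
      | z where "z \<in> U" "x \<in> U" "y = u + z" | z z' where "z \<in> U" "z' \<in> U" "x = u + z" "y = u + z'"
      by auto
    then show ?thesis
    proof cases
      case 1 then show ?thesis using add by auto
    next
      case (2 z)
      then have "x + y = u + (z + y)" by (simp add: add.assoc)
      then show ?thesis using add[OF 2(1,2)] by auto
    next
      case (3 z)
      then have "x + y = u + (z + x)" by (simp add: ac_simps)
      then show ?thesis using add[OF 3(1,2)] by blast
    next
      case (4 z z')
      then have "x + y = z + z'" by (simp add: ac_simps)
      then show ?thesis using add[OF 4(1,2)] by auto
    qed
  qed
  ultimately show ?thesis
    using T unfolding transversal_bases_def by auto
qed

text \<open>Otherwise pick \<open>a k, b k \<in> S k\<close> distinct modulo \<open>U\<close>. Dividing by any of these \<open>2 * card I\<close>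
  vectors \<open>u\<close>, induction yields an index \<open>k\<close> with \<open>a k + b k = u\<close> modulo \<open>U\<close>. This determines \<open>u\<close>
  by \<open>k\<close>, which is impossible for cardinality reasons.\<close>

lemma transversal_bases_exists_constant:
  assumes "finite I" "I \<noteq> {}" "transversal_bases I S U W"
  shows "\<exists>k\<in>I. \<forall>a\<in>S k. \<forall>b\<in>S k. a + b \<in> U"
  using assms
proof (induction "card I" arbitrary: I U rule: less_induct)
  case less
  note T = less.prems(3)
  have add: "x + y \<in> U" if "x \<in> U" "y \<in> U" for x y
    using T that by (auto simp: transversal_bases_def)
  show ?case
  proof (rule ccontr)
    assume "\<not> ?thesis"
    then have "\<forall>k\<in>I. \<exists>ab. fst ab \<in> S k \<and> snd ab \<in> S k \<and> fst ab + snd ab \<notin> U"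
      unfolding split_paired_Ex by simp blast
    then obtain ab where ab: "\<And>k. k \<in> I \<Longrightarrow> fst (ab k) \<in> S k \<and> snd (ab k) \<in> S k \<and> fst (ab k) + snd (ab k) \<notin> U"
      by metis
    \<comment> \<open>The \<open>2 * card I\<close> vectors of the counting argument, indexed by an
      index and a flag.\<close>
    define sel where "sel = (\<lambda>(j, e). if e then fst (ab j) else snd (ab j))"
    have sel: "sel (j, e) \<in> S j" if "j \<in> I" for j e using ab[OF that] by (simp add: sel_def)
    have indep: "K = {}" if "\<forall>i\<in>I. x i \<in> S i" "K \<subseteq> I" "sum x K \<in> U" for x K
      using T that unfolding transversal_bases_def by blast
    have spans: "\<exists>K\<subseteq>I. w + sum x K \<in> U" if "\<forall>i\<in>I. x i \<in> S i" "w \<in> W" for x w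
      using T that unfolding transversal_bases_def by blast
    have SW: "S i \<subseteq> W" if "i \<in> I" for i using T that by (auto simp: transversal_bases_def)
    have "\<exists>k\<in>I. fst (ab k) + snd (ab k) + sel p \<in> U" if p: "p \<in> I \<times> UNIV" for p
    proof -
      obtain j e where [simp]: "p = (j, e)" and j: "j \<in> I" using p by auto
      \<comment> \<open>The induction hypothesis needs an index left over. With a single one,
        \<open>W\<close> modulo \<open>U\<close> has only one nonzero class, so the two chosen
        vectors would agree modulo \<open>U\<close>.\<close>
      have ne: "I - {j} \<noteq> {}"
      proof
        assume "I - {j} = {}"
        then have I: "I = {j}" using j by auto
        have "\<exists>K\<subseteq>I. snd (ab j) + sum (\<lambda>i. fst (ab i)) K \<in> U"
          using ab SW j by (intro spans) auto
        then obtain K where K: "K \<subseteq> {j}" "snd (ab j) + sum (\<lambda>i. fst (ab i)) K \<in> U" using I by auto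
        from K(1) have "K = {} \<or> K = {j}" by auto
        then show False
        proof
          assume "K = {}"
          then have "sum (\<lambda>i. snd (ab i)) {j} \<in> U" using K by simp
          then show False using indep[of "\<lambda>i. snd (ab i)" "{j}"] ab I by auto
        next
          assume "K = {j}"
          then show False using K ab[OF j] by (simp add: add.commute)
        qed
      qed
      have "card (I - {j}) < card I" using j less.prems(1) by (metis card_Diff1_less)
      moreover have "transversal_bases (I - {j}) S (U \<union> (+) (sel p) ` U) W"
        using transversal_bases_quotient[OF less.prems(1) T j] sel[OF j] by simp
      ultimately obtain k where k: "k \<in> I - {j}"
        and "\<forall>a\<in>S k. \<forall>b\<in>S k. a + b \<in> U \<union> (+) (sel p) ` U"
        using less.hyps[of "I - {j}"] less.prems(1) ne by blast
      then have "fst (ab k) + snd (ab k) \<in> U \<union> (+) (sel p) ` U" using ab by blast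
      \<comment> \<open>Constancy modulo the larger subspace puts the sum into \<open>U\<close> or
        its translate by \<open>sel p\<close>; the choice of \<open>ab\<close> excludes
        \<open>U\<close>.\<close>
      then have "fst (ab k) + snd (ab k) \<in> (+) (sel p) ` U" using ab k by blast
      then obtain z where "z \<in> U" "fst (ab k) + snd (ab k) = sel p + z" by auto
      then have "fst (ab k) + snd (ab k) + sel p \<in> U" by (simp add: ac_simps)
      then show ?thesis using k by blast
    qed
    then obtain f where f: "\<And>p. p \<in> I \<times> UNIV \<Longrightarrow> f p \<in> I \<and> fst (ab (f p)) + snd (ab (f p)) + sel p \<in> U"
      by metis
    have "inj_on f (I \<times> (UNIV :: bool set))"
    proof (rule inj_onI)
      fix p q :: "'a \<times> bool" assume pq: "p \<in> I \<times> UNIV" "q \<in> I \<times> UNIV" "f p = f q"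
      let ?d = "fst (ab (f p)) + snd (ab (f p))"
      have "(?d + sel p) + (?d + sel q) \<in> U"
        by (rule add) (use f[OF pq(1)] f[OF pq(2)] pq(3) in simp_all)
      moreover have "(?d + sel p) + (?d + sel q) = sel p + sel q"
        by (simp only: bit_vec_ac)
      ultimately have s: "sel p + sel q \<in> U" by simp
      obtain j e j' e' where [simp]: "p = (j, e)" "q = (j', e')" by (metis surj_pair)
      have jj: "j \<in> I" "j' \<in> I" using pq by auto
      show "p = q"
      proof (cases "j = j'")
        case True
        have "e = e'"
        proof (rule ccontr)
          assume "e \<noteq> e'"
          then have "sel p + sel q = fst (ab j) + snd (ab j)"
            using True by (cases e; cases e') (simp_all add: sel_def add.commute)
          then show False using s ab jj by simp
        qed
        then show ?thesis using True by simp
      next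
        case False
        \<comment> \<open>A choice through both vectors: it takes \<open>sel q\<close> at
          \<open>j'\<close>, and \<open>sel p\<close> at \<open>j\<close> because \<open>e\<close>
          is the flag of \<open>p\<close>.\<close>
        define x where "x = (\<lambda>i. if i = j' then sel q else sel (i, e))"
        have "\<forall>i\<in>I. x i \<in> S i" using sel jj by (auto simp: x_def)
        moreover have "sum x {j, j'} = sel p + sel q" using False by (simp add: x_def)
        ultimately have "{j, j'} = {}" using s jj indep[of x "{j, j'}"] by simp
        then show ?thesis by simp
      qed
    qed
    moreover have "f ` (I \<times> UNIV) \<subseteq> I" using f by blast
    ultimately have "card (I \<times> (UNIV :: bool set)) \<le> card I"
      using less.prems(1) card_inj_on_le by blast
    then show False using less.prems(1,2) by (simp add: card_cartesian_product card_gt_0_iff)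
  qed
qed

text \<open>Repeatedly splits off an index whose set is constant and puts it last, so that the
  others are ordered modulo \<open>U\<close> and \<open>x k\<close>. A sum that vanishes only up to
  \<open>x k\<close> is corrected by adding \<open>k\<close> to \<open>K\<close>, which is allowed
  since \<open>k\<close> comes after every other index.\<close>

lemma transversal_bases_order:
  assumes "finite I" "transversal_bases I S U W" "\<forall>i\<in>I. x i \<in> S i"
  shows "\<exists>\<pi>. bij_betw \<pi> {..<card I} I \<and>
    (\<forall>i<card I. \<forall>a\<in>S (\<pi> i). \<forall>b\<in>S (\<pi> i). \<exists>K\<subseteq>\<pi> ` {i<..<card I}. a + b + sum x K \<in> U)"
  using assms
proof (induction "card I" arbitrary: I U)
  case 0
  then have "I = {}" by simp
  then show ?case by (auto simp: bij_betw_def)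
next
  case (Suc N)
  then have "I \<noteq> {}" by auto
  then obtain k where k: "k \<in> I" "\<forall>a\<in>S k. \<forall>b\<in>S k. a + b \<in> U"
    using transversal_bases_exists_constant[OF Suc.prems(1)] Suc.prems(2) by blast
  have N: "N = card (I - {k})" "card I = Suc N" using k Suc by auto
  have T: "transversal_bases (I - {k}) S (U \<union> (+) (x k) ` U) W"
    by (rule transversal_bases_quotient[OF Suc.prems(1,2) k(1)]) (use Suc.prems k in auto)
  have "\<exists>\<pi>. bij_betw \<pi> {..<N} (I - {k}) \<and> (\<forall>i<N. \<forall>a\<in>S (\<pi> i). \<forall>b\<in>S (\<pi> i).
      \<exists>K\<subseteq>\<pi> ` {i<..<N}. a + b + sum x K \<in> U \<union> (+) (x k) ` U)"
    unfolding N(1) by (rule Suc.hyps(1)[OF N(1) _ T]) (use Suc.prems in auto)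
  then obtain \<pi> where \<pi>: "bij_betw \<pi> {..<N} (I - {k})"
    and ord: "\<And>i a b. i < N \<Longrightarrow> a \<in> S (\<pi> i) \<Longrightarrow> b \<in> S (\<pi> i) \<Longrightarrow>
      \<exists>K\<subseteq>\<pi> ` {i<..<N}. a + b + sum x K \<in> U \<union> (+) (x k) ` U"
    by blast
  define \<rho> where "\<rho> = \<pi>(N := k)"
  have img: "\<rho> ` {i<..<Suc N} = insert k (\<pi> ` {i<..<N})" if "i < N" for i
  proof -
    have "{i<..<Suc N} = insert N {i<..<N}" using that by auto
    then show ?thesis by (auto simp: \<rho>_def)
  qed
  have "bij_betw \<rho> {..<N} (I - {k})" using \<pi> by (rule bij_betw_cong[THEN iffD1, rotated]) (auto simp: \<rho>_def)
  then have "bij_betw \<rho> (insert N {..<N}) (insert (\<rho> N) (I - {k}))"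
    by (intro notIn_Un_bij_betw3[THEN iffD1, of _ _ _ "I - {k}", simplified]) (auto simp: \<rho>_def)
  then have bij: "bij_betw \<rho> {..<Suc N} I" using k by (simp add: \<rho>_def insert_absorb lessThan_Suc)
  have "\<exists>K\<subseteq>\<rho> ` {i<..<Suc N}. a + b + sum x K \<in> U"
    if i: "i < Suc N" and ab: "a \<in> S (\<rho> i)" "b \<in> S (\<rho> i)" for i a b
  proof (cases "i = N")
    case True
    then show ?thesis using k ab by (intro exI[of _ "{}"]) (auto simp: \<rho>_def)
  next
    case False
    then have iN: "i < N" using i by simp
    then obtain K where K: "K \<subseteq> \<pi> ` {i<..<N}" "a + b + sum x K \<in> U \<union> (+) (x k) ` U"
      using ord[of i a b] ab by (auto simp: \<rho>_def)
    then consider "a + b + sum x K \<in> U" | z where "z \<in> U" "a + b + sum x K = x k + z" by auto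
    then show ?thesis
    proof cases
      case 1
      then show ?thesis using K img[OF iN] by blast
    next
      case 2
      have "\<pi> ` {i<..<N} \<subseteq> I - {k}" using \<pi> by (auto simp: bij_betw_def)
      then have "k \<notin> K" "finite K" using K finite_subset by blast+
      then have "a + b + sum x (insert k K) = z" using 2 by (simp add: ac_simps)
      then show ?thesis using 2 K img[OF iN] by (intro exI[of _ "insert k K"]) auto
    qed
  qed
  then show ?case unfolding N(2) using bij by blast
qed

section \<open>Bases obtained by counting subset sums\<close>

lemma bit_vec_double [simp]: "2 * (v :: 'a \<Rightarrow> bit) = 0"
  by (simp only: mult_2 bit_vec_add_self)

lemma sum_symmetric_difference:
  fixes f :: "'a \<Rightarrow> 'b \<Rightarrow> bit"
  assumes "finite S" "finite T"
  shows "sum f S + sum f T = sum f ((S - T) \<union> (T - S))"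
proof -
  have S: "sum f S = sum f (S - T) + sum f (S \<inter> T)"
    using assms by (subst sum.union_disjoint[symmetric]) (auto intro: arg_cong[where f = "sum f"])
  have T: "sum f T = sum f (T - S) + sum f (S \<inter> T)"
    using assms by (subst sum.union_disjoint[symmetric]) (auto intro: arg_cong[where f = "sum f"])
  have "sum f ((S - T) \<union> (T - S)) = sum f (S - T) + sum f (T - S)"
    using assms by (intro sum.union_disjoint) auto
  then show ?thesis
    unfolding S T by (simp only: bit_vec_ac)
qed

text \<open>Distinct subsets have distinct sums, since otherwise their symmetric difference would be
  a relation. These \<open>2 ^ card S\<close> sums fill \<open>bvec A\<close>, which has no more
  elements.\<close>

lemma independent_family_basis:
  fixes f :: "'a \<Rightarrow> 'b \<Rightarrow> bit"
  assumes S: "finite S" and A: "finite A" and card: "card S = card A" and sub: "f ` S \<subseteq> bvec A"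
    and indep: "\<And>T. T \<subseteq> S \<Longrightarrow> sum f T = 0 \<Longrightarrow> T = {}"
  shows "bij_betw (sum f) (Pow S) (bvec A)"
proof -
  have inj: "inj_on (sum f) (Pow S)"
  proof (rule inj_onI)
    fix T T' assume T: "T \<in> Pow S" "T' \<in> Pow S" "sum f T = sum f T'"
    then have "finite T" "finite T'" using S finite_subset by auto
    then have "sum f ((T - T') \<union> (T' - T)) = 0"
      using T(3) sum_symmetric_difference[of T T' f] by simp
    then have "(T - T') \<union> (T' - T) = {}"
      using T by (intro indep) auto
    then show "T = T'" by blast
  qed
  have "sum f ` Pow S \<subseteq> bvec A"
    using sub by (auto intro!: bvec_sum)
  moreover have "card (bvec A) \<le> card (sum f ` Pow S)"
    using card_bvec_le[OF A] card S by (simp add: card_image[OF inj] card_Pow)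
  ultimately have "sum f ` Pow S = bvec A"
    using finite_bvec[OF A] by (simp add: card_seteq)
  then show ?thesis using inj by (simp add: bij_betw_def)
qed

lemma bij_betw_bit_linear_combination:
  fixes f :: "'a \<Rightarrow> 'b \<Rightarrow> bit"
  assumes S: "finite S" and A: "finite A" and card: "card S = card A" and sub: "f ` S \<subseteq> bvec A"
    and indep: "\<And>T. T \<subseteq> S \<Longrightarrow> sum f T = 0 \<Longrightarrow> T = {}"
  shows "bij_betw (\<lambda>g. \<Sum>a\<in>S. bscale (g a) (f a)) (bvec S) (bvec A)"
proof -
  have "bij_betw (\<lambda>g. {a \<in> S. g a = (1::bit)}) (bvec S) (Pow S)"
  proof (rule bij_betwI')
    fix x y :: "'a \<Rightarrow> bit" assume xy: "x \<in> bvec S" "y \<in> bvec S"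
    have "x = y" if eq: "{a \<in> S. x a = 1} = {a \<in> S. y a = 1}"
    proof
      fix a
      have "x a = 1 \<longleftrightarrow> y a = 1" if "a \<in> S" using eq that by blast
      then show "x a = y a"
        using xy by (cases "a \<in> S"; cases "x a"; cases "y a") (auto simp: bvec_def)
    qed
    then show "({a \<in> S. x a = 1} = {a \<in> S. y a = 1}) = (x = y)" by blast
  next
    fix T assume "T \<in> Pow S"
    then show "\<exists>x\<in>bvec S. T = {a \<in> S. x a = (1::bit)}"
      by (intro bexI[of _ "indicator T"]) (auto simp: indicator_def bvec_def)
  qed auto
  from bij_betw_trans[OF this independent_family_basis[OF assms]]
  show ?thesis
    by (simp add: sum_bscale_eq_sum_support[OF S] comp_def)
qed

lemma bit_linear_combination:
  assumes "\<And>a. a \<in> S \<Longrightarrow> f a \<in> bvec A"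
  shows "bit_linear V (bvec A) (\<lambda>g. \<Sum>a\<in>S. bscale (g a) (f a))"
  using assms
  by (auto simp: bit_linear_def bitvec.scale_left_distrib sum.distrib intro!: bvec_sum)

lemma combination_unit_vec:
  assumes "finite S" "b \<in> S"
  shows "(\<Sum>a\<in>S. bscale (unit_vec b a) (f a)) = f b"
proof -
  have "(\<Sum>a\<in>S. bscale (unit_vec b a) (f a)) = (\<Sum>a\<in>S. if a = b then f a else 0)"
    by (rule sum.cong) (auto simp: unit_vec_apply)
  then show ?thesis using assms by simp
qed

section \<open>The triangular form of a characteristic map\<close>

text \<open>What is extracted from a characteristic map and from factor-compatibility: additive
  functionals, \<open>\<xi> i\<close> being 1 on factor \<open>i\<close> and 0 elsewhere, and
  independence at every vertex. A vertex is a choice of a corner \<open>c k\<close> in each polygon,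
  where the sides \<open>c k\<close> and \<open>Suc (c k) mod m k\<close> meet.\<close>

locale balanced_vectors =
  fixes n :: nat and m :: "nat \<Rightarrow> nat" and v :: "nat \<times> nat \<Rightarrow> nat \<Rightarrow> bit"
    and \<xi> :: "nat \<Rightarrow> (nat \<Rightarrow> bit) \<Rightarrow> bit"
  assumes m3: "\<And>k. k < n \<Longrightarrow> 3 \<le> m k"
    and v_in: "\<And>k j. k < n \<Longrightarrow> j < m k \<Longrightarrow> v (k, j) \<in> bvec {..<2 * n}"
    and \<xi>_add: "\<And>k x y. \<xi> k (x + y) = \<xi> k x + \<xi> k y"
    and \<xi>_v: "\<And>i k j. i < n \<Longrightarrow> k < n \<Longrightarrow> j < m k \<Longrightarrow> \<xi> i (v (k, j)) = (if i = k then 1 else 0)"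
    and indep: "\<And>c T. (\<forall>k<n. c k < m k) \<Longrightarrow>
      T \<subseteq> (SIGMA k:{..<n}. {c k, Suc (c k) mod m k}) \<Longrightarrow> sum v T = 0 \<Longrightarrow> T = {}"
begin

definition w :: "nat \<Rightarrow> nat \<Rightarrow> nat \<Rightarrow> bit" where
  "w k j = v (k, j) + v (k, Suc j mod m k)"

lemma Suc_mod_neq: "k < n \<Longrightarrow> j < m k \<Longrightarrow> Suc j mod m k \<noteq> j"
  using m3[of k] by (cases "Suc j = m k") auto

lemma Suc_mod_less: "k < n \<Longrightarrow> Suc j mod m k < m k"
  using m3[of k] by simp

lemma w_in: "k < n \<Longrightarrow> j < m k \<Longrightarrow> w k j \<in> bvec {..<2 * n}"
  using v_in Suc_mod_less by (simp add: w_def)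

lemma \<xi>_0: "\<xi> k 0 = 0"
  using \<xi>_add[of k 0 0] by (cases "\<xi> k 0") auto

lemma \<xi>_w: "i < n \<Longrightarrow> k < n \<Longrightarrow> j < m k \<Longrightarrow> \<xi> i (w k j) = 0"
  using \<xi>_v Suc_mod_less by (simp add: w_def \<xi>_add)

lemma \<xi>_sum: "\<xi> k (sum f I) = (\<Sum>i\<in>I. \<xi> k (f i))"
  by (induction I rule: infinite_finite_induct)
    (simp_all only: sum.infinite sum.empty sum.insert \<xi>_0 \<xi>_add not_False_eq_True)

lemma vertex_basis:
  assumes c: "\<forall>k<n. c k < m k"
  shows "bij_betw (sum v) (Pow (SIGMA k:{..<n}. {c k, Suc (c k) mod m k})) (bvec {..<2 * n})"
proof (rule independent_family_basis)
  have "card {c k, Suc (c k) mod m k} = 2" if "k < n" for k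
    using Suc_mod_neq[OF that, of "c k"] c that by simp
  then show "card (SIGMA k:{..<n}. {c k, Suc (c k) mod m k}) = card {..<2 * n}"
    by simp
  show "v ` (SIGMA k:{..<n}. {c k, Suc (c k) mod m k}) \<subseteq> bvec {..<2 * n}"
    using v_in Suc_mod_less c by auto
  show "T = {}" if "T \<subseteq> (SIGMA k:{..<n}. {c k, Suc (c k) mod m k})" "sum v T = 0" for T
    using indep[OF c that] .
qed auto

lemma sum_v_Sigma:
  assumes c: "\<forall>k<n. c k < m k" and K: "K \<subseteq> {..<n}"
  shows "sum v (SIGMA k:K. {c k, Suc (c k) mod m k}) = (\<Sum>k\<in>K. w k (c k))"
proof -
  have fin: "finite K" using K finite_subset by blast
  have "sum v (SIGMA k:K. {c k, Suc (c k) mod m k}) = (\<Sum>k\<in>K. \<Sum>j\<in>{c k, Suc (c k) mod m k}. v (k, j))"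
    using fin by (subst sum.Sigma) (auto intro!: sum.cong)
  also have "\<dots> = (\<Sum>k\<in>K. w k (c k))"
  proof (rule sum.cong)
    fix k assume "k \<in> K"
    then have "c k \<noteq> Suc (c k) mod m k" using Suc_mod_neq[of k "c k"] c K by auto
    then show "(\<Sum>j\<in>{c k, Suc (c k) mod m k}. v (k, j)) = w k (c k)" by (simp add: w_def)
  qed simp
  finally show ?thesis .
qed

text \<open>An element \<open>y\<close> of the kernel is a sum over a subset \<open>T\<close> of the
  facets at a vertex. Evaluating \<open>\<xi> k\<close> counts the members of \<open>T\<close> in
  factor \<open>k\<close> modulo 2, so \<open>T\<close> contains both sides of the corner or none,
  and \<open>y\<close> is a sum of some \<open>w k (c k)\<close>. Independence is inherited from the
  facets at the vertex.\<close>

lemma transversal_bases_w: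
  "transversal_bases {..<n} (\<lambda>k. w k ` {..<m k}) {0} {x \<in> bvec {..<2 * n}. \<forall>k<n. \<xi> k x = 0}"
  (is "transversal_bases _ ?S _ ?W")
proof -
  have "(\<forall>K\<subseteq>{..<n}. sum x K \<in> {0} \<longrightarrow> K = {}) \<and> (\<forall>y\<in>?W. \<exists>K\<subseteq>{..<n}. y + sum x K \<in> {0})"
    if "\<forall>k\<in>{..<n}. x k \<in> ?S k" for x
  proof -
    have "\<forall>k. \<exists>j. k < n \<longrightarrow> j < m k \<and> x k = w k j" using that by auto
    then obtain c where c: "\<And>k. k < n \<Longrightarrow> c k < m k \<and> x k = w k (c k)" by metis
    let ?c' = "\<lambda>k. Suc (c k) mod m k"
    let ?B = "\<lambda>K. SIGMA k:K. {c k, ?c' k}"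
    have cm: "\<forall>k<n. c k < m k" using c by blast
    have sum_x: "sum x K = sum v (?B K)" if "K \<subseteq> {..<n}" for K
      unfolding sum_v_Sigma[OF cm that] using c that by (intro sum.cong) auto
    have "K = {}" if K: "K \<subseteq> {..<n}" "sum x K \<in> {0}" for K
    proof -
      have "?B K \<subseteq> ?B {..<n}" using K by auto
      then have "?B K = {}" using indep[OF cm, of "?B K"] sum_x K by auto
      then show ?thesis by auto
    qed
    moreover have "\<exists>K\<subseteq>{..<n}. y + sum x K \<in> {0}" if y: "y \<in> ?W" for y
    proof -
      have "y \<in> sum v ` Pow (?B {..<n})" using vertex_basis[OF cm] y by (simp add: bij_betw_def)
      then obtain T where T: "T \<subseteq> ?B {..<n}" "y = sum v T" by auto
      have finB: "finite (?B {..<n})" by auto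
      have iff: "(k, c k) \<in> T \<longleftrightarrow> (k, ?c' k) \<in> T" if k: "k < n" for k
      proof -
        have "0 = \<xi> k y" using y k by simp
        also have "\<dots> = (\<Sum>t\<in>T. \<xi> k (v t))" using T by (simp add: \<xi>_sum)
        also have "\<dots> = (\<Sum>t\<in>T. if fst t = k then 1 else 0)"
          using T(1) \<xi>_v k cm Suc_mod_less by (intro sum.cong) auto
        also have "\<dots> = (\<Sum>t\<in>{t \<in> T. fst t = k}. 1)"
          using finite_subset[OF T(1) finB] by (rule sum.inter_filter[symmetric])
        also have "{t \<in> T. fst t = k} = T \<inter> {(k, c k), (k, ?c' k)}" using T(1) by auto
        finally have 0: "0 = (\<Sum>t\<in>T \<inter> {(k, c k), (k, ?c' k)}. (1::bit))" .
        have ne: "c k \<noteq> ?c' k" using Suc_mod_neq[of k "c k"] cm k by auto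
        show ?thesis
          using 0 ne by (cases "(k, c k) \<in> T"; cases "(k, ?c' k) \<in> T") auto
      qed
      define K where "K = {k. k < n \<and> (k, c k) \<in> T}"
      have "T = ?B K" using T(1) iff by (auto simp: K_def)
      moreover have "K \<subseteq> {..<n}" by (auto simp: K_def)
      ultimately have "sum x K = y" using T(2) sum_x[of K] by metis
      then have "y + sum x K = 0" by simp
      then show ?thesis by (intro exI[of _ K]) (auto simp: K_def)
    qed
    ultimately show ?thesis by blast
  qed
  then show ?thesis
    unfolding transversal_bases_def using w_in \<xi>_w by auto
qed

text \<open>The columns of \<open>\<beta>\<close> are the vectors of the sides 0 and 1 of the
  factors in the new order. Modulo later factors any two \<open>w\<close> of one factor agree, so
  two consecutive steps cancel and the vector of a side depends only on the parity of its number.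
  The coordinates from \<open>2 * i + 2\<close> on are left free: they hold the contribution of
  later factors.\<close>

theorem triangular_form:
  obtains \<pi> \<beta> where "\<pi> permutes {..<n}"
    "bit_linear (bvec {..<2 * n}) (bvec {..<2 * n}) \<beta>"
    "bij_betw \<beta> (bvec {..<2 * n}) (bvec {..<2 * n})"
    "\<And>i. i < n \<Longrightarrow> even (m (\<pi> i))"
    "\<And>i j. i < n \<Longrightarrow> j < m (\<pi> i) \<Longrightarrow> \<exists>A\<in>bvec {..<2 * n}. \<beta> A = v (\<pi> i, j) \<and>
       (\<forall>r<2 * i + 2. A r = (if r = 2 * i + j mod 2 then 1 else 0))"
proof -
  let ?V = "bvec {..<2 * n} :: (nat \<Rightarrow> bit) set"
  have "\<forall>k\<in>{..<n}. w k 0 \<in> w k ` {..<m k}" using m3 by force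
  from transversal_bases_order[OF _ transversal_bases_w this]
  obtain \<pi>\<^sub>0 where \<pi>0: "bij_betw \<pi>\<^sub>0 {..<n} {..<n}"
    and ord0: "\<And>i j j'. i < n \<Longrightarrow> j < m (\<pi>\<^sub>0 i) \<Longrightarrow> j' < m (\<pi>\<^sub>0 i) \<Longrightarrow>
      \<exists>K\<subseteq>\<pi>\<^sub>0 ` {i<..<n}. w (\<pi>\<^sub>0 i) j + w (\<pi>\<^sub>0 i) j' + (\<Sum>k\<in>K. w k 0) = 0"
    by auto
  define \<pi> where "\<pi> = (\<lambda>i. if i < n then \<pi>\<^sub>0 i else i)"
  have bij: "bij_betw \<pi> {..<n} {..<n}"
    using \<pi>0 by (rule bij_betw_cong[THEN iffD1, rotated]) (simp add: \<pi>_def)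
  then have perm: "\<pi> permutes {..<n}" by (rule bij_imp_permutes) (simp add: \<pi>_def)
  have \<pi>n: "\<pi> i < n" if "i < n" for i using bij that by (auto simp: bij_betw_def)
  have ord: "\<exists>K\<subseteq>\<pi> ` {i<..<n}. w (\<pi> i) j + w (\<pi> i) 0 = (\<Sum>k\<in>K. w k 0)"
    if "i < n" "j < m (\<pi> i)" for i j
  proof -
    have "0 < m (\<pi> i)" using m3[OF \<pi>n] that by force
    moreover have "\<pi>\<^sub>0 ` {i<..<n} = \<pi> ` {i<..<n}" by (auto simp: \<pi>_def)
    ultimately show ?thesis using ord0[of i j 0] that by (auto simp: \<pi>_def bit_vec_add_eq_0_iff)
  qed
  define b where "b r = v (\<pi> (r div 2), r mod 2)" for r
  define \<beta> where "\<beta> A = (\<Sum>r<2 * n. bscale (A r) (b r))" for A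
  have m0: "0 < m k" "Suc 0 < m k" if "k < n" for k using m3[OF that] by auto
  have div_less: "r div 2 < n" if "r < 2 * n" for r using that by auto
  have b_in: "b r \<in> ?V" if "r < 2 * n" for r
    unfolding b_def using v_in[OF \<pi>n] m0[OF \<pi>n] div_less[OF that]
    by (cases "r mod 2 = 0") (auto simp: mod2_eq_if)
  \<comment> \<open>The columns belong to the vertex at which the sides 0 and 1 of all factors
    meet.\<close>
  have b_indep: "T = {}" if T: "T \<subseteq> {..<2 * n}" "sum b T = 0" for T
  proof -
    let ?g = "\<lambda>r. (\<pi> (r div 2), r mod 2)"
    have inj: "inj_on ?g T"
    proof (rule inj_onI)
      fix r s assume rs: "r \<in> T" "s \<in> T" "?g r = ?g s"
      then have "r div 2 = s div 2"
        using inj_onD[OF bij_betw_imp_inj_on[OF bij]] div_less T(1) by fastforce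
      then show "r = s" using rs by (metis div_mult_mod_eq prod.inject)
    qed
    have "?g ` T \<subseteq> (SIGMA k:{..<n}. {0, Suc 0 mod m k})"
    proof
      fix p assume "p \<in> ?g ` T"
      then obtain r where r: "r < 2 * n" "p = ?g r" using T by auto
      then have "Suc 0 mod m (\<pi> (r div 2)) = 1" using m0(2)[OF \<pi>n[OF div_less[OF r(1)]]] by simp
      then show "p \<in> (SIGMA k:{..<n}. {0, Suc 0 mod m k})"
        using r \<pi>n[OF div_less] by (auto simp: mod2_eq_if)
    qed
    moreover have "sum v (?g ` T) = 0"
      unfolding sum.reindex[OF inj] using T(2) by (simp add: comp_def b_def)
    ultimately have "?g ` T = {}" using m0 by (intro indep[of "\<lambda>_. 0"]) auto
    then show ?thesis by auto
  qed
  have lin: "bit_linear ?V ?V \<beta>"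
    using bit_linear_combination[of "{..<2 * n}" b "{..<2 * n}" ?V] b_in by (simp add: \<beta>_def[abs_def])
  have \<beta>_bij: "bij_betw \<beta> ?V ?V"
    using bij_betw_bit_linear_combination[of "{..<2 * n}" "{..<2 * n}" b] b_in b_indep
    by (auto simp: \<beta>_def[abs_def])
  have \<beta>_unit: "\<beta> (unit_vec r) = b r" if "r < 2 * n" for r
    using that by (simp add: \<beta>_def combination_unit_vec)
  \<comment> \<open>The span of the columns of all factors after position \<open>i\<close>.\<close>
  define G where "G i = \<beta> ` {A \<in> ?V. \<forall>r<2 * i + 2. A r = 0}" for i
  have G0: "0 \<in> G i" for i
    unfolding G_def using bit_linear_0[OF lin] by (intro image_eqI[of _ _ 0]) auto
  have G_add: "x + y \<in> G i" if xy: "x \<in> G i" "y \<in> G i" for x y i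
  proof -
    obtain A B where AB: "A \<in> ?V" "B \<in> ?V" "\<forall>r<2 * i + 2. A r = 0" "\<forall>r<2 * i + 2. B r = 0"
      "x = \<beta> A" "y = \<beta> B" using xy by (auto simp: G_def)
    then have "x + y = \<beta> (A + B)" using bit_linear_add[OF lin] by simp
    then show ?thesis using AB by (auto simp: G_def)
  qed
  have w0: "w (\<pi> l) 0 = \<beta> (unit_vec (2 * l) + unit_vec (Suc (2 * l)))" if "l < n" for l
  proof -
    have "w (\<pi> l) 0 = b (2 * l) + b (Suc (2 * l))"
      using m0[OF \<pi>n[OF that]] by (simp add: w_def b_def)
    also have "\<dots> = \<beta> (unit_vec (2 * l)) + \<beta> (unit_vec (Suc (2 * l)))"
      using that by (simp add: \<beta>_unit)
    finally show ?thesis using that by (simp add: bit_linear_add[OF lin])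
  qed
  have sum_G: "(\<Sum>k\<in>K. w k 0) \<in> G i" if "K \<subseteq> \<pi> ` {i<..<n}" for K i
  proof -
    have "finite K" using that finite_subset by blast
    then show ?thesis using that
    proof (induction K rule: finite_induct)
      case (insert k K)
      then obtain l where l: "k = \<pi> l" "i < l" "l < n" by auto
      have "w k 0 \<in> G i" unfolding l(1) w0[OF l(3)] G_def
        using l by (intro imageI CollectI conjI bvec_add) (simp_all, simp add: unit_vec_apply)
      moreover have "(\<Sum>k\<in>K. w k 0) \<in> G i" using insert by simp
      ultimately show ?case unfolding sum.insert[OF insert(1,2)] by (rule G_add)
    qed (simp add: G0)
  qed
  have w_G: "w (\<pi> i) j + w (\<pi> i) 0 \<in> G i" if "i < n" "j < m (\<pi> i)" for i j
    using ord[OF that] sum_G by metis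
  have v_G: "v (\<pi> i, j) + v (\<pi> i, j mod 2) \<in> G i" if "i < n" "j < m (\<pi> i)" for i j
    using that(2)
  proof (induction j rule: less_induct)
    case (less j)
    show ?case
    proof (cases "j < 2")
      case True
      then show ?thesis using G0[of i] by (simp only: mod_less bit_vec_add_self)
    next
      case False
      then obtain l where l: "j = Suc (Suc l)" by (metis add_2_eq_Suc le_Suc_ex not_less)
      have "v (\<pi> i, l) + v (\<pi> i, l mod 2) \<in> G i"
        by (rule less.IH) (use less.prems l in simp_all)
      \<comment> \<open>Each bracket lies in \<open>G i\<close>, and the two copies of
        \<open>w (\<pi> i) 0\<close> cancel; what is left is the passage from side \<open>l\<close>
        to side \<open>l + 2\<close>.\<close>
      moreover have "(w (\<pi> i) (Suc l) + w (\<pi> i) 0) + (w (\<pi> i) l + w (\<pi> i) 0) \<in> G i"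
        using less.prems l that(1) by (intro G_add w_G) auto
      ultimately have "((w (\<pi> i) (Suc l) + w (\<pi> i) 0) + (w (\<pi> i) l + w (\<pi> i) 0)) +
          (v (\<pi> i, l) + v (\<pi> i, l mod 2)) \<in> G i" using G_add by blast
      also have "((w (\<pi> i) (Suc l) + w (\<pi> i) 0) + (w (\<pi> i) l + w (\<pi> i) 0)) +
          (v (\<pi> i, l) + v (\<pi> i, l mod 2)) = v (\<pi> i, j) + v (\<pi> i, j mod 2)"
        using less.prems l
        by (simp add: w_def)
      finally show ?thesis .
    qed
  qed
  have "even (m (\<pi> i))" if i: "i < n" for i
  proof (rule ccontr)
    assume odd: "odd (m (\<pi> i))"
    \<comment> \<open>With an odd number of sides the last side has an even number and is followed
      by side 0, so its step joins two sides of the same parity and lies in \<open>G i\<close>. Then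
      so does \<open>w (\<pi> i) 0\<close>, although it has coordinate 1 in row
      \<open>2 * i\<close>.\<close>
    let ?j = "m (\<pi> i) - 1"
    have j: "?j < m (\<pi> i)" "?j mod 2 = 0" "Suc ?j = m (\<pi> i)" using odd m0[OF \<pi>n[OF i]] by auto
    have w_j: "w (\<pi> i) ?j = v (\<pi> i, ?j) + v (\<pi> i, ?j mod 2)" using j by (simp add: w_def)
    have "w (\<pi> i) ?j + w (\<pi> i) 0 + w (\<pi> i) ?j \<in> G i"
      using j v_G[OF i j(1)] unfolding w_j[symmetric] by (intro G_add w_G[OF i]) simp_all
    then have "w (\<pi> i) 0 \<in> G i" by (simp only: bit_vec_ac)
    then obtain A where A: "A \<in> ?V" "\<forall>r<2 * i + 2. A r = 0" "w (\<pi> i) 0 = \<beta> A" by (auto simp: G_def)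
    have "unit_vec (2 * i) + unit_vec (Suc (2 * i)) \<in> ?V" using i by auto
    then have "A = unit_vec (2 * i) + unit_vec (Suc (2 * i))"
      using A(1,3) w0[OF i] bij_betw_imp_inj_on[OF \<beta>_bij] by (auto simp: inj_on_def)
    then have "A (2 * i) = 1" by (simp add: unit_vec_apply)
    then show False using A(2) by auto
  qed
  moreover have "\<exists>A\<in>?V. \<beta> A = v (\<pi> i, j) \<and> (\<forall>r<2 * i + 2. A r = (if r = 2 * i + j mod 2 then 1 else 0))"
    if ij: "i < n" "j < m (\<pi> i)" for i j
  proof -
    obtain A where A: "A \<in> ?V" "\<forall>r<2 * i + 2. A r = 0" "v (\<pi> i, j) + v (\<pi> i, j mod 2) = \<beta> A"
      using v_G[OF ij] by (auto simp: G_def)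
    let ?r = "2 * i + j mod 2"
    have r: "?r < 2 * n" using ij by auto
    have "v (\<pi> i, j) = v (\<pi> i, j mod 2) + \<beta> A" using A(3) by (metis bit_vec_add_eq_iff)
    also have "v (\<pi> i, j mod 2) = \<beta> (unit_vec ?r)" using \<beta>_unit[OF r] by (simp add: b_def)
    also have "\<beta> (unit_vec ?r) + \<beta> A = \<beta> (unit_vec ?r + A)" using bit_linear_add[OF lin] A r by simp
    finally have "\<beta> (unit_vec ?r + A) = v (\<pi> i, j)" ..
    then show ?thesis using A r by (intro bexI[of _ "unit_vec ?r + A"]) (auto simp: unit_vec_apply)
  qed
  ultimately show ?thesis using that[OF perm lin \<beta>_bij] by blast
qed

end

section \<open>Small covers as quotients of a product with a finite group\<close>

lemma quotient_map_quotient_topology: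
  assumes r: "equiv (topspace X) r"
  shows "quotient_map X (quotient_topology X r) (\<lambda>x. r `` {x})"
  unfolding quotient_map_def
proof (intro conjI allI impI)
  show "(\<lambda>x. r `` {x}) ` topspace X = topspace (quotient_topology X r)"
    by (auto simp: topspace_quotient_topology[OF r] quotient_def)
next
  fix U assume U: "U \<subseteq> topspace (quotient_topology X r)"
  then have sub: "U \<subseteq> topspace X // r" by (simp add: topspace_quotient_topology[OF r])
  have "{x \<in> topspace X. r `` {x} \<in> U} = \<Union>U"
  proof
    show "{x \<in> topspace X. r `` {x} \<in> U} \<subseteq> \<Union>U" using equiv_class_self[OF r] by blast
    show "\<Union>U \<subseteq> {x \<in> topspace X. r `` {x} \<in> U}"
    proof
      fix x assume "x \<in> \<Union>U"
      then obtain c where c: "c \<in> U" "x \<in> c" by auto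
      then obtain y where y: "y \<in> topspace X" "c = r `` {y}" using sub by (auto elim!: quotientE)
      then have "(y, x) \<in> r" using c by auto
      then have "r `` {x} = c" using y equiv_class_eq[OF r] by blast
      moreover have "x \<in> topspace X" using \<open>(y, x) \<in> r\<close> r by (auto simp: equiv_def refl_on_def)
      ultimately show "x \<in> {x \<in> topspace X. r `` {x} \<in> U}" using c by simp
    qed
  qed
  then show "openin X {x \<in> topspace X. r `` {x} \<in> U} \<longleftrightarrow> openin (quotient_topology X r) U"
    using sub by (simp add: openin_quotient_topology[OF r])
qed

text \<open>The common source of the homeomorphisms below: the one induced by a facet homeomorphism,
  the local trivializations and the charts all descend from maps on copies of the polytope.\<close>

lemma quotient_maps_same_fibers:
  assumes q: "quotient_map X Y q" and r: "quotient_map X Z r"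
    and eq: "\<And>x y. x \<in> topspace X \<Longrightarrow> y \<in> topspace X \<Longrightarrow> q x = q y \<longleftrightarrow> r x = r y"
  obtains h where "homeomorphic_map Y Z h" "\<And>x. x \<in> topspace X \<Longrightarrow> h (q x) = r x"
proof -
  obtain h where h: "continuous_map Y Z h" "\<And>x. x \<in> topspace X \<Longrightarrow> h (q x) = r x"
    using quotient_map_lift_exists[OF q quotient_imp_continuous_map[OF r]] eq by metis
  have "quotient_map X Z (h \<circ> q)"
    by (rule quotient_map_eq[OF r]) (simp add: h)
  then have "quotient_map Y Z h"
    using quotient_map_from_composition[OF quotient_imp_continuous_map[OF q] h(1)] by blast
  moreover have "inj_on h (topspace Y)"
  proof (rule inj_onI)
    fix a b assume ab: "a \<in> topspace Y" "b \<in> topspace Y" "h a = h b"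
    then obtain x y where "x \<in> topspace X" "y \<in> topspace X" "a = q x" "b = q y"
      using quotient_imp_surjective_map[OF q] by blast
    then show "a = b" using eq h ab by auto
  qed
  ultimately have "homeomorphic_map Y Z h" by (simp add: homeomorphic_map_def)
  then show ?thesis using h that by blast
qed

text \<open>Perfect maps are quotient maps of a kind that is stable under products, which quotient
  maps in general are not.\<close>

lemma perfect_map_prod:
  assumes "perfect_map X X' f" "perfect_map Y Y' g"
  shows "perfect_map (prod_topology X Y) (prod_topology X' Y') (\<lambda>(x, y). (f x, g y))"
  using assms
  by (auto simp: perfect_map_def continuous_map_prod_top proper_map_prod image_paired_Times)

definition facets_at :: "('p, 'f) faceted_space \<Rightarrow> 'p \<Rightarrow> 'f set" where
  "facets_at P p = {F \<in> facets P. p \<in> facet P F}"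

text \<open>The point of the small cover over \<open>p\<close> in the copy of the polytope indexed by \<open>v\<close>.\<close>

definition cover_point ::
  "('p, 'f) faceted_space \<Rightarrow> (('f \<Rightarrow> bit) \<Rightarrow> nat \<Rightarrow> bit) \<Rightarrow> (nat \<Rightarrow> bit) \<times> 'p \<Rightarrow> (('f \<Rightarrow> bit) \<times> 'p) set set" where
  "cover_point P lam = (\<lambda>(v, p). (\<lambda>g. mirror_relation P `` {(g, p)}) ` {g \<in> bvec (facets P). lam g = v})"

definition copies :: "nat \<Rightarrow> ('p, 'f) faceted_space \<Rightarrow> ((nat \<Rightarrow> bit) \<times> 'p) topology" where
  "copies d P = prod_topology (discrete_topology (bvec {..<d})) (points P)"

lemma topspace_copies: "topspace (copies d P) = bvec {..<d} \<times> topspace (points P)"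
  by (simp add: copies_def)

text \<open>Surjectivity gives every element of the acting group a copy of the polytope in
  \<open>cover_point\<close>; together with finitely many closed facets this makes the small cover a
  closed quotient of finitely many copies.\<close>

locale surjective_labelling =
  fixes P :: "('p, 'f) faceted_space" and d :: nat and lam :: "('f \<Rightarrow> bit) \<Rightarrow> nat \<Rightarrow> bit"
  assumes finite_facets: "finite (facets P)"
    and closed_facets: "\<And>F. F \<in> facets P \<Longrightarrow> closedin (points P) (facet P F)"
    and linear: "bit_linear (bvec (facets P)) (bvec {..<d}) lam"
    and surjective: "bvec {..<d} \<subseteq> lam ` bvec (facets P)"
begin

abbreviation mirror_class :: "('f \<Rightarrow> bit) \<Rightarrow> 'p \<Rightarrow> (('f \<Rightarrow> bit) \<times> 'p) set" where
  "mirror_class g p \<equiv> mirror_relation P `` {(g, p)}"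

abbreviation full_copies :: "(('f \<Rightarrow> bit) \<times> 'p) topology" where
  "full_copies \<equiv> prod_topology (discrete_topology (bvec (facets P))) (points P)"

lemma facets_at_subset: "facets_at P p \<subseteq> facets P"
  by (auto simp: facets_at_def)

lemma bvec_facets_at: "g \<in> bvec (facets_at P p) \<Longrightarrow> g \<in> bvec (facets P)"
  using bvec_mono[OF facets_at_subset] by blast

lemma lam_add: "g \<in> bvec (facets P) \<Longrightarrow> h \<in> bvec (facets P) \<Longrightarrow> lam (g + h) = lam g + lam h"
  using bit_linear_add[OF linear] .

lemma lam_in: "g \<in> bvec (facets P) \<Longrightarrow> lam g \<in> bvec {..<d}"
  using bit_linear_in[OF linear] .

lemma lam_section: obtains \<sigma> where "\<And>v. v \<in> bvec {..<d} \<Longrightarrow> \<sigma> v \<in> bvec (facets P) \<and> lam (\<sigma> v) = v"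
proof -
  have "\<forall>v\<in>bvec {..<d}. \<exists>g. g \<in> bvec (facets P) \<and> lam g = v" using surjective by blast
  then show ?thesis using that by metis
qed

lemma mirror_iff:
  "((g, p), (h, q)) \<in> mirror_relation P \<longleftrightarrow> g \<in> bvec (facets P) \<and> h \<in> bvec (facets P) \<and> p = q \<and>
     p \<in> topspace (points P) \<and> g + h \<in> bvec (facets_at P p)"
proof -
  have "{unit_vec F |F. F \<in> facets P \<and> p \<in> facet P F} = unit_vec ` facets_at P p"
    by (auto simp: facets_at_def)
  moreover have "finite (facets_at P p)"
    using finite_facets facets_at_subset finite_subset by metis
  ultimately have "bitvec.span {unit_vec F |F. F \<in> facets P \<and> p \<in> facet P F} = bvec (facets_at P p)"
    using span_unit_vec by metis
  then show ?thesis by (auto simp: mirror_relation_def)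
qed

lemma equiv_mirror:
  "equiv (topspace full_copies) (mirror_relation P)"
proof (rule equivI)
  show "mirror_relation P \<subseteq> topspace full_copies \<times> topspace full_copies"
    by (auto simp: mirror_iff)
  show "refl_on (topspace full_copies) (mirror_relation P)"
    by (auto simp: refl_on_def mirror_iff)
  show "sym (mirror_relation P)"
    by (auto simp: sym_def mirror_iff add.commute)
  show "trans (mirror_relation P)"
  proof (rule transI)
    fix x y z assume xyz: "(x, y) \<in> mirror_relation P" "(y, z) \<in> mirror_relation P"
    obtain g p h q k r where [simp]: "x = (g, p)" "y = (h, q)" "z = (k, r)" by (metis surj_pair)
    have "(g + h) + (h + k) \<in> bvec (facets_at P p)"
      by (rule bvec_add) (use xyz in \<open>auto simp: mirror_iff\<close>)
    moreover have "(g + h) + (h + k) = g + k" by (simp only: add.assoc bit_vec_add_self_left)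
    ultimately show "(x, z) \<in> mirror_relation P"
      using xyz by (auto simp: mirror_iff)
  qed
qed

lemma mirror_class_eq_iff:
  assumes "g \<in> bvec (facets P)" "h \<in> bvec (facets P)" "p \<in> topspace (points P)" "q \<in> topspace (points P)"
  shows "mirror_class g p = mirror_class h q \<longleftrightarrow> p = q \<and> g + h \<in> bvec (facets_at P p)"
  using eq_equiv_class_iff[OF equiv_mirror, of "(g, p)" "(h, q)"] assms by (simp add: mirror_iff)

lemma mirror_class_act:
  assumes "h \<in> bvec (facets P)" "g \<in> bvec (facets P)"
  shows "moment_angle_act h (mirror_class g p) = mirror_class (h + g) p"
proof -
  have "(h + k, q) \<in> mirror_class (h + g) p" if "(k, q) \<in> mirror_class g p" for k q
  proof -
    have "h + g + (h + k) = g + k" by (simp only: ac_simps bit_vec_add_self_left)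
    then show ?thesis using that assms by (auto simp: mirror_iff)
  qed
  moreover have "(k, q) \<in> (\<lambda>(g, p). (h + g, p)) ` mirror_class g p" if k: "(k, q) \<in> mirror_class (h + g) p" for k q
  proof -
    have "h + g + k = g + (h + k)" by (simp only: ac_simps)
    moreover have "h + g + k \<in> bvec (facets_at P p)" using k unfolding Image_singleton_iff mirror_iff by blast
    ultimately have "g + (h + k) \<in> bvec (facets_at P p)" by (simp only:)
    then have "(h + k, q) \<in> mirror_class g p" using k assms by (auto simp: mirror_iff)
    then show ?thesis by (rule rev_image_eqI) simp
  qed
  ultimately show ?thesis by (auto simp: moment_angle_act_def)
qed

lemma topspace_real_moment_angle:
  "topspace (real_moment_angle P) = {mirror_class g p |g p. g \<in> bvec (facets P) \<and> p \<in> topspace (points P)}"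
  by (auto simp: real_moment_angle_def topspace_quotient_topology[OF equiv_mirror] quotient_def)

definition orbit_relation where
  "orbit_relation = {(x, y). x \<in> topspace (real_moment_angle P) \<and> (\<exists>g\<in>char_kernel P lam. y = moment_angle_act g x)}"

lemma char_kernel_iff: "g \<in> char_kernel P lam \<longleftrightarrow> g \<in> bvec (facets P) \<and> lam g = 0"
  by (auto simp: char_kernel_def)

lemma orbit_iff:
  assumes "g \<in> bvec (facets P)" "p \<in> topspace (points P)"
  shows "(mirror_class g p, y) \<in> orbit_relation \<longleftrightarrow> (\<exists>h\<in>bvec (facets P). lam h = lam g \<and> y = mirror_class h p)"
proof
  assume "(mirror_class g p, y) \<in> orbit_relation"
  then obtain k where "k \<in> bvec (facets P)" "lam k = 0" "y = mirror_class (k + g) p"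
    using assms mirror_class_act by (auto simp: orbit_relation_def char_kernel_iff)
  then show "\<exists>h\<in>bvec (facets P). lam h = lam g \<and> y = mirror_class h p"
    using assms lam_add by (intro bexI[of _ "k + g"]) auto
next
  assume "\<exists>h\<in>bvec (facets P). lam h = lam g \<and> y = mirror_class h p"
  then obtain h where h: "h \<in> bvec (facets P)" "lam h = lam g" "y = mirror_class h p" by auto
  then have "h + g \<in> char_kernel P lam" using assms lam_add by (auto simp: char_kernel_iff)
  moreover have "y = moment_angle_act (h + g) (mirror_class g p)"
    using h assms by (simp add: mirror_class_act)
  ultimately show "(mirror_class g p, y) \<in> orbit_relation"
    using assms by (auto simp: orbit_relation_def topspace_real_moment_angle)
qed

lemma orbit_class:
  assumes "g \<in> bvec (facets P)" "p \<in> topspace (points P)"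
  shows "orbit_relation `` {mirror_class g p} = cover_point P lam (lam g, p)"
  using orbit_iff[OF assms] by (auto simp: cover_point_def)

lemma equiv_orbit: "equiv (topspace (real_moment_angle P)) orbit_relation"
proof (rule equivI)
  show "orbit_relation \<subseteq> topspace (real_moment_angle P) \<times> topspace (real_moment_angle P)"
  proof
    fix z assume z: "z \<in> orbit_relation"
    obtain x y where [simp]: "z = (x, y)" by (metis surj_pair)
    from z have "x \<in> topspace (real_moment_angle P)" by (simp add: orbit_relation_def)
    then obtain g p where "g \<in> bvec (facets P)" "p \<in> topspace (points P)" "x = mirror_class g p"
      by (auto simp: topspace_real_moment_angle)
    then show "z \<in> topspace (real_moment_angle P) \<times> topspace (real_moment_angle P)"
      using z orbit_iff by (auto simp: topspace_real_moment_angle)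
  qed
  show "refl_on (topspace (real_moment_angle P)) orbit_relation"
    using orbit_iff by (auto simp: refl_on_def topspace_real_moment_angle)
  show "sym orbit_relation"
  proof (rule symI)
    fix x y assume xy: "(x, y) \<in> orbit_relation"
    then have "x \<in> topspace (real_moment_angle P)" by (simp add: orbit_relation_def)
    then obtain g p where "g \<in> bvec (facets P)" "p \<in> topspace (points P)" "x = mirror_class g p"
      by (auto simp: topspace_real_moment_angle)
    with xy show "(y, x) \<in> orbit_relation" using orbit_iff by auto
  qed
  show "trans orbit_relation"
  proof (rule transI)
    fix x y z assume xy: "(x, y) \<in> orbit_relation" and yz: "(y, z) \<in> orbit_relation"
    then have "x \<in> topspace (real_moment_angle P)" by (simp add: orbit_relation_def)
    then obtain g p where "g \<in> bvec (facets P)" "p \<in> topspace (points P)" "x = mirror_class g p"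
      by (auto simp: topspace_real_moment_angle)
    with xy yz show "(x, z) \<in> orbit_relation" using orbit_iff by auto
  qed
qed

lemma small_cover_eq: "small_cover P lam = quotient_topology (real_moment_angle P) orbit_relation"
  by (simp add: small_cover_def orbit_relation_def)

lemma quotient_map_big:
  "quotient_map full_copies (small_cover P lam)
     (\<lambda>(g, p). cover_point P lam (lam g, p))"
proof -
  have "quotient_map full_copies (small_cover P lam)
     ((\<lambda>c. orbit_relation `` {c}) \<circ> (\<lambda>x. mirror_relation P `` {x}))"
    unfolding small_cover_eq
    by (rule quotient_map_compose[OF _ quotient_map_quotient_topology[OF equiv_orbit]])
      (simp add: real_moment_angle_def quotient_map_quotient_topology[OF equiv_mirror])
  then show ?thesis
    by (rule quotient_map_eq) (clarsimp simp del: Image_singleton_iff simp: orbit_class)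
qed

lemma continuous_map_copies:
  assumes "\<And>v. v \<in> bvec {..<d} \<Longrightarrow> f v \<in> A"
  shows "continuous_map (copies d Q) (prod_topology (discrete_topology A) (points Q)) (\<lambda>(v, p). (f v, p))"
proof -
  have "continuous_map (discrete_topology (bvec {..<d})) (discrete_topology A) f"
    using assms by auto
  then have "continuous_map (copies d Q) (discrete_topology A) (f \<circ> fst)"
    unfolding copies_def by (rule continuous_map_compose[OF continuous_map_fst])
  then show ?thesis
    unfolding case_prod_beta
    by (intro continuous_map_pairedI) (auto simp: comp_def copies_def continuous_map_snd)
qed

lemma continuous_cover_point: "continuous_map (copies d P) (small_cover P lam) (cover_point P lam)"
proof -
  obtain \<sigma> where \<sigma>: "\<And>v. v \<in> bvec {..<d} \<Longrightarrow> \<sigma> v \<in> bvec (facets P) \<and> lam (\<sigma> v) = v"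
    using lam_section by blast
  have "continuous_map (copies d P) (small_cover P lam)
      ((\<lambda>(g, p). cover_point P lam (lam g, p)) \<circ> (\<lambda>(v, p). (\<sigma> v, p)))"
    using continuous_map_copies[of \<sigma>] quotient_imp_continuous_map[OF quotient_map_big] \<sigma>
    by (intro continuous_map_compose) auto
  then show ?thesis
    by (rule continuous_map_eq) (auto simp: topspace_copies \<sigma>)
qed

text \<open>The quotient map from the copies indexed by the larger group factors continuously
  through the copies indexed by \<open>bvec {..<d}\<close>, so the second factor is a quotient map
  as well.\<close>

lemma quotient_map_cover_point: "quotient_map (copies d P) (small_cover P lam) (cover_point P lam)"
proof (rule quotient_map_from_composition)
  have "continuous_map (discrete_topology (bvec (facets P))) (discrete_topology (bvec {..<d})) lam"
    using lam_in by auto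
  then have "continuous_map full_copies
      (discrete_topology (bvec {..<d})) (lam \<circ> fst)"
    by (rule continuous_map_compose[OF continuous_map_fst])
  then show "continuous_map full_copies (copies d P)
      (\<lambda>(g, p). (lam g, p))"
    unfolding case_prod_beta copies_def
    by (intro continuous_map_pairedI) (auto simp: comp_def continuous_map_snd)
  show "continuous_map (copies d P) (small_cover P lam) (cover_point P lam)"
    by (rule continuous_cover_point)
  show "quotient_map full_copies (small_cover P lam)
      (cover_point P lam \<circ> (\<lambda>(g, p). (lam g, p)))"
    by (rule quotient_map_eq[OF quotient_map_big]) auto
qed

lemma topspace_small_cover: "topspace (small_cover P lam) = cover_point P lam ` (bvec {..<d} \<times> topspace (points P))"
  using quotient_imp_surjective_map[OF quotient_map_cover_point] by (simp add: topspace_copies)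

text \<open>The standard model of a small cover: over \<open>p\<close>, copies are glued along the
  span of the vectors of the facets through \<open>p\<close>. Later arguments compare points by this
  criterion instead of unfolding the two nested quotients.\<close>

lemma cover_point_eq_iff:
  assumes v: "v \<in> bvec {..<d}" "w \<in> bvec {..<d}" and p: "p \<in> topspace (points P)" "q \<in> topspace (points P)"
  shows "cover_point P lam (v, p) = cover_point P lam (w, q) \<longleftrightarrow> p = q \<and> v + w \<in> lam ` bvec (facets_at P p)"
proof
  assume eq: "cover_point P lam (v, p) = cover_point P lam (w, q)"
  obtain g where g: "g \<in> bvec (facets P)" "lam g = v" using surjective v by blast
  then have "mirror_class g p \<in> cover_point P lam (w, q)"
    unfolding eq[symmetric] by (auto simp: cover_point_def)
  then obtain h where h: "h \<in> bvec (facets P)" "lam h = w" "mirror_class g p = mirror_class h q"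
    by (auto simp: cover_point_def)
  then have "p = q \<and> g + h \<in> bvec (facets_at P p)" using g p mirror_class_eq_iff by metis
  then show "p = q \<and> v + w \<in> lam ` bvec (facets_at P p)"
    using lam_add g h by (metis imageI)
next
  assume "p = q \<and> v + w \<in> lam ` bvec (facets_at P p)"
  then obtain k where k: "p = q" "k \<in> bvec (facets_at P p)" "v + w = lam k" by auto
  have sub: "cover_point P lam (v, p) \<subseteq> cover_point P lam (w, p)" if vw: "v + w = lam k" for v w
  proof
    fix c assume "c \<in> cover_point P lam (v, p)"
    then obtain g where g: "g \<in> bvec (facets P)" "lam g = v" "c = mirror_class g p" by (auto simp: cover_point_def)
    have kP: "k \<in> bvec (facets P)" using k bvec_facets_at by blast
    have "mirror_class g p = mirror_class (g + k) p"
      using g k kP p by (subst mirror_class_eq_iff) auto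
    moreover have "lam (g + k) = w" using lam_add[OF g(1) kP] g vw by (metis bit_vec_add_self_left)
    ultimately show "c \<in> cover_point P lam (w, p)" using g kP by (auto simp: cover_point_def)
  qed
  show "cover_point P lam (v, p) = cover_point P lam (w, q)"
    using sub[OF k(3)] sub[of w v] k(1,3) by (simp add: add.commute)
qed

lemma small_cover_act_cover_point:
  assumes u: "u \<in> bvec {..<d}" and v: "v \<in> bvec {..<d}"
  shows "small_cover_act P lam u (cover_point P lam (v, p)) = cover_point P lam (u + v, p)"
proof
  show "small_cover_act P lam u (cover_point P lam (v, p)) \<subseteq> cover_point P lam (u + v, p)"
    using lam_add by (auto simp: small_cover_act_def cover_point_def mirror_class_act)
  obtain h where h: "h \<in> bvec (facets P)" "lam h = u" using surjective u by blast
  show "cover_point P lam (u + v, p) \<subseteq> small_cover_act P lam u (cover_point P lam (v, p))"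
  proof
    fix c assume "c \<in> cover_point P lam (u + v, p)"
    then obtain g where g: "g \<in> bvec (facets P)" "lam g = u + v" "c = mirror_class g p" by (auto simp: cover_point_def)
    have "c = moment_angle_act h (mirror_class (h + g) p)"
      using g h by (simp add: mirror_class_act)
    moreover have "mirror_class (h + g) p \<in> cover_point P lam (v, p)"
      using g h lam_add by (auto simp: cover_point_def)
    ultimately show "c \<in> small_cover_act P lam u (cover_point P lam (v, p))"
      using h unfolding small_cover_act_def by blast
  qed
qed

lemma orbit_point_cover_point:
  assumes "v \<in> bvec {..<d}" "p \<in> topspace (points P)"
  shows "orbit_point (cover_point P lam (v, p)) = p"
proof -
  obtain g where g: "g \<in> bvec (facets P)" "lam g = v" using surjective assms by blast
  have "(g, p) \<in> mirror_class g p" using g assms by (auto simp: mirror_iff)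
  then have "p \<in> snd ` \<Union>(cover_point P lam (v, p))"
    using g by (force simp: cover_point_def)
  moreover have "snd ` \<Union>(cover_point P lam (v, p)) \<subseteq> {p}"
    by (auto simp: cover_point_def mirror_iff)
  ultimately have "snd ` \<Union>(cover_point P lam (v, p)) = {p}" by blast
  then show ?thesis by (simp add: orbit_point_def)
qed

text \<open>The saturation of a closed set is a finite union of translates of its intersections with faces.\<close>

lemma closed_map_cover_point: "closed_map (copies d P) (small_cover P lam) (cover_point P lam)"
  unfolding closed_map_def
proof (intro allI impI)
  fix C assume C: "closedin (copies d P) C"
  then have C_sub: "C \<subseteq> bvec {..<d} \<times> topspace (points P)"
    using closedin_subset topspace_copies by metis
  define D where "D v g = {v + lam g} \<times> ({p \<in> topspace (points P). (v, p) \<in> C} \<inter>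
    (topspace (points P) \<inter> (\<Inter>F\<in>{F \<in> facets P. g F = 1}. facet P F)))" for v g
  have closed_D: "closedin (copies d P) (D v g)" if "v \<in> bvec {..<d}" "g \<in> bvec (facets P)" for v g
  proof -
    have "continuous_map (points P) (copies d P) (\<lambda>p. (v, p))"
      unfolding copies_def using that by (intro continuous_map_pairedI) auto
    then have "closedin (points P) {p \<in> topspace (points P). (v, p) \<in> C}"
      using C closedin_continuous_map_preimage by fastforce
    moreover have "closedin (points P) (topspace (points P) \<inter> (\<Inter>F\<in>{F \<in> facets P. g F = 1}. facet P F))"
    \<comment> \<open>An intersection over the empty family is the whole type, which need not be a
      subset of the space; hence the extra factor \<open>topspace (points P)\<close>.\<close>
    proof (cases "{F \<in> facets P. g F = 1} = {}")
      case True
      then show ?thesis unfolding True by simp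
    next
      case False
      then have "closedin (points P) (\<Inter>F\<in>{F \<in> facets P. g F = 1}. facet P F)"
        using closed_facets by (intro closedin_INT) auto
      then show ?thesis by blast
    qed
    moreover have "v + lam g \<in> bvec {..<d}" using that lam_in by simp
    ultimately show ?thesis
      unfolding D_def copies_def closedin_prod_Times_iff by auto
  qed
  have L_eq: "{x \<in> topspace (copies d P). cover_point P lam x \<in> cover_point P lam ` C} =
      (\<Union>z\<in>bvec {..<d} \<times> bvec (facets P). D (fst z) (snd z))" (is "?L = ?R")
  proof
    show "?L \<subseteq> ?R"
    proof
      fix x assume x: "x \<in> ?L"
      obtain w p where [simp]: "x = (w, p)" by (metis surj_pair)
      have wp: "w \<in> bvec {..<d}" "p \<in> topspace (points P)" using x by (auto simp: topspace_copies)
      from x obtain v q where vq: "(v, q) \<in> C" "cover_point P lam (w, p) = cover_point P lam (v, q)" by auto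
      then have vq': "v \<in> bvec {..<d}" "q \<in> topspace (points P)" using C_sub by auto
      then have "p = q" "w + v \<in> lam ` bvec (facets_at P p)"
        using vq(2) cover_point_eq_iff[OF wp(1) vq'(1) wp(2) vq'(2)] by auto
      then obtain g where g: "g \<in> bvec (facets_at P p)" "w + v = lam g" by auto
      have "\<forall>F\<in>{F \<in> facets P. g F = 1}. p \<in> facet P F"
        using g(1) by (auto simp: bvec_def facets_at_def)
      moreover have "w = v + lam g" using g(2) by (metis bit_vec_add_self_left add.commute)
      ultimately have "(w, p) \<in> D v g" using vq \<open>p = q\<close> wp by (auto simp: D_def)
      moreover have "g \<in> bvec (facets P)" using g bvec_facets_at by blast
      ultimately show "x \<in> ?R" using vq'(1) by force
    qed
    show "?R \<subseteq> ?L"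
    proof
      fix x assume "x \<in> ?R"
      then obtain v g where vg: "v \<in> bvec {..<d}" "g \<in> bvec (facets P)" "x \<in> D v g" by auto
      then obtain p where p: "x = (v + lam g, p)" "p \<in> topspace (points P)" "(v, p) \<in> C"
        "\<forall>F\<in>facets P. g F = 1 \<longrightarrow> p \<in> facet P F" by (auto simp: D_def)
      have "g \<in> bvec (facets_at P p)"
        unfolding bvec_def facets_at_def
      proof (rule CollectI, intro allI impI)
        fix F assume F: "F \<notin> {F \<in> facets P. p \<in> facet P F}"
        show "g F = 0"
        proof (cases "F \<in> facets P")
          case True
          then have "g F \<noteq> 1" using F p(4) by blast
          then show ?thesis by (simp only: bit_not_one_iff)
        next
          case False
          then show ?thesis using vg(2) by (simp add: bvec_def)
        qed
      qed
      moreover have "v + lam g + v = lam g" by (simp add: ac_simps)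
      ultimately have "cover_point P lam x = cover_point P lam (v, p)"
        unfolding p(1) using vg p lam_in by (subst cover_point_eq_iff) auto
      moreover have "x \<in> topspace (copies d P)" using vg p lam_in by (simp add: topspace_copies)
      ultimately show "x \<in> ?L" using p by auto
    qed
  qed
  have "closedin (copies d P) ?R"
    using closed_D finite_bvec[OF finite_facets] finite_bvec[OF finite_lessThan]
    by (intro closedin_Union) (auto intro!: finite_imageI finite_cartesian_product)
  then have "closedin (copies d P) ?L" unfolding L_eq .
  moreover have "cover_point P lam ` C \<subseteq> topspace (small_cover P lam)"
    unfolding topspace_small_cover using C_sub by (rule image_mono)
  ultimately show "closedin (small_cover P lam) (cover_point P lam ` C)"
    using quotient_map_cover_point unfolding quotient_map_closedin by blast
qed

lemma perfect_map_cover_point: "perfect_map (copies d P) (small_cover P lam) (cover_point P lam)"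
proof -
  have "compactin (copies d P) {x \<in> topspace (copies d P). cover_point P lam x = y}" for y
  proof (rule finite_imp_compactin)
    show "finite {x \<in> topspace (copies d P). cover_point P lam x = y}"
    proof (rule finite_subset)
      show "{x \<in> topspace (copies d P). cover_point P lam x = y} \<subseteq> bvec {..<d} \<times> {orbit_point y}"
        using orbit_point_cover_point by (auto simp: topspace_copies)
      show "finite (bvec {..<d} \<times> {orbit_point y})" by (simp add: finite_bvec)
    qed
  qed auto
  then show ?thesis
    using closed_map_cover_point continuous_cover_point quotient_imp_surjective_map[OF quotient_map_cover_point]
    by (simp add: perfect_map_def proper_map_def)
qed

end

section \<open>Relabelled facets and homeomorphisms of polytopes\<close>

lemma relabel_unit_vec:
  assumes "finite (facets Q)" "F \<in> facets Q"
  shows "relabel Q \<tau> lam (unit_vec F) = lam (unit_vec (\<tau> F))"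
proof -
  have "(\<Sum>G\<in>facets Q. bscale (unit_vec F G) (unit_vec (\<tau> G))) =
      (\<Sum>G\<in>facets Q. if G = F then unit_vec (\<tau> G) else 0)"
    by (rule sum.cong) (auto simp: unit_vec_apply)
  then show ?thesis using assms by (simp add: relabel_def)
qed

lemma bit_linear_relabel:
  assumes "bit_linear (bvec (facets P)) W lam" "\<tau> ` facets Q \<subseteq> facets P"
  shows "bit_linear (bvec (facets Q)) W (relabel Q \<tau> lam)"
proof -
  have in_P: "(\<Sum>F\<in>facets Q. bscale (g F) (unit_vec (\<tau> F))) \<in> bvec (facets P)" for g
    using assms(2) by (intro bvec_sum bvec_bscale) auto
  have "relabel Q \<tau> lam (g + h) = relabel Q \<tau> lam g + relabel Q \<tau> lam h" for g h
    unfolding relabel_def bit_linear_add[OF assms(1) in_P in_P, symmetric]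
    by (simp add: bitvec.scale_left_distrib sum.distrib)
  then show ?thesis
    using bit_linear_in[OF assms(1) in_P] by (auto simp: bit_linear_def relabel_def)
qed

text \<open>Applied to the facets at a point, this says that relabelling transports the gluing
  subspaces; applied to all facets, that it preserves surjectivity.\<close>

lemma relabel_image:
  assumes lin: "bit_linear (bvec (facets P)) W lam" and bij: "bij_betw \<tau> (facets Q) (facets P)"
    and fin: "finite (facets Q)" and S: "S \<subseteq> facets Q"
  shows "relabel Q \<tau> lam ` bvec S = lam ` bvec (\<tau> ` S)"
proof -
  let ?f = "\<lambda>g. \<Sum>F\<in>facets Q. bscale (g F) (unit_vec (\<tau> F))"
  have "?f ` bvec S = bvec (\<tau> ` S)"
  proof
    show "?f ` bvec S \<subseteq> bvec (\<tau> ` S)"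
    proof
      fix x assume "x \<in> ?f ` bvec S"
      then obtain g where g: "g \<in> bvec S" "x = ?f g" by auto
      have "bscale (g F) (unit_vec (\<tau> F)) \<in> bvec (\<tau> ` S)" for F
        using g(1) by (cases "F \<in> S") (auto simp: bvec_def unit_vec_apply bscale_def)
      then show "x \<in> bvec (\<tau> ` S)" using g by (auto intro: bvec_sum)
    qed
    show "bvec (\<tau> ` S) \<subseteq> ?f ` bvec S"
    proof
      fix k assume k: "k \<in> bvec (\<tau> ` S)"
      define g where "g F = (if F \<in> S then k (\<tau> F) else 0)" for F
      have inj: "inj_on \<tau> (facets Q)" using bij by (rule bij_betw_imp_inj_on)
      have "?f g = k"
      proof
        fix G
        have "?f g G = (\<Sum>F\<in>facets Q. if G = \<tau> F then g F else 0)"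
          unfolding sum_fun_apply by (rule sum.cong) (auto simp: bscale_def unit_vec_apply)
        also have "\<dots> = k G"
        proof (cases "G \<in> \<tau> ` facets Q")
          case True
          then obtain F where F: "F \<in> facets Q" "G = \<tau> F" by auto
          then have "(\<Sum>F'\<in>facets Q. if G = \<tau> F' then g F' else 0) = (\<Sum>F'\<in>facets Q. if F' = F then g F' else 0)"
            using inj by (intro sum.cong) (auto simp: inj_on_def)
          also have "\<dots> = g F" using F fin by simp
          also have "\<dots> = k G"
          proof (cases "F \<in> S")
            case False
            then have "G \<notin> \<tau> ` S" using inj S F by (auto simp: inj_on_def)
            then show ?thesis using k False by (simp add: g_def bvec_def)
          qed (simp add: g_def F)
          finally show ?thesis .
        next
          case False
          then have "k G = 0" using k S by (auto simp: bvec_def)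
          moreover have "(\<Sum>F\<in>facets Q. if G = \<tau> F then g F else 0) = 0"
            using False by (intro sum.neutral) auto
          ultimately show ?thesis by simp
        qed
        finally show "?f g G = k G" .
      qed
      moreover have "g \<in> bvec S" by (simp add: g_def bvec_def)
      ultimately show "k \<in> ?f ` bvec S" by blast
    qed
  qed
  then show ?thesis unfolding relabel_def image_image[symmetric, of lam ?f] by simp
qed

lemma facets_at_facet_homeo:
  assumes f: "facet_homeo P Q \<tau> f" and sub: "\<And>F. F \<in> facets P \<Longrightarrow> facet P F \<subseteq> topspace (points P)"
    and p: "p \<in> topspace (points P)"
  shows "\<tau> ` facets_at Q (f p) = facets_at P p"
proof -
  have inj: "inj_on f (topspace (points P))" using f by (auto simp: facet_homeo_def homeomorphic_map_def)
  have bij: "bij_betw \<tau> (facets Q) (facets P)" using f by (auto simp: facet_homeo_def)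
  have iff: "f p \<in> facet Q F \<longleftrightarrow> p \<in> facet P (\<tau> F)" if F: "F \<in> facets Q" for F
  proof -
    have "facet Q F = f ` facet P (\<tau> F)" using f F by (auto simp: facet_homeo_def)
    moreover have "facet P (\<tau> F) \<subseteq> topspace (points P)" using sub bij F by (auto simp: bij_betw_def)
    ultimately show ?thesis using inj_on_image_mem_iff[OF inj p] by simp
  qed
  moreover have "facets P = \<tau> ` facets Q" using bij by (simp add: bij_betw_def)
  ultimately show ?thesis unfolding facets_at_def by auto
qed

text \<open>The map \<open>id\<close> times \<open>f\<close> on the copies respects the gluings in
  both directions, since the facets through \<open>f p\<close> correspond under
  \<open>\<tau>\<close> to those through \<open>p\<close> and carry the same vectors. It therefore
  descends, with \<open>id\<close> as automorphism of the acting group.\<close>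

theorem weakly_equivariant_homeo_facet_homeo:
  assumes P: "surjective_labelling P d lam" and f: "facet_homeo P Q \<tau> f"
    and finQ: "finite (facets Q)" and closedQ: "\<And>F. F \<in> facets Q \<Longrightarrow> closedin (points Q) (facet Q F)"
  obtains h where "weakly_equivariant_homeo d P lam Q (relabel Q \<tau> lam) f h"
proof -
  interpret P: surjective_labelling P d lam by (fact P)
  let ?mu = "relabel Q \<tau> lam"
  have bij: "bij_betw \<tau> (facets Q) (facets P)" and hom: "homeomorphic_map (points P) (points Q) f"
    using f by (auto simp: facet_homeo_def)
  have img: "?mu ` bvec S = lam ` bvec (\<tau> ` S)" if "S \<subseteq> facets Q" for S
    using relabel_image[OF P.linear bij finQ that] .
  interpret Q: surjective_labelling Q d ?mu
  proof
    show "bit_linear (bvec (facets Q)) (bvec {..<d}) ?mu"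
      by (rule bit_linear_relabel[OF P.linear]) (use bij in \<open>simp add: bij_betw_def\<close>)
    show "bvec {..<d} \<subseteq> ?mu ` bvec (facets Q)"
      using img[of "facets Q"] P.surjective bij by (simp add: bij_betw_def)
  qed (use finQ closedQ in auto)
  have fQ: "f p \<in> topspace (points Q)" if "p \<in> topspace (points P)" for p
    using hom that homeomorphic_imp_surjective_map by blast
  have f_inj: "inj_on f (topspace (points P))"
    using hom by (simp add: homeomorphic_map_def)
  have "perfect_map (copies d P) (copies d Q) (\<lambda>(v, p). (id v, f p))"
    unfolding copies_def using hom homeomorphic_imp_perfect_map
    by (intro perfect_map_prod) (auto intro!: perfect_map_id[unfolded id_def] simp: id_def)
  then have quot: "quotient_map (copies d P) (small_cover Q ?mu) (cover_point Q ?mu \<circ> (\<lambda>(v, p). (id v, f p)))"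
    by (intro quotient_map_compose[OF perfect_imp_quotient_map Q.quotient_map_cover_point])
  have at: "?mu ` bvec (facets_at Q (f p)) = lam ` bvec (facets_at P p)" if "p \<in> topspace (points P)" for p
    using img[OF Q.facets_at_subset] facets_at_facet_homeo[OF f _ that]
      closedin_subset[OF P.closed_facets] by metis
  have same: "cover_point P lam x = cover_point P lam y \<longleftrightarrow>
      (cover_point Q ?mu \<circ> (\<lambda>(v, p). (id v, f p))) x = (cover_point Q ?mu \<circ> (\<lambda>(v, p). (id v, f p))) y"
    if "x \<in> topspace (copies d P)" "y \<in> topspace (copies d P)" for x y
  proof -
    obtain v p w q where xy: "x = (v, p)" "y = (w, q)" by (metis surj_pair)
    then have vp: "v \<in> bvec {..<d}" "w \<in> bvec {..<d}" "p \<in> topspace (points P)" "q \<in> topspace (points P)"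
      using that by (auto simp: topspace_copies)
    have "cover_point Q ?mu (v, f p) = cover_point Q ?mu (w, f q) \<longleftrightarrow> p = q \<and> v + w \<in> lam ` bvec (facets_at P p)"
      unfolding Q.cover_point_eq_iff[OF vp(1,2) fQ[OF vp(3)] fQ[OF vp(4)]] at[OF vp(3)]
      using inj_on_eq_iff[OF f_inj vp(3,4)] by simp
    then show ?thesis
      unfolding xy comp_def prod.case id_def P.cover_point_eq_iff[OF vp] by (rule sym)
  qed
  from quotient_maps_same_fibers[OF P.quotient_map_cover_point quot same]
  obtain h where h: "homeomorphic_map (small_cover P lam) (small_cover Q ?mu) h"
    and "\<And>x. x \<in> topspace (copies d P) \<Longrightarrow> h (cover_point P lam x) = (cover_point Q ?mu \<circ> (\<lambda>(v, p). (id v, f p))) x"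
    by blast
  then have h_eq: "h (cover_point P lam (v, p)) = cover_point Q ?mu (v, f p)"
    if "v \<in> bvec {..<d}" "p \<in> topspace (points P)" for v p
    using that by (auto simp: topspace_copies)
  have "bit_linear (bvec {..<d}) (bvec {..<d}) id" by (simp add: bit_linear_def)
  moreover have "\<forall>v\<in>bvec {..<d}. \<forall>x\<in>topspace (small_cover P lam).
      h (small_cover_act P lam v x) = small_cover_act Q ?mu (id v) (h x)"
    by (auto simp: P.topspace_small_cover h_eq P.small_cover_act_cover_point Q.small_cover_act_cover_point)
  moreover have "\<forall>x\<in>topspace (small_cover P lam). orbit_point (h x) = f (orbit_point x)"
    using fQ by (auto simp: P.topspace_small_cover h_eq P.orbit_point_cover_point Q.orbit_point_cover_point)
  ultimately have "weakly_equivariant_homeo d P lam Q ?mu f h"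
    unfolding weakly_equivariant_homeo_def using h bij_betw_id by blast
  then show ?thesis using that by blast
qed

section \<open>Bundles from block triangular labellings\<close>

text \<open>\<open>t\<close> and \<open>s\<close> split the acting group into base and fiber part,
  \<open>a\<close> and \<open>b\<close> split the polytope. The assumption \<open>block\<close>
  describes the gluing subspace over \<open>p\<close> by a block triangular matrix with diagonal
  blocks \<open>mu\<close>, \<open>nu\<close> and off-diagonal block \<open>\<sigma>\<close>;
  \<open>mu_inj\<close> makes the vector \<open>g\<close> in it unique.\<close>

locale block_triangular_labelling =
  P: surjective_labelling P d lam + Q: surjective_labelling Q e mu + R: surjective_labelling R c nu
  for P :: "('p, 'f) faceted_space" and d lam and Q :: "('q, 'g) faceted_space" and e mu
    and R :: "('r, 'h) faceted_space" and c nu +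
  fixes a :: "'p \<Rightarrow> 'q" and b :: "'p \<Rightarrow> 'r" and t s :: "(nat \<Rightarrow> bit) \<Rightarrow> nat \<Rightarrow> bit"
    and \<sigma> :: "('g \<Rightarrow> bit) \<Rightarrow> nat \<Rightarrow> bit"
  assumes R_nonempty: "topspace (points R) \<noteq> {}"
    and split: "homeomorphic_map (points P) (prod_topology (points Q) (points R)) (\<lambda>p. (a p, b p))"
    and t_add: "\<And>u v. t (u + v) = t u + t v"
    and s_add: "\<And>u v. s (u + v) = s u + s v"
    and bij_ts: "bij_betw (\<lambda>v. (t v, s v)) (bvec {..<d}) (bvec {..<e} \<times> bvec {..<c})"
    and \<sigma>_linear: "bit_linear (bvec (facets Q)) (bvec {..<c}) \<sigma>"
    and mu_inj: "\<And>q. q \<in> topspace (points Q) \<Longrightarrow> inj_on mu (bvec (facets_at Q q))"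
    and block: "\<And>p u. p \<in> topspace (points P) \<Longrightarrow> u \<in> bvec {..<d} \<Longrightarrow>
      u \<in> lam ` bvec (facets_at P p) \<longleftrightarrow>
      (\<exists>g\<in>bvec (facets_at Q (a p)). t u = mu g \<and> s u + \<sigma> g \<in> nu ` bvec (facets_at R (b p)))"
begin

lemma t_in: "v \<in> bvec {..<d} \<Longrightarrow> t v \<in> bvec {..<e}"
  and s_in: "v \<in> bvec {..<d} \<Longrightarrow> s v \<in> bvec {..<c}"
  using bij_betwE[OF bij_ts] by auto

lemma a_in: "p \<in> topspace (points P) \<Longrightarrow> a p \<in> topspace (points Q)"
  and b_in: "p \<in> topspace (points P) \<Longrightarrow> b p \<in> topspace (points R)"
  using homeomorphic_imp_surjective_map[OF split] by auto

lemma ab_inj: "p \<in> topspace (points P) \<Longrightarrow> p' \<in> topspace (points P) \<Longrightarrow> a p = a p' \<Longrightarrow> b p = b p' \<Longrightarrow> p = p'"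
  using homeomorphic_imp_injective_map[OF split] by (auto simp: inj_on_def)

lemma ab_surj:
  assumes "q \<in> topspace (points Q)" "r \<in> topspace (points R)"
  obtains p where "p \<in> topspace (points P)" "a p = q" "b p = r"
proof -
  have "(q, r) \<in> (\<lambda>p. (a p, b p)) ` topspace (points P)"
    using homeomorphic_imp_surjective_map[OF split] assms by simp
  then show ?thesis using that by auto
qed

lemma ts_surj:
  assumes "x \<in> bvec {..<e}" "y \<in> bvec {..<c}"
  obtains v where "v \<in> bvec {..<d}" "t v = x" "s v = y"
proof -
  have "(x, y) \<in> (\<lambda>v. (t v, s v)) ` bvec {..<d}" using bij_ts assms by (simp add: bij_betw_def)
  then show ?thesis using that by auto
qed

lemma continuous_a: "continuous_map (points P) (points Q) a"
  and continuous_b: "continuous_map (points P) (points R) b"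
proof -
  have "continuous_map (points P) (prod_topology (points Q) (points R)) (\<lambda>p. (a p, b p))"
    using split by (rule homeomorphic_imp_continuous_map)
  then show "continuous_map (points P) (points Q) a" "continuous_map (points P) (points R) b"
    by (auto simp: continuous_map_pairwise comp_def)
qed

text \<open>Stated for any \<open>s'\<close> that forms a bijection together with \<open>t\<close>,
  additive or not: besides \<open>s\<close> it is applied to a twist of \<open>s\<close> by a
  function of \<open>t\<close> that behaves additively only on one coset.\<close>

lemma shuffle:
  assumes s': "bij_betw (\<lambda>v. (t v, s' v)) (bvec {..<d}) (bvec {..<e} \<times> bvec {..<c})"
  shows "homeomorphic_map (copies d P) (prod_topology (copies e Q) (copies c R))
    (\<lambda>x. ((t (fst x), a (snd x)), (s' (fst x), b (snd x))))"
proof -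
  obtain k where k: "homeomorphic_maps (points P) (prod_topology (points Q) (points R)) (\<lambda>p. (a p, b p)) k"
    using split homeomorphic_map_maps by blast
  define l where "l = inv_into (bvec {..<d}) (\<lambda>v. (t v, s' v))"
  have l_in: "l z \<in> bvec {..<d}" if "z \<in> bvec {..<e} \<times> bvec {..<c}" for z
    using s' that unfolding l_def bij_betw_def by (metis inv_into_into)
  have l_eq: "(t (l z), s' (l z)) = z" if "z \<in> bvec {..<e} \<times> bvec {..<c}" for z
    using s' that unfolding l_def by (rule bij_betw_inv_into_right)
  have l_left: "l (t v, s' v) = v" if "v \<in> bvec {..<d}" for v
    using s' that unfolding l_def by (rule bij_betw_inv_into_left)
  have s'_in: "s' v \<in> bvec {..<c}" if "v \<in> bvec {..<d}" for v using bij_betwE[OF s'] that by auto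
  have fst_cont: "continuous_map (copies d P) (discrete_topology (bvec {..<d})) fst"
    and snd_cont: "continuous_map (copies d P) (points P) snd"
    by (simp_all add: copies_def continuous_map_fst continuous_map_snd)
  have disc: "continuous_map (copies d P) (discrete_topology B) (f \<circ> fst)" if "f ` bvec {..<d} \<subseteq> B" for f B
    by (rule continuous_map_compose[OF fst_cont]) (use that in auto)
  have cont: "continuous_map (copies d P) (prod_topology (copies e Q) (copies c R))
      (\<lambda>x. ((t (fst x), a (snd x)), (s' (fst x), b (snd x))))"
    unfolding copies_def[of e] copies_def[of c]
    using disc[of t "bvec {..<e}"] disc[of s' "bvec {..<c}"] t_in s'_in
      continuous_map_compose[OF snd_cont continuous_a] continuous_map_compose[OF snd_cont continuous_b]
    by (intro continuous_map_pairedI) (auto simp: comp_def)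
  let ?Y = "prod_topology (copies e Q) (copies c R)"
  have f1: "continuous_map ?Y (copies e Q) fst" "continuous_map ?Y (copies c R) snd"
    by (simp_all add: continuous_map_fst continuous_map_snd)
  have f2: "continuous_map (copies e Q) (discrete_topology (bvec {..<e})) fst" "continuous_map (copies e Q) (points Q) snd"
    "continuous_map (copies c R) (discrete_topology (bvec {..<c})) fst" "continuous_map (copies c R) (points R) snd"
    by (simp_all add: copies_def continuous_map_fst continuous_map_snd)
  have "continuous_map ?Y (prod_topology (discrete_topology (bvec {..<e})) (discrete_topology (bvec {..<c})))
      (\<lambda>y. ((fst \<circ> fst) y, (fst \<circ> snd) y))"
    by (intro continuous_map_pairedI continuous_map_compose[OF f1(1) f2(1)] continuous_map_compose[OF f1(2) f2(3)])
  \<comment> \<open>A product of discrete spaces is discrete, so the inverse \<open>l\<close> of the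
    splitting is continuous whatever it is.\<close>
  then have "continuous_map ?Y (discrete_topology (bvec {..<e} \<times> bvec {..<c})) (\<lambda>y. ((fst \<circ> fst) y, (fst \<circ> snd) y))"
    by (simp add: prod_topology_discrete_topology)
  then have g1: "continuous_map ?Y (discrete_topology (bvec {..<d})) (l \<circ> (\<lambda>y. ((fst \<circ> fst) y, (fst \<circ> snd) y)))"
    by (rule continuous_map_compose) (use l_in in auto)
  have "continuous_map ?Y (prod_topology (points Q) (points R)) (\<lambda>y. ((snd \<circ> fst) y, (snd \<circ> snd) y))"
    by (intro continuous_map_pairedI continuous_map_compose[OF f1(1) f2(2)] continuous_map_compose[OF f1(2) f2(4)])
  then have g2: "continuous_map ?Y (points P) (k \<circ> (\<lambda>y. ((snd \<circ> fst) y, (snd \<circ> snd) y)))"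
    by (rule continuous_map_compose) (use k in \<open>auto simp: homeomorphic_maps_def\<close>)
  have cont': "continuous_map ?Y (copies d P)
      (\<lambda>y. (l (fst (fst y), fst (snd y)), k (snd (fst y), snd (snd y))))"
    unfolding copies_def[of d] using g1 g2 by (intro continuous_map_pairedI) (auto simp: comp_def)
  have k1: "k (a p, b p) = p" if "p \<in> topspace (points P)" for p
    using k that by (auto simp: homeomorphic_maps_def)
  have k2: "(a (k z), b (k z)) = z" if "z \<in> topspace (points Q) \<times> topspace (points R)" for z
    using k that by (auto simp: homeomorphic_maps_def)
  let ?f = "\<lambda>x. ((t (fst x), a (snd x)), (s' (fst x), b (snd x)))"
    and ?g = "\<lambda>y. (l (fst (fst y), fst (snd y)), k (snd (fst y), snd (snd y)))"
  have "homeomorphic_maps (copies d P) ?Y ?f ?g"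
    unfolding homeomorphic_maps_def
  proof (intro conjI cont cont' ballI)
    fix x assume "x \<in> topspace (copies d P)"
    then show "?g (?f x) = x"
      using l_left k1 by (auto simp: topspace_copies)
  next
    fix y assume "y \<in> topspace ?Y"
    then obtain x q z r where y: "y = ((x, q), (z, r))" "(x, z) \<in> bvec {..<e} \<times> bvec {..<c}"
      "(q, r) \<in> topspace (points Q) \<times> topspace (points R)"
      by (cases y) (auto simp: topspace_copies)
    show "?f (?g y) = y"
      using l_eq[OF y(2)] k2[OF y(3)] by (simp add: y(1))
  qed
  then show ?thesis using homeomorphic_map_maps by blast
qed

lemma block_same_fiber:
  assumes v: "v \<in> bvec {..<d}" "w \<in> bvec {..<d}" and p: "p \<in> topspace (points P)"
  shows "cover_point P lam (v, p) = cover_point P lam (w, p) \<longleftrightarrow>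
    (\<exists>g\<in>bvec (facets_at Q (a p)). t v + t w = mu g \<and> s v + s w + \<sigma> g \<in> nu ` bvec (facets_at R (b p)))"
  using block[OF p, of "v + w"] v p by (simp add: P.cover_point_eq_iff t_add s_add)

text \<open>Over the open star of \<open>p0\<close> only facets through \<open>p0\<close> occur, and
  on vectors supported there \<open>mu\<close> is injective. Hence \<open>\<sigma>\<close> becomes a
  function \<open>\<gamma>\<close> of the base coordinate, and adding it to \<open>s\<close> turns
  the block triangular gluing into a product of gluings.\<close>

theorem equivariant_bundle_block_triangular: "\<exists>q. equivariant_bundle d P lam e Q mu c R nu q"
proof -
  let ?M = "small_cover P lam" and ?B = "small_cover Q mu" and ?F = "small_cover R nu"
  define r0 where "r0 = (cover_point Q mu \<circ> (\<lambda>x. (t (fst x), a (snd x))))"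
  have "continuous_map (copies d P) (copies e Q) (\<lambda>x. (t (fst x), a (snd x)))"
  proof -
    have "continuous_map (copies d P) (prod_topology (copies e Q) (copies c R))
        (\<lambda>x. ((t (fst x), a (snd x)), (s (fst x), b (snd x))))"
      using shuffle[OF bij_ts] by (rule homeomorphic_imp_continuous_map)
    then show ?thesis by (auto simp: continuous_map_pairwise comp_def)
  qed
  then have cont: "continuous_map (copies d P) ?B r0"
    unfolding r0_def by (rule continuous_map_compose[OF _ Q.continuous_cover_point])
  have wd: "r0 x = r0 y"
    if xy: "x \<in> topspace (copies d P)" "y \<in> topspace (copies d P)" "cover_point P lam x = cover_point P lam y" for x y
  proof -
    obtain v p w r where [simp]: "x = (v, p)" "y = (w, r)" by (metis surj_pair)
    have vp: "v \<in> bvec {..<d}" "w \<in> bvec {..<d}" "p \<in> topspace (points P)" "r \<in> topspace (points P)"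
      using xy by (auto simp: topspace_copies)
    have "p = r" using xy(3) P.cover_point_eq_iff[OF vp] by simp
    then obtain g where "g \<in> bvec (facets_at Q (a p))" "t v + t w = mu g"
      using xy(3) block_same_fiber[OF vp(1-3)] by auto
    then show ?thesis
      using \<open>p = r\<close> vp t_in a_in by (auto simp: r0_def Q.cover_point_eq_iff)
  qed
  obtain q where q: "continuous_map ?M ?B q"
    and q_eq': "\<And>x. x \<in> topspace (copies d P) \<Longrightarrow> q (cover_point P lam x) = r0 x"
    by (rule quotient_map_lift_exists[OF P.quotient_map_cover_point cont], erule (2) wd, rule that)
  then have q_eq: "q (cover_point P lam (v, p)) = cover_point Q mu (t v, a p)"
    if "v \<in> bvec {..<d}" "p \<in> topspace (points P)" for v p
    using that by (simp add: topspace_copies r0_def)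
  have q_surj: "q ` topspace ?M = topspace ?B"
  proof
    show "q ` topspace ?M \<subseteq> topspace ?B" using q by (rule continuous_map_image_subset_topspace)
    show "topspace ?B \<subseteq> q ` topspace ?M"
    proof
      fix y assume "y \<in> topspace ?B"
      then obtain x r where xr: "x \<in> bvec {..<e}" "r \<in> topspace (points Q)" "y = cover_point Q mu (x, r)"
        by (auto simp: Q.topspace_small_cover)
      show "y \<in> q ` topspace ?M"
      proof -
        obtain z where "z \<in> topspace (points R)" using R_nonempty by blast
        then obtain p where p: "p \<in> topspace (points P)" "a p = r" using ab_surj xr by metis
        obtain v where v: "v \<in> bvec {..<d}" "t v = x" using ts_surj[OF xr(1) bvec_0] by metis
        have "y = q (cover_point P lam (v, p))" using q_eq v p xr by simp
        then show ?thesis using v p by (auto simp: P.topspace_small_cover)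
      qed
    qed
  qed
  have t_surj: "t ` bvec {..<d} = bvec {..<e}"
  proof
    show "t ` bvec {..<d} \<subseteq> bvec {..<e}" using t_in by auto
    show "bvec {..<e} \<subseteq> t ` bvec {..<d}"
    proof
      fix x :: "nat \<Rightarrow> bit" assume "x \<in> bvec {..<e}"
      then show "x \<in> t ` bvec {..<d}" using ts_surj[OF _ bvec_0] by (metis imageI)
    qed
  qed
  have s_bij: "bij_betw s {v \<in> bvec {..<d}. t v = 0} (bvec {..<c})"
    unfolding bij_betw_def
  proof
    show "inj_on s {v \<in> bvec {..<d}. t v = 0}"
      using bij_betw_imp_inj_on[OF bij_ts] by (auto simp: inj_on_def)
    show "s ` {v \<in> bvec {..<d}. t v = 0} = bvec {..<c}"
    proof
      show "s ` {v \<in> bvec {..<d}. t v = 0} \<subseteq> bvec {..<c}" using s_in by auto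
      show "bvec {..<c} \<subseteq> s ` {v \<in> bvec {..<d}. t v = 0}"
      proof
        fix x :: "nat \<Rightarrow> bit" assume "x \<in> bvec {..<c}"
        then obtain v where "v \<in> bvec {..<d}" "t v = 0" "s v = x" using ts_surj[OF bvec_0] by metis
        then show "x \<in> s ` {v \<in> bvec {..<d}. t v = 0}" by auto
      qed
    qed
  qed
  have triv: "\<exists>U h. openin ?B U \<and> y \<in> U \<and>
      homeomorphic_map (subtopology ?M {x \<in> topspace ?M. q x \<in> U}) (prod_topology (subtopology ?B U) ?F) h \<and>
      (\<forall>x\<in>topspace ?M. q x \<in> U \<longrightarrow> fst (h x) = q x \<and>
        (\<forall>v\<in>bvec {..<d}. t v = 0 \<longrightarrow> snd (h (small_cover_act P lam v x)) = small_cover_act R nu (s v) (snd (h x))))"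
    if y: "y \<in> topspace ?B" for y
  proof -
    obtain v0 p0 where v0: "v0 \<in> bvec {..<e}" and p0: "p0 \<in> topspace (points Q)" and y_eq: "y = cover_point Q mu (v0, p0)"
      using y by (auto simp: Q.topspace_small_cover)
    let ?A = "bvec (facets_at Q p0)"
    define H where "H = mu ` ?A"
    \<comment> \<open>The open star of \<open>p0\<close>: the complement of the facets that miss
      \<open>p0\<close>.\<close>
    define N where "N = {p \<in> topspace (points Q). facets_at Q p \<subseteq> facets_at Q p0}"
    \<comment> \<open>The copies of the star that meet at \<open>y\<close> are those indexed by the
      coset of \<open>v0\<close> under \<open>H\<close>.\<close>
    define W where "W = {v \<in> bvec {..<e}. v + v0 \<in> H} \<times> N"
    \<comment> \<open>Outside \<open>H\<close> the value 0 keeps \<open>\<gamma>\<close> inside the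
      fiber group, which the bijectivity of the twisted splitting requires.\<close>
    define \<gamma> where "\<gamma> h = (if h \<in> H then \<sigma> (inv_into ?A mu h) else 0)" for h
    have A_sub: "g \<in> bvec (facets Q)" if "g \<in> ?A" for g using that by (rule Q.bvec_facets_at)
    have \<gamma>_mu: "\<gamma> (mu g) = \<sigma> g" if "g \<in> ?A" for g
      using that mu_inj[OF p0] by (simp add: \<gamma>_def H_def)
    have H_mu_add: "x + mu g \<in> H" "\<gamma> (x + mu g) = \<gamma> x + \<sigma> g" if x: "x \<in> H" and g: "g \<in> ?A" for x g
    proof -
      obtain g' where g': "g' \<in> ?A" "x = mu g'" using x by (auto simp: H_def)
      have eq: "x + mu g = mu (g' + g)" using Q.lam_add A_sub g g' by simp
      then show "x + mu g \<in> H" using g g' by (simp add: H_def)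
      show "\<gamma> (x + mu g) = \<gamma> x + \<sigma> g"
        unfolding eq using g g' A_sub by (simp add: \<gamma>_mu bit_linear_add[OF \<sigma>_linear])
    qed
    have \<gamma>_in: "\<gamma> x \<in> bvec {..<c}" for x
      using bit_linear_in[OF \<sigma>_linear] A_sub inv_into_into[of x mu ?A] by (auto simp: \<gamma>_def H_def)
    have N_open: "openin (points Q) N"
    proof -
      have "N = topspace (points Q) - (\<Union>F\<in>facets Q - facets_at Q p0. facet Q F)"
        by (auto simp: N_def facets_at_def)
      moreover have "closedin (points Q) (\<Union>F\<in>facets Q - facets_at Q p0. facet Q F)"
        using Q.finite_facets Q.closed_facets by (intro closedin_Union) auto
      ultimately show ?thesis by (simp add: openin_diff)
    qed
    have W_open: "openin (copies e Q) W"
      unfolding W_def copies_def openin_prod_Times_iff using N_open by auto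
    have W_sub: "W \<subseteq> topspace (copies e Q)"
      using W_open by (rule openin_subset)
    define U where "U = cover_point Q mu ` W"
    \<comment> \<open>\<open>W\<close> is saturated: a gluing inside the star moves the copy by an
      element of \<open>H\<close> and stays in the coset. This will make the image \<open>U\<close>
      open.\<close>
    have sat: "z \<in> W" if z: "z \<in> topspace (copies e Q)" "cover_point Q mu z \<in> U" for z
    proof -
      obtain x p where [simp]: "z = (x, p)" by (metis surj_pair)
      obtain x' p' where x': "(x', p') \<in> W" "cover_point Q mu (x, p) = cover_point Q mu (x', p')"
        using z by (auto simp: U_def)
      have in': "x' \<in> bvec {..<e}" "p' \<in> topspace (points Q)" using x'(1) W_sub by (auto simp: topspace_copies)
      have xp: "x \<in> bvec {..<e}" "p \<in> topspace (points Q)" using z by (auto simp: topspace_copies)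
      then have "p = p'" "x + x' \<in> mu ` bvec (facets_at Q p)"
        using x'(2) Q.cover_point_eq_iff[OF xp(1) in'(1) xp(2) in'(2)] by auto
      then obtain g where g: "g \<in> bvec (facets_at Q p)" "x + x' = mu g" by auto
      have "facets_at Q p \<subseteq> facets_at Q p0" using x'(1) \<open>p = p'\<close> by (simp add: W_def N_def)
      then have gA: "g \<in> ?A" using g(1) bvec_mono by blast
      have "x' + v0 \<in> H" using x'(1) by (simp add: W_def)
      then have "(x' + v0) + mu g \<in> H" using gA by (rule H_mu_add)
      moreover have "(x' + v0) + mu g = x + v0" unfolding g(2)[symmetric] by (simp only: bit_vec_ac)
      ultimately show "z \<in> W" using xp x'(1) \<open>p = p'\<close> by (simp add: W_def)
    qed
    have U_iff: "cover_point Q mu z \<in> U \<longleftrightarrow> z \<in> W" if "z \<in> topspace (copies e Q)" for z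
      using sat[OF that] by (auto simp: U_def)
    have U_sub: "U \<subseteq> topspace ?B" using W_sub by (auto simp: U_def Q.topspace_small_cover topspace_copies)
    have U_open: "openin ?B U"
    proof -
      have pre: "{z \<in> topspace (copies e Q). cover_point Q mu z \<in> U} = W" using U_iff W_sub by auto
      have "openin (copies e Q) {z \<in> topspace (copies e Q). cover_point Q mu z \<in> U} = openin ?B U"
        using Q.quotient_map_cover_point U_sub unfolding quotient_map_def by blast
      then show ?thesis using W_open unfolding pre by blast
    qed
    have "y \<in> U"
      unfolding U_def y_eq
      using v0 p0 bit_linear_0[OF Q.linear] by (intro imageI) (force simp: W_def N_def H_def intro: image_eqI[of _ _ 0])
    define s' where "s' v = s v + \<gamma> (t v + v0)" for v
    have s'_bij: "bij_betw (\<lambda>v. (t v, s' v)) (bvec {..<d}) (bvec {..<e} \<times> bvec {..<c})"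
    proof -
      \<comment> \<open>A shear by a function of the first coordinate is its own inverse over two
        elements.\<close>
      have "bij_betw (\<lambda>z. (fst z, snd z + \<gamma> (fst z + v0))) (bvec {..<e} \<times> bvec {..<c}) (bvec {..<e} \<times> bvec {..<c})"
        by (rule bij_betw_byWitness[where f' = "\<lambda>z. (fst z, snd z + \<gamma> (fst z + v0))"]) (auto simp: \<gamma>_in)
      from bij_betw_trans[OF bij_ts this] show ?thesis by (simp add: comp_def s'_def)
    qed
    have s'_in: "s' v \<in> bvec {..<c}" if "v \<in> bvec {..<d}" for v using bij_betwE[OF s'_bij] that by auto
    define rho where "rho = (\<lambda>x. (cover_point Q mu (t (fst x), a (snd x)), cover_point R nu (s' (fst x), b (snd x))))"
    \<comment> \<open>Perfectness of the two \<open>cover_point\<close> maps enters here: it makes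
      their product a quotient map.\<close>
    have "quotient_map (copies d P) (prod_topology ?B ?F)
        ((\<lambda>(x, y). (cover_point Q mu x, cover_point R nu y)) \<circ> (\<lambda>x. ((t (fst x), a (snd x)), (s' (fst x), b (snd x)))))"
      using shuffle[OF s'_bij]
      by (intro quotient_map_compose[OF _ perfect_imp_quotient_map[OF perfect_map_prod[OF Q.perfect_map_cover_point R.perfect_map_cover_point]]])
        (simp add: homeomorphic_map_def)
    then have rho: "quotient_map (copies d P) (prod_topology ?B ?F) rho"
      by (simp add: comp_def rho_def)
    define X where "X = {x \<in> topspace (copies d P). (t (fst x), a (snd x)) \<in> W}"
    have ta_in: "(t (fst x), a (snd x)) \<in> topspace (copies e Q)" if "x \<in> topspace (copies d P)" for x
      using that t_in a_in by (auto simp: topspace_copies)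
    have rho_X: "quotient_map (subtopology (copies d P) X) (prod_topology (subtopology ?B U) ?F) rho"
    proof -
      have "{x \<in> topspace (copies d P). rho x \<in> U \<times> topspace ?F} = X"
        using U_iff[OF ta_in] s'_in b_in by (auto simp: X_def rho_def R.topspace_small_cover topspace_copies)
      moreover have "openin (prod_topology ?B ?F) (U \<times> topspace ?F)"
        using U_open by (simp add: openin_prod_Times_iff)
      ultimately have "quotient_map (subtopology (copies d P) X) (subtopology (prod_topology ?B ?F) (U \<times> topspace ?F)) rho"
        using quotient_map_restriction[OF rho] by blast
      then show ?thesis by (simp add: subtopology_Times)
    qed
    have q_cov: "q (cover_point P lam x) = cover_point Q mu (t (fst x), a (snd x))" if "x \<in> topspace (copies d P)" for x
      using q_eq' that by (simp add: r0_def)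
    have Psi_X: "quotient_map (subtopology (copies d P) X) (subtopology ?M {x \<in> topspace ?M. q x \<in> U}) (cover_point P lam)"
    proof (rule quotient_map_restriction[OF P.quotient_map_cover_point])
      show "{x \<in> topspace (copies d P). cover_point P lam x \<in> {x \<in> topspace ?M. q x \<in> U}} = X"
        using q_cov U_iff[OF ta_in] P.topspace_small_cover by (auto simp: X_def topspace_copies)
      show "openin ?M {x \<in> topspace ?M. q x \<in> U} \<or> closedin ?M {x \<in> topspace ?M. q x \<in> U}"
        using openin_continuous_map_preimage[OF q U_open] by simp
    qed
    have same: "cover_point P lam x = cover_point P lam z \<longleftrightarrow> rho x = rho z"
      if "x \<in> topspace (subtopology (copies d P) X)" "z \<in> topspace (subtopology (copies d P) X)" for x z
    proof -
      obtain v p w p' where [simp]: "x = (v, p)" "z = (w, p')" by (metis surj_pair)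
      have xX: "x \<in> X" "z \<in> X" using that by auto
      have vp: "v \<in> bvec {..<d}" "w \<in> bvec {..<d}" "p \<in> topspace (points P)" "p' \<in> topspace (points P)"
        using xX by (auto simp: X_def topspace_copies)
      show ?thesis
      proof (cases "p = p'")
        case False
        then have "a p \<noteq> a p' \<or> b p \<noteq> b p'" using ab_inj vp by blast
        then show ?thesis
          using False vp t_in a_in s'_in b_in
          by (auto simp: rho_def P.cover_point_eq_iff Q.cover_point_eq_iff R.cover_point_eq_iff)
      next
        case True
        have "facets_at Q (a p) \<subseteq> facets_at Q p0" using xX by (simp add: X_def W_def N_def)
        then have sub: "g \<in> ?A" if "g \<in> bvec (facets_at Q (a p))" for g using that bvec_mono by blast
        have wH: "t w + v0 \<in> H" using xX by (simp add: X_def W_def)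
        \<comment> \<open>Gluing by \<open>g\<close> moves the base coordinate by
          \<open>mu g\<close> and therefore \<open>\<gamma>\<close> by \<open>\<sigma> g\<close>. So
          the change of the twisted coordinate \<open>s'\<close> is exactly the sum that
          \<open>block\<close> requires to lie in the gluing subspace of the fiber.\<close>
        have shift: "s' v + s' w = s v + s w + \<sigma> g" if g: "g \<in> bvec (facets_at Q (a p))" "t v + t w = mu g" for g
        proof -
          have "t v + v0 = (t w + v0) + mu g" unfolding g(2)[symmetric] by (simp only: bit_vec_ac)
          then have "\<gamma> (t v + v0) = \<gamma> (t w + v0) + \<sigma> g" using H_mu_add(2)[OF wH sub[OF g(1)]] by (simp only:)
          then show ?thesis by (simp only: s'_def ac_simps bit_vec_add_self_left bit_vec_add_self add.right_neutral add.left_neutral)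
        qed
        have "rho x = rho z \<longleftrightarrow> t v + t w \<in> mu ` bvec (facets_at Q (a p)) \<and> s' v + s' w \<in> nu ` bvec (facets_at R (b p))"
          using True vp t_in a_in s'_in b_in by (simp add: rho_def Q.cover_point_eq_iff R.cover_point_eq_iff)
        also have "\<dots> \<longleftrightarrow> (\<exists>g\<in>bvec (facets_at Q (a p)). t v + t w = mu g \<and> s v + s w + \<sigma> g \<in> nu ` bvec (facets_at R (b p)))"
          using shift by (metis (no_types, lifting) imageE imageI)
        also have "\<dots> \<longleftrightarrow> cover_point P lam x = cover_point P lam z"
          using block_same_fiber[OF vp(1-3)] True by simp
        finally show ?thesis by (rule sym)
      qed
    qed
    obtain h where h: "homeomorphic_map (subtopology ?M {x \<in> topspace ?M. q x \<in> U}) (prod_topology (subtopology ?B U) ?F) h"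
      and h_eq: "\<And>x. x \<in> topspace (subtopology (copies d P) X) \<Longrightarrow> h (cover_point P lam x) = rho x"
      by (rule quotient_maps_same_fibers[OF Psi_X rho_X], erule (1) same, rule that)
    have "fst (h x) = q x \<and>
        (\<forall>v\<in>bvec {..<d}. t v = 0 \<longrightarrow> snd (h (small_cover_act P lam v x)) = small_cover_act R nu (s v) (snd (h x)))"
      if x: "x \<in> topspace ?M" "q x \<in> U" for x
    proof -
      obtain w p where wp: "w \<in> bvec {..<d}" "p \<in> topspace (points P)" "x = cover_point P lam (w, p)"
        using x(1) by (auto simp: P.topspace_small_cover)
      have "cover_point Q mu (t w, a p) \<in> U" using x(2) q_eq wp by simp
      then have W: "(t w, a p) \<in> W" using U_iff wp t_in a_in by (simp add: topspace_copies)
      then have hx: "h x = rho (w, p)" using h_eq[of "(w, p)"] wp by (simp add: X_def topspace_copies)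
      have "snd (h (small_cover_act P lam v x)) = small_cover_act R nu (s v) (snd (h x))"
        if v: "v \<in> bvec {..<d}" "t v = 0" for v
      proof -
        \<comment> \<open>Elements of the kernel of \<open>t\<close> leave the argument of
          \<open>\<gamma>\<close> unchanged, so the twist commutes with their action.\<close>
        have tv: "t (v + w) = t w" using v by (simp add: t_add)
        have "h (small_cover_act P lam v x) = h (cover_point P lam (v + w, p))"
          using wp v by (simp add: P.small_cover_act_cover_point)
        also have "\<dots> = rho (v + w, p)"
          using h_eq[of "(v + w, p)"] wp v W tv by (simp add: X_def topspace_copies)
        finally have "snd (h (small_cover_act P lam v x)) = cover_point R nu (s' (v + w), b p)" by (simp add: rho_def)
        also have "s' (v + w) = s v + s' w" by (simp only: s'_def tv s_add add.assoc)
        also have "cover_point R nu (s v + s' w, b p) = small_cover_act R nu (s v) (cover_point R nu (s' w, b p))"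
          using R.small_cover_act_cover_point[OF s_in[OF v(1)] s'_in[OF wp(1)]] by simp
        finally show ?thesis unfolding hx by (simp add: rho_def)
      qed
      moreover have "fst (h x) = q x" unfolding hx using wp q_eq by (simp add: rho_def)
      ultimately show ?thesis by blast
    qed
    then show ?thesis using U_open \<open>y \<in> U\<close> h by blast
  qed
  have t_lin: "bit_linear (bvec {..<d}) (bvec {..<e}) t"
    using t_in t_add by (auto simp: bit_linear_def)
  have s_lin: "bit_linear {v \<in> bvec {..<d}. t v = 0} (bvec {..<c}) s"
    using s_in s_add by (auto simp: bit_linear_def)
  have equi: "\<forall>v\<in>bvec {..<d}. \<forall>x\<in>topspace ?M. q (small_cover_act P lam v x) = small_cover_act Q mu (t v) (q x)"
    using t_in by (auto simp: P.topspace_small_cover P.small_cover_act_cover_point q_eq Q.small_cover_act_cover_point t_add)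
  have "equivariant_bundle d P lam e Q mu c R nu q"
    unfolding equivariant_bundle_def
    by (intro conjI q q_surj, rule exI[of _ t], rule exI[of _ s],
        intro conjI t_lin t_surj equi s_lin s_bij, rule ballI, erule triv)
  then show ?thesis by blast
qed

end

section \<open>Regular polygons as intersections of half-planes\<close>

text \<open>The outward unit normal of side \<open>j\<close>: its angle is halfway between those of
  the vertices \<open>j\<close> and \<open>j + 1\<close>.\<close>

definition side_normal :: "nat \<Rightarrow> nat \<Rightarrow> complex" where
  "side_normal k j = cis ((2 * real j + 1) * pi / real k)"

text \<open>\<open>cos (pi / real k)\<close> is the apothem, the common distance of all sides from
  the center; the value is positive on the inner side of the line through side
  \<open>j\<close>.\<close>

definition side_distance :: "nat \<Rightarrow> nat \<Rightarrow> complex \<Rightarrow> real" where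
  "side_distance k j z = cos (pi / real k) - inner (side_normal k j) z"

lemma cis_add_2pi_nat: "cis (a + 2 * pi * real q) = cis a"
  by (simp add: complex_eq_iff cos_add sin_add sin_times_pi_eq_0 cos_2pi_minus cis.ctr cos_int_2pin[of "int q", simplified] sin_int_2pin[of "int q", simplified])

lemma polygon_vertex_add: "k > 0 \<Longrightarrow> polygon_vertex k (j + k * q) = polygon_vertex k j"
  using cis_add_2pi_nat[of "2 * pi * real j / real k" q]
  by (simp add: polygon_vertex_def field_simps)

lemma polygon_vertex_mod: "k > 0 \<Longrightarrow> polygon_vertex k (j mod k) = polygon_vertex k j"
  using polygon_vertex_add[of k "j mod k" "j div k"] by simp

lemma side_normal_add: "k > 0 \<Longrightarrow> side_normal k (j + k * q) = side_normal k j"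
  using cis_add_2pi_nat[of "(2 * real j + 1) * pi / real k" q]
  by (simp add: side_normal_def field_simps)

lemma side_normal_mod: "k > 0 \<Longrightarrow> side_normal k (j mod k) = side_normal k j"
  using side_normal_add[of k "j mod k" "j div k"] by simp

lemma inner_cis: "inner (cis a) (cis b) = cos (b - a)"
  by (simp add: inner_complex_def cos_diff)

lemma side_distance_vertex:
  "side_distance k j (polygon_vertex k i) = cos (pi / real k) - cos ((2 * real i - 2 * real j - 1) * pi / real k)"
proof -
  have "2 * pi * real i / real k - (2 * real j + 1) * pi / real k = (2 * real i - 2 * real j - 1) * pi / real k"
    by (simp add: diff_divide_distrib algebra_simps add_divide_distrib)
  then show ?thesis by (simp add: side_distance_def side_normal_def polygon_vertex_def inner_cis)
qed

lemma cos_less_cos_outside: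
  assumes "0 \<le> a" "a < x" "x < 2 * pi - a"
  shows "cos x < cos a"
proof (cases "x \<le> pi")
  case True
  then show ?thesis using assms by (intro cos_monotone_0_pi) auto
next
  case False
  have "cos (2 * pi - x) < cos a" using assms False by (intro cos_monotone_0_pi) auto
  then show ?thesis by simp
qed

text \<open>The angle between vertex \<open>i\<close> and the normal of side \<open>j\<close> is an
  odd multiple of \<open>pi / real k\<close>. Its cosine is at most that of
  \<open>pi / real k\<close>, with equality only for the two nearest vertices, which are the ends of
  the side.\<close>

lemma side_distance_vertex_sign:
  assumes k: "3 \<le> k" and i: "i < k" and j: "j < k"
  shows "0 \<le> side_distance k j (polygon_vertex k i)"
    and "side_distance k j (polygon_vertex k i) = 0 \<longleftrightarrow> i = j \<or> i = Suc j mod k"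
proof -
  let ?a = "pi / real k"
  have a: "0 < ?a" using k by simp
  have "(2 * real k - 1) * ?a = 2 * (real k * ?a) - ?a"
    by (simp only: left_diff_distrib mult.assoc mult_1_left)
  then have ka: "(2 * real k - 1) * ?a = 2 * pi - ?a" using k by simp
  consider "i = j" | "i = Suc j" | "j = k - 1" "i = 0" | "Suc j < i" | "i < j" "\<not> (j = k - 1 \<and> i = 0)"
    by linarith
  then have "0 \<le> side_distance k j (polygon_vertex k i) \<and>
    (side_distance k j (polygon_vertex k i) = 0 \<longleftrightarrow> i = j \<or> i = Suc j mod k)"
  proof cases
    case 1
    then show ?thesis by (simp add: side_distance_vertex)
  next
    case 2
    then show ?thesis using i by (simp add: side_distance_vertex)
  next
    case 3
    \<comment> \<open>The wrap-around: side \<open>k - 1\<close> ends at vertex \<open>k\<close>,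
      which is vertex 0.\<close>
    have "polygon_vertex k 0 = polygon_vertex k k" using polygon_vertex_mod[of k k] k by simp
    moreover have "Suc j = k" using 3 k by simp
    ultimately have "side_distance k j (polygon_vertex k i) = 0"
      using 3 side_distance_vertex[of k j "Suc j"] by (simp add: algebra_simps)
    then show ?thesis using 3 \<open>Suc j = k\<close> by simp
  next
    case 4
    let ?x = "(2 * real i - 2 * real j - 1) * ?a"
    have "1 * ?a < (2 * real i - 2 * real j - 1) * ?a"
      using 4 a by (intro mult_strict_right_mono) auto
    moreover have "(2 * real i - 2 * real j - 1) * ?a < (2 * real k - 1) * ?a"
      using i a by (intro mult_strict_right_mono) auto
    ultimately have "cos ?x < cos ?a"
      unfolding ka using a by (intro cos_less_cos_outside) auto
    then show ?thesis using 4 i by (auto simp: side_distance_vertex)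
  next
    case 5
    let ?x = "(2 * real j - 2 * real i + 1) * ?a"
    have "1 * ?a < (2 * real j - 2 * real i + 1) * ?a"
      using 5 a by (intro mult_strict_right_mono) auto
    moreover have "(2 * real j - 2 * real i + 1) * ?a < (2 * real k - 1) * ?a"
    proof (intro mult_strict_right_mono)
      have "j + 1 < k + i" using 5 j by linarith
      then have "real (j + 1) < real (k + i)" by (simp only: of_nat_less_iff)
      then show "2 * real j - 2 * real i + 1 < 2 * real k - 1" by simp
    qed (rule a)
    ultimately have "cos ?x < cos ?a"
      unfolding ka using a by (intro cos_less_cos_outside) auto
    also have "cos ?x = cos ((2 * real i - 2 * real j - 1) * pi / real k)"
      by (subst cos_minus[symmetric]) (simp add: algebra_simps diff_divide_distrib add_divide_distrib)
    finally have "0 < side_distance k j (polygon_vertex k i)" by (simp add: side_distance_vertex)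
    moreover have "i \<noteq> Suc j mod k" using 5 j by (cases "Suc j = k") auto
    ultimately show ?thesis using 5 by auto
  qed
  then show "0 \<le> side_distance k j (polygon_vertex k i)"
    and "side_distance k j (polygon_vertex k i) = 0 \<longleftrightarrow> i = j \<or> i = Suc j mod k" by auto
qed

lemma side_distance_convex_combination:
  "side_distance k j ((1 - t) *\<^sub>R x + t *\<^sub>R y) = (1 - t) * side_distance k j x + t * side_distance k j y"
  by (simp add: side_distance_def inner_add_right algebra_simps)

abbreviation polygon_hull :: "nat \<Rightarrow> complex set" where
  "polygon_hull k \<equiv> convex hull (polygon_vertex k ` {..<k})"

text \<open>The center is the average of the vertices, since the roots of unity of order
  \<open>k\<close> add up to 0.\<close>

lemma zero_in_polygon_hull:
  assumes "2 \<le> k" shows "0 \<in> polygon_hull k"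
proof -
  have "bij_betw (polygon_vertex k) {..<k} {z. z ^ k = 1}"
    unfolding polygon_vertex_def using Complex.bij_betw_roots_unity[of k] assms by simp
  then have "(\<Sum>j<k. polygon_vertex k j) = \<Sum>{z. z ^ k = 1}"
    using sum.reindex_bij_betw by (metis (no_types, lifting) sum.cong)
  also have "\<dots> = 0" using assms by (intro sum_roots_unity) auto
  finally have "(\<Sum>j<k. (1 / real k) *\<^sub>R polygon_vertex k j) = 0"
    by (simp add: scaleR_right.sum[symmetric])
  moreover have "(\<Sum>j<k. (1 / real k) *\<^sub>R polygon_vertex k j) \<in> polygon_hull k"
    using assms by (intro convex_sum) (auto intro: hull_inc)
  ultimately show ?thesis by simp
qed

text \<open>The polygon is cut into triangles with apex 0. In the angular sector of side
  \<open>j\<close> a point is a combination of the ends of that side with nonnegative coefficients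
  \<open>s\<close> and \<open>t\<close>, and its distance to the side is the apothem times
  \<open>1 - (s + t)\<close>; nonnegativity puts the point into the triangle.\<close>

lemma polygon_hull_eq:
  assumes k: "3 \<le> k"
  shows "polygon_hull k = {z. \<forall>j<k. 0 \<le> side_distance k j z}"
proof
  have "{z. \<forall>j<k. 0 \<le> side_distance k j z} = (\<Inter>j\<in>{..<k}. {z. inner (side_normal k j) z \<le> cos (pi / real k)})"
    by (auto simp: side_distance_def)
  also have "convex \<dots>" by (intro convex_INT convex_halfspace_le)
  finally have "convex {z. \<forall>j<k. 0 \<le> side_distance k j z}" .
  then show "polygon_hull k \<subseteq> {z. \<forall>j<k. 0 \<le> side_distance k j z}"
    using side_distance_vertex_sign(1)[OF k] by (intro hull_minimal) auto
  show "{z. \<forall>j<k. 0 \<le> side_distance k j z} \<subseteq> polygon_hull k"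
  proof
    fix z assume "z \<in> {z. \<forall>j<k. 0 \<le> side_distance k j z}"
    then have z: "0 \<le> side_distance k j z" if "j < k" for j using that by simp
    let ?b = "2 * pi / real k"
    have b: "0 < ?b" "?b < pi" using k by (auto simp: field_simps)
    have kb: "real k * ?b = 2 * pi" using k by simp
    obtain r \<theta> where r: "z = rcis r \<theta>" "0 \<le> r" "0 \<le> \<theta>" "\<theta> < 2 * pi"
    proof -
      have "z = rcis (norm z) (Arg2pi z)" by (simp add: rcis_def Arg2pi_eq cis_conv_exp mult.commute)
      then show ?thesis using that[of "norm z" "Arg2pi z"] Arg2pi_ge_0 Arg2pi_lt_2pi by auto
    qed
    \<comment> \<open>The sector containing \<open>z\<close>, of opening angle \<open>?b\<close>;
      below, \<open>\<phi>\<close> is the angle of \<open>z\<close> within it.\<close>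
    define j where "j = nat \<lfloor>\<theta> / ?b\<rfloor>"
    have fl: "real j \<le> \<theta> / ?b" "\<theta> / ?b < real j + 1"
      using r b unfolding j_def by (auto simp: of_nat_nat)
    define \<phi> where "\<phi> = \<theta> - real j * ?b"
    have "real j * ?b \<le> \<theta>" using fl(1) b(1) by (simp only: pos_le_divide_eq)
    moreover have "\<theta> < (real j + 1) * ?b" using fl(2) b(1) by (simp only: pos_divide_less_eq)
    ultimately have j\<theta>: "real j * ?b \<le> \<theta>" and \<phi>: "0 \<le> \<phi>" "\<phi> < ?b"
      unfolding \<phi>_def distrib_right by linarith+
    have jk: "j < k"
    proof -
      have "real j * ?b < real k * ?b" using j\<theta> r(4) unfolding kb by linarith
      then show ?thesis using b(1) by (simp only: mult_less_cancel_right_pos of_nat_less_iff)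
    qed
    \<comment> \<open>The coefficients come from the law of sines in the parallelogram with diagonal
      \<open>z\<close> and edges along the two ends of the side.\<close>
    define s where "s = r * sin (?b - \<phi>) / sin ?b"
    define t where "t = r * sin \<phi> / sin ?b"
    have sb: "0 < sin ?b" using b by (intro sin_gt_zero) auto
    have s0: "0 \<le> s" unfolding s_def using \<phi> b sb r by (intro divide_nonneg_pos mult_nonneg_nonneg sin_ge_zero) auto
    have t0: "0 \<le> t" unfolding t_def using \<phi> b sb r by (intro divide_nonneg_pos mult_nonneg_nonneg sin_ge_zero) auto
    have vj: "polygon_vertex k j = cis (real j * ?b)" "polygon_vertex k (Suc j) = cis (real j * ?b) * cis ?b"
      by (simp_all add: polygon_vertex_def cis_mult algebra_simps add_divide_distrib)
    have zeq: "z = s *\<^sub>R polygon_vertex k j + t *\<^sub>R polygon_vertex k (Suc j)"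
    proof -
      have "sin ?b *\<^sub>R (s *\<^sub>R (1::complex) + t *\<^sub>R cis ?b) = sin ?b *\<^sub>R (r *\<^sub>R cis \<phi>)"
        using sb by (simp add: complex_eq_iff s_def t_def field_simps sin_diff)
      then have "s *\<^sub>R (1::complex) + t *\<^sub>R cis ?b = r *\<^sub>R cis \<phi>"
        by (rule scaleR_left_imp_eq[rotated]) (use sb in simp)
      then have "cis (real j * ?b) * (s *\<^sub>R (1::complex) + t *\<^sub>R cis ?b) = cis (real j * ?b) * (r *\<^sub>R cis \<phi>)" by simp
      moreover have "cis (real j * ?b) * (r *\<^sub>R cis \<phi>) = z"
        using r(1) by (simp add: rcis_def cis_mult \<phi>_def scaleR_conv_of_real)
      ultimately show ?thesis by (simp add: vj algebra_simps)
    qed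
    have d0: "side_distance k j (polygon_vertex k j) = 0" "side_distance k j (polygon_vertex k (Suc j)) = 0"
      by (simp_all add: side_distance_vertex)
    then have "side_distance k j z = cos (pi / real k) * (1 - (s + t))"
      unfolding zeq by (simp add: side_distance_def inner_add_right algebra_simps)
    then have "0 \<le> cos (pi / real k) * (1 - (s + t))" using z[OF jk] by simp
    moreover have "0 < cos (pi / real k)"
    proof (rule cos_gt_zero)
      show "pi / real k < pi / 2" using k by (simp add: field_simps)
    qed (use k in simp)
    ultimately have st: "s + t \<le> 1" by (simp add: zero_le_mult_iff)
    have vin: "polygon_vertex k j \<in> polygon_hull k" "polygon_vertex k (Suc j) \<in> polygon_hull k"
    proof -
      show "polygon_vertex k j \<in> polygon_hull k" using jk by (auto intro: hull_inc)
      have "polygon_vertex k (Suc j mod k) \<in> polygon_hull k" using k by (intro hull_inc) auto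
      then show "polygon_vertex k (Suc j) \<in> polygon_hull k" using polygon_vertex_mod[of k] k by simp
    qed
    have "z \<in> convex hull {polygon_vertex k j, polygon_vertex k (Suc j), 0}"
      unfolding convex_hull_3 using st s0 t0 zeq
      by (intro CollectI exI[of _ s] exI[of _ t] exI[of _ "1 - s - t"]) auto
    also have "\<dots> \<subseteq> polygon_hull k"
      using vin zero_in_polygon_hull[of k] k by (intro hull_minimal) auto
    finally show "z \<in> polygon_hull k" .
  qed
qed

text \<open>If a convex combination of vertices has distance 0 to side \<open>j\<close>, all its
  terms are nonnegative and hence 0, so the weight sits on the two vertices at distance 0.\<close>

lemma facet_polygon:
  assumes k: "3 \<le> k" and j: "j < k"
  shows "facet (polygon k) j = {z \<in> polygon_hull k. side_distance k j z = 0}"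
proof
  have vin: "polygon_vertex k j \<in> polygon_hull k" "polygon_vertex k (Suc j) \<in> polygon_hull k"
  proof -
    show "polygon_vertex k j \<in> polygon_hull k" using j by (auto intro: hull_inc)
    have "polygon_vertex k (Suc j mod k) \<in> polygon_hull k" using k by (intro hull_inc) auto
    then show "polygon_vertex k (Suc j) \<in> polygon_hull k" using polygon_vertex_mod[of k] k by simp
  qed
  show "facet (polygon k) j \<subseteq> {z \<in> polygon_hull k. side_distance k j z = 0}"
  proof
    fix z assume "z \<in> facet (polygon k) j"
    then have seg: "z \<in> closed_segment (polygon_vertex k j) (polygon_vertex k (Suc j))"
      by (simp add: polygon_def)
    then obtain t where "z = (1 - t) *\<^sub>R polygon_vertex k j + t *\<^sub>R polygon_vertex k (Suc j)"
      by (auto simp: closed_segment_def)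
    then have "side_distance k j z = 0"
      unfolding side_distance_convex_combination by (simp add: side_distance_convex_combination side_distance_vertex)
    moreover have "z \<in> polygon_hull k"
      using seg closed_segment_subset[OF vin convex_convex_hull] by blast
    ultimately show "z \<in> {z \<in> polygon_hull k. side_distance k j z = 0}" by simp
  qed
  show "{z \<in> polygon_hull k. side_distance k j z = 0} \<subseteq> facet (polygon k) j"
  proof
    fix z assume "z \<in> {z \<in> polygon_hull k. side_distance k j z = 0}"
    then have z: "z \<in> polygon_hull k" "side_distance k j z = 0" by auto
    let ?S = "polygon_vertex k ` {..<k}"
    obtain u where u: "\<forall>x\<in>?S. 0 \<le> u x" "sum u ?S = 1" "(\<Sum>x\<in>?S. u x *\<^sub>R x) = z"
      using z(1) by (auto simp: convex_hull_finite)
    have "(\<Sum>x\<in>?S. u x * side_distance k j x) =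
        cos (pi / real k) * sum u ?S - inner (side_normal k j) (\<Sum>x\<in>?S. u x *\<^sub>R x)"
      by (simp add: side_distance_def right_diff_distrib sum_subtractf sum_distrib_left inner_sum_right mult.commute)
    also have "\<dots> = side_distance k j z" unfolding u by (simp add: side_distance_def)
    finally have "(\<Sum>x\<in>?S. u x * side_distance k j x) = 0" using z(2) by simp
    then have zero: "u x * side_distance k j x = 0" if "x \<in> ?S" for x
      using that u(1) side_distance_vertex_sign(1)[OF k _ j]
      by (subst (asm) sum_nonneg_eq_0_iff) auto
    let ?T = "{polygon_vertex k j, polygon_vertex k (Suc j mod k)}"
    have T: "?T \<subseteq> ?S" using j k by auto
    have u0: "u x = 0" if x: "x \<in> ?S - ?T" for x
    proof -
      obtain i where i: "i < k" "x = polygon_vertex k i" "i \<noteq> j" "i \<noteq> Suc j mod k" using x by auto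
      then have "side_distance k j x \<noteq> 0" using side_distance_vertex_sign(2)[OF k i(1) j] by simp
      then show ?thesis using zero[of x] x by auto
    qed
    have "sum u ?T = sum u ?S" "(\<Sum>x\<in>?T. u x *\<^sub>R x) = (\<Sum>x\<in>?S. u x *\<^sub>R x)"
      using u0 by (intro sum.mono_neutral_left T ballI; simp)+
    then have "sum u ?T = 1" "(\<Sum>x\<in>?T. u x *\<^sub>R x) = z" unfolding u by simp_all
    moreover have "\<forall>x\<in>?T. 0 \<le> u x" using T u(1) by blast
    ultimately have "z \<in> convex hull ?T" by (auto simp: convex_hull_finite intro!: exI[of _ u])
    then have "z \<in> closed_segment (polygon_vertex k j) (polygon_vertex k (Suc j mod k))"
      by (simp add: segment_convex_hull)
    then show "z \<in> facet (polygon k) j"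
      using k by (simp add: polygon_def polygon_vertex_mod)
  qed
qed

lemma polygon_simps [simp]:
  "facets (polygon k) = {..<k}" "topspace (points (polygon k)) = polygon_hull k"
  "points (polygon k) = top_of_set (polygon_hull k)"
  by (simp_all add: polygon_def)

lemma polygon_vertex_in_facets:
  assumes "3 \<le> k" "j < k"
  shows "polygon_vertex k (Suc j) \<in> facet (polygon k) j" "polygon_vertex k (Suc j) \<in> facet (polygon k) (Suc j mod k)"
proof -
  show "polygon_vertex k (Suc j) \<in> facet (polygon k) j" by (simp add: polygon_def)
  have "polygon_vertex k (Suc j mod k) \<in> facet (polygon k) (Suc j mod k)" by (simp add: polygon_def)
  then show "polygon_vertex k (Suc j) \<in> facet (polygon k) (Suc j mod k)"
    using assms by (simp add: polygon_vertex_mod)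
qed

text \<open>A point strictly between the ends of a side lies on no other side: both ends would have
  distance 0 to it, but two sides of a polygon with at least three sides do not share both ends. The
  inclusion also covers points on one side or none.\<close>

lemma polygon_facets_at:
  assumes k: "3 \<le> k" and z: "z \<in> polygon_hull k"
  obtains i where "i < k" "{j. j < k \<and> z \<in> facet (polygon k) j} \<subseteq> {i, Suc i mod k}"
proof -
  have vertex: "\<exists>i<k. {j. j < k \<and> polygon_vertex k l \<in> facet (polygon k) j} \<subseteq> {i, Suc i mod k}" if l: "l < k" for l
  proof -
    \<comment> \<open>The side that ends at vertex \<open>l\<close>; adding \<open>k - 1\<close>
      subtracts 1 modulo \<open>k\<close>.\<close>
    define i where "i = (l + (k - 1)) mod k"
    have i: "i < k" "Suc i mod k = l" using l k by (auto simp: i_def mod_Suc_eq)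
    have "j = i \<or> j = Suc i mod k" if "j < k" "polygon_vertex k l \<in> facet (polygon k) j" for j
    proof -
      have "l = j \<or> l = Suc j mod k"
        using that facet_polygon[OF k that(1)] side_distance_vertex_sign(2)[OF k l that(1)] by simp
      moreover have "j = i" if "l = Suc j mod k"
        using that i \<open>j < k\<close> by (cases "Suc j = k"; cases "Suc i = k") auto
      ultimately show ?thesis using i by blast
    qed
    then show ?thesis using i by blast
  qed
  show ?thesis
  proof (cases "\<exists>j<k. z \<in> facet (polygon k) j")
    case False
    then show ?thesis using that[of 0] k by auto
  next
    case True
    then obtain j where j: "j < k" "z \<in> facet (polygon k) j" by auto
    then obtain t where t: "0 \<le> t" "t \<le> 1" "z = (1 - t) *\<^sub>R polygon_vertex k j + t *\<^sub>R polygon_vertex k (Suc j mod k)"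
      using k by (auto simp: polygon_def closed_segment_def polygon_vertex_mod)
    consider "t = 0" | "t = 1" | "0 < t" "t < 1" using t by linarith
    then show ?thesis
    proof cases
      case 1
      then show ?thesis using vertex[OF j(1)] t that by auto
    next
      case 2
      have "Suc j mod k < k" using k by simp
      then show ?thesis using vertex[of "Suc j mod k"] 2 t that by auto
    next
      case 3
      have "i = j" if i: "i < k" "z \<in> facet (polygon k) i" for i
      proof (rule ccontr)
        assume "i \<noteq> j"
        have "side_distance k i z = 0" using i facet_polygon[OF k i(1)] by simp
        then have "(1 - t) * side_distance k i (polygon_vertex k j) +
            t * side_distance k i (polygon_vertex k (Suc j mod k)) = 0"
          unfolding t(3) side_distance_convex_combination .
        moreover have nn: "0 \<le> side_distance k i (polygon_vertex k j)"
          "0 \<le> side_distance k i (polygon_vertex k (Suc j mod k))"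
          using side_distance_vertex_sign(1)[OF k _ i(1)] j k by auto
        ultimately have "(1 - t) * side_distance k i (polygon_vertex k j) = 0"
            "t * side_distance k i (polygon_vertex k (Suc j mod k)) = 0"
          using 3 by (auto simp: add_nonneg_eq_0_iff)
        then have "side_distance k i (polygon_vertex k j) = 0"
          "side_distance k i (polygon_vertex k (Suc j mod k)) = 0" using 3 by auto
        then have a: "j = i \<or> j = Suc i mod k" and b: "Suc j mod k = i \<or> Suc j mod k = Suc i mod k"
          using side_distance_vertex_sign(2)[OF k _ i(1)] j k by auto
        have "j = Suc i mod k" using a \<open>i \<noteq> j\<close> by simp
        moreover have "Suc j mod k = i"
          using b \<open>i \<noteq> j\<close> i j by (cases "Suc j = k"; cases "Suc i = k") auto
        ultimately show False using k i j by (cases "Suc j = k"; cases "Suc i = k") auto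
      qed
      then show ?thesis using that[OF j(1)] by auto
    qed
  qed
qed

section \<open>Characteristic maps of products of polygons\<close>

lemma polygon_product_simps [simp]:
  "facets (polygon_product n m) = (SIGMA i:{..<n}. {..<m i})"
  "points (polygon_product n m) = product_topology (\<lambda>i. top_of_set (polygon_hull (m i))) {..<n}"
  "topspace (points (polygon_product n m)) = (\<Pi>\<^sub>E i\<in>{..<n}. polygon_hull (m i))"
  "facet (polygon_product n m) (i, j) = {x \<in> \<Pi>\<^sub>E i\<in>{..<n}. polygon_hull (m i). x i \<in> facet (polygon (m i)) j}"
  by (simp_all add: polygon_product_def)

lemma facets_at_polygon_product:
  assumes "x \<in> (\<Pi>\<^sub>E i\<in>{..<n}. polygon_hull (m i))"
  shows "facets_at (polygon_product n m) x = {(i, j). i < n \<and> j < m i \<and> x i \<in> facet (polygon (m i)) j}"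
proof (rule set_eqI)
  fix F :: "nat \<times> nat"
  obtain i j where F: "F = (i, j)" by (metis surj_pair)
  show "F \<in> facets_at (polygon_product n m) x \<longleftrightarrow> F \<in> {(i, j). i < n \<and> j < m i \<and> x i \<in> facet (polygon (m i)) j}"
    unfolding F facets_at_def polygon_product_simps mem_Collect_eq case_prod_conv using assms by simp
qed

lemma closedin_facet_polygon:
  assumes "3 \<le> k" "j < k"
  shows "closedin (points (polygon k)) (facet (polygon k) j)"
proof -
  have "facet (polygon k) j \<subseteq> polygon_hull k" using facet_polygon[OF assms] by auto
  moreover have "closed (facet (polygon k) j)" by (simp add: polygon_def)
  ultimately show ?thesis by (simp add: closed_subset)
qed

lemma closedin_facet_polygon_product:
  assumes m: "\<forall>i<n. 3 \<le> m i" and F: "F \<in> facets (polygon_product n m)"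
  shows "closedin (points (polygon_product n m)) (facet (polygon_product n m) F)"
proof -
  obtain i j where ij: "F = (i, j)" "i < n" "j < m i" using F by auto
  have "continuous_map (points (polygon_product n m)) (points (polygon (m i))) (\<lambda>x. x i)"
    using continuous_map_product_projection[of i "{..<n}" "\<lambda>i. top_of_set (polygon_hull (m i))"] ij by simp
  from closedin_continuous_map_preimage[OF this closedin_facet_polygon] show ?thesis
    using m ij by simp
qed

text \<open>A triangularity argument: in the row of the smallest leading position \<open>l x\<close>
  only \<open>x\<close> contributes, because the leading positions are distinct.\<close>

lemma sum_nonzero_leading:
  fixes f :: "'a \<Rightarrow> nat \<Rightarrow> bit"
  assumes T: "finite T" "T \<noteq> {}" and inj: "inj_on l T"
    and low: "\<And>x r. x \<in> T \<Longrightarrow> r \<le> l x \<Longrightarrow> f x r = (if r = l x then 1 else 0)"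
  shows "sum f T \<noteq> 0"
proof
  assume 0: "sum f T = 0"
  obtain x where x: "x \<in> T" "\<And>y. y \<in> T \<Longrightarrow> l x \<le> l y"
    using arg_min_if_finite[OF T] by (metis linorder_not_less arg_min_least[OF T])
  have "sum f T (l x) = (\<Sum>y\<in>T. if y = x then 1 else 0)"
    unfolding sum_fun_apply using x low inj by (intro sum.cong) (auto simp: inj_on_def)
  then show False using 0 x T by simp
qed

lemma characteristic_map_combination:
  assumes fin: "finite (facets P)" and f: "\<And>F. F \<in> facets P \<Longrightarrow> f F \<in> bvec {..<d}"
    and indep: "\<And>p T. p \<in> topspace (points P) \<Longrightarrow> T \<subseteq> facets_at P p \<Longrightarrow> sum f T = 0 \<Longrightarrow> T = {}"
  shows "characteristic_map P d (\<lambda>g. \<Sum>F\<in>facets P. bscale (g F) (f F))"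
  unfolding characteristic_map_def
proof (intro conjI allI impI)
  show "bit_linear (bvec (facets P)) (bvec {..<d}) (\<lambda>g. \<Sum>F\<in>facets P. bscale (g F) (f F))"
    using f by (rule bit_linear_combination)
next
  fix S assume S: "finite S \<and> S \<subseteq> facets P \<and> topspace (points P) \<inter> (\<Inter>F\<in>S. facet P F) \<noteq> {}"
  then obtain p where p: "p \<in> topspace (points P)" "\<forall>F\<in>S. p \<in> facet P F" by auto
  have "S \<subseteq> facets_at P p" using S p by (auto simp: facets_at_def)
  then have *: "\<forall>T\<subseteq>S. sum f T = 0 \<longrightarrow> T = {}" using indep[OF p(1)] by blast
  have eq: "(\<Sum>G\<in>facets P. bscale (unit_vec F G) (f G)) = f F" if "F \<in> S" for F
    using S that fin by (intro combination_unit_vec) auto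
  have "inj_on f S \<and> bitvec.independent (f ` S)" using * S independent_family_iff by blast
  then show "inj_on (\<lambda>F. \<Sum>G\<in>facets P. bscale (unit_vec F G) (f G)) S"
    and "bitvec.independent ((\<lambda>F. \<Sum>G\<in>facets P. bscale (unit_vec F G) (f G)) ` S)"
    using eq by (simp_all cong: inj_on_cong image_cong)
qed

lemma characteristic_map_independent:
  assumes "characteristic_map P d lam" "finite (facets P)" "p \<in> topspace (points P)" "T \<subseteq> facets_at P p"
    "(\<Sum>F\<in>T. lam (unit_vec F)) = 0"
  shows "T = {}"
proof -
  have T: "T \<subseteq> facets P" "\<forall>F\<in>T. p \<in> facet P F" using assms(4) by (auto simp: facets_at_def)
  then have fin: "finite T" using assms(2) finite_subset by blast
  have "topspace (points P) \<inter> (\<Inter>F\<in>T. facet P F) \<noteq> {}" using T assms(3) by auto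
  then have "inj_on (\<lambda>F. lam (unit_vec F)) T \<and> bitvec.independent ((\<lambda>F. lam (unit_vec F)) ` T)"
    using assms(1) T fin by (auto simp: characteristic_map_def)
  then show ?thesis using independent_family_iff[OF fin] assms(5) by blast
qed

lemma characteristic_map_inj:
  assumes char: "characteristic_map P d lam" and fin: "finite (facets P)" and p: "p \<in> topspace (points P)"
  shows "inj_on lam (bvec (facets_at P p))"
proof (rule inj_onI)
  fix g h assume g: "g \<in> bvec (facets_at P p)" and h: "h \<in> bvec (facets_at P p)" and eq: "lam g = lam h"
  have sub: "facets_at P p \<subseteq> facets P" by (auto simp: facets_at_def)
  then have finp: "finite (facets_at P p)" using fin finite_subset by blast
  have lin: "bit_linear (bvec (facets P)) (bvec {..<d}) lam" using char by (simp add: characteristic_map_def)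
  then have lin': "bit_linear (bvec (facets_at P p)) (bvec {..<d}) lam"
    using bvec_mono[OF sub] by (auto simp: bit_linear_def)
  have gh: "g + h \<in> bvec (facets_at P p)" using g h by simp
  have "0 = lam (g + h)" using bit_linear_add[OF lin' g h] eq by simp
  also have "\<dots> = (\<Sum>F\<in>facets_at P p. bscale ((g + h) F) (lam (unit_vec F)))"
    by (rule bit_linear_expand[OF lin' finp gh])
  also have "\<dots> = (\<Sum>F\<in>{F \<in> facets_at P p. (g + h) F = 1}. lam (unit_vec F))"
    by (rule sum_bscale_eq_sum_support[OF finp])
  finally have "{F \<in> facets_at P p. (g + h) F = 1} = {}"
    by (intro characteristic_map_independent[OF char fin p]) auto
  then have "(g + h) F \<noteq> 1" if "F \<in> facets_at P p" for F using that by blast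
  then have "(g + h) F = 0" for F
    using gh by (cases "F \<in> facets_at P p") (auto simp: bvec_def simp del: plus_fun_apply)
  then have "g + h = 0" by (simp add: fun_eq_iff del: plus_fun_apply)
  then show "g = h" by (simp only: bit_vec_add_eq_0_iff)
qed

text \<open>The labels of \<open>d\<close> facets through one point form a basis, so already their
  subset sums exhaust \<open>bvec {..<d}\<close>.\<close>

lemma surjective_labelling_characteristic_map:
  assumes char: "characteristic_map P d lam" and fin: "finite (facets P)"
    and closed: "\<And>F. F \<in> facets P \<Longrightarrow> closedin (points P) (facet P F)"
    and S: "S \<subseteq> facets P" "card S = d" and p: "p \<in> topspace (points P)" "\<And>F. F \<in> S \<Longrightarrow> p \<in> facet P F"
  shows "surjective_labelling P d lam"
proof
  show lin: "bit_linear (bvec (facets P)) (bvec {..<d}) lam" using char by (simp add: characteristic_map_def)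
  have S': "S \<subseteq> facets_at P p" using S p by (auto simp: facets_at_def)
  have finS: "finite S" using S fin finite_subset by blast
  have "bij_betw (sum (\<lambda>F. lam (unit_vec F))) (Pow S) (bvec {..<d})"
  proof (rule independent_family_basis)
    show "(\<lambda>F. lam (unit_vec F)) ` S \<subseteq> bvec {..<d}"
      using S bit_linear_in[OF lin] by auto
    show "T = {}" if "T \<subseteq> S" "(\<Sum>F\<in>T. lam (unit_vec F)) = 0" for T
      using characteristic_map_independent[OF char fin p(1) _ that(2)] that(1) S' by blast
  qed (use S finS in auto)
  then have "bvec {..<d} = sum (\<lambda>F. lam (unit_vec F)) ` Pow S" by (simp add: bij_betw_def)
  also have "\<dots> \<subseteq> lam ` bvec (facets P)"
  proof
    fix v assume "v \<in> sum (\<lambda>F. lam (unit_vec F)) ` Pow S"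
    then obtain T where T: "T \<subseteq> S" "v = (\<Sum>F\<in>T. lam (unit_vec F))" by auto
    have in_P: "unit_vec F \<in> bvec (facets P)" if "F \<in> T" for F using that T S by auto
    then have "v = lam (\<Sum>F\<in>T. unit_vec F)" using T(2) by (simp add: bit_linear_sum[OF lin])
    moreover have "(\<Sum>F\<in>T. unit_vec F) \<in> bvec (facets P)" using in_P by (rule bvec_sum)
    ultimately show "v \<in> lam ` bvec (facets P)" by blast
  qed
  finally show "bvec {..<d} \<subseteq> lam ` bvec (facets P)" .
qed (use fin closed in auto)

lemma polygon_product_vertex:
  assumes m: "\<forall>i<n. 3 \<le> m i" and c: "\<forall>i<n. c i < m i"
  obtains x where "x \<in> topspace (points (polygon_product n m))"
    "\<And>F. F \<in> (SIGMA k:{..<n}. {c k, Suc (c k) mod m k}) \<Longrightarrow> x \<in> facet (polygon_product n m) F"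
    "(SIGMA k:{..<n}. {c k, Suc (c k) mod m k}) \<subseteq> facets (polygon_product n m)"
proof
  \<comment> \<open>Vertex \<open>c k + 1\<close> is the common end of the sides \<open>c k\<close>
    and \<open>c k + 1\<close>.\<close>
  let ?x = "\<lambda>k\<in>{..<n}. polygon_vertex (m k) (Suc (c k))"
  have vin: "polygon_vertex (m k) (Suc (c k)) \<in> polygon_hull (m k)" if "k < n" for k
    using polygon_vertex_in_facets(1)[of "m k" "c k"] facet_polygon[of "m k" "c k"] m c that by auto
  show "?x \<in> topspace (points (polygon_product n m))" using vin by auto
  show "?x \<in> facet (polygon_product n m) F" if "F \<in> (SIGMA k:{..<n}. {c k, Suc (c k) mod m k})" for F
    using that vin polygon_vertex_in_facets m c by auto
  have "Suc (c k) mod m k < m k" if "k < n" for k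
    using m that by (metis less_le_trans mod_less_divisor zero_less_numeral)
  then show "(SIGMA k:{..<n}. {c k, Suc (c k) mod m k}) \<subseteq> facets (polygon_product n m)" using c by auto
qed

lemma card_vertex_facets:
  assumes m: "\<forall>i<n. 3 \<le> m i" and c: "\<forall>i<n. c i < m i"
  shows "card (SIGMA k:{..<n}. {c k, Suc (c k) mod m k}) = 2 * n"
proof -
  have "card {c k, Suc (c k) mod m k} = 2" if "k < n" for k
  proof -
    have "3 \<le> m k" "c k < m k" using m c that by auto
    then have "c k \<noteq> Suc (c k) mod m k" by (cases "Suc (c k) = m k") auto
    then show ?thesis by simp
  qed
  then show ?thesis by simp
qed

lemma surjective_labelling_polygon_product:
  assumes m: "\<forall>i<n. 3 \<le> m i" and char: "characteristic_map (polygon_product n m) (2 * n) lam"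
  shows "surjective_labelling (polygon_product n m) (2 * n) lam"
proof -
  have c: "\<forall>i<n. 0 < m i" using m by force
  from polygon_product_vertex[OF m c] obtain x where x: "x \<in> topspace (points (polygon_product n m))"
    "\<And>F. F \<in> (SIGMA k:{..<n}. {0, Suc 0 mod m k}) \<Longrightarrow> x \<in> facet (polygon_product n m) F"
    "(SIGMA k:{..<n}. {0, Suc 0 mod m k}) \<subseteq> facets (polygon_product n m)" by blast
  show ?thesis
    using card_vertex_facets[OF m c]
    by (intro surjective_labelling_characteristic_map[OF char _ closedin_facet_polygon_product[OF m] x(3) _ x(1) x(2)]) auto
qed

section \<open>The alternating colouring of an even polygon\<close>

definition alternating_map :: "nat \<Rightarrow> (nat \<Rightarrow> bit) \<Rightarrow> nat \<Rightarrow> bit" where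
  "alternating_map k g = (\<Sum>j\<in>facets (polygon k). bscale (g j) (unit_vec (j mod 2)))"

text \<open>Here evenness of \<open>k\<close> enters: the parity also changes in passing from side
  \<open>k - 1\<close> to side 0, so the two sides at any corner have different colours.\<close>

lemma inj_on_parity_facets_at:
  assumes k: "3 \<le> k" "even k" and z: "z \<in> polygon_hull k"
  shows "inj_on (\<lambda>j. j mod 2) {j. j < k \<and> z \<in> facet (polygon k) j}"
proof -
  obtain i where i: "i < k" "{j. j < k \<and> z \<in> facet (polygon k) j} \<subseteq> {i, Suc i mod k}"
    using polygon_facets_at[OF k(1) z] .
  have "i mod 2 \<noteq> Suc i mod k mod 2"
    unfolding mod_mod_cancel[OF k(2)] by presburger
  then have "inj_on (\<lambda>j. j mod 2) {i, Suc i mod k}" by auto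
  then show ?thesis by (rule inj_on_subset) (fact i(2))
qed

lemma characteristic_map_alternating:
  assumes k: "3 \<le> k" "even k"
  shows "characteristic_map (polygon k) 2 (alternating_map k)"
  unfolding alternating_map_def[abs_def]
proof (rule characteristic_map_combination)
  fix z T assume z: "z \<in> topspace (points (polygon k))" and T: "T \<subseteq> facets_at (polygon k) z"
    and 0: "(\<Sum>j\<in>T. unit_vec (j mod 2)) = (0 :: nat \<Rightarrow> bit)"
  have T': "T \<subseteq> {j. j < k \<and> z \<in> facet (polygon k) j}" using T by (auto simp: facets_at_def)
  show "T = {}"
  proof (rule ccontr)
    assume "T \<noteq> {}"
    moreover have "finite T" using T' by (rule finite_subset) simp
    moreover have "inj_on (\<lambda>j. j mod 2) T"
      by (rule inj_on_subset[OF inj_on_parity_facets_at[OF k] T']) (use z in simp)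
    ultimately have "(\<Sum>j\<in>T. unit_vec (j mod 2)) \<noteq> (0 :: nat \<Rightarrow> bit)"
      by (intro sum_nonzero_leading[where l = "\<lambda>j. j mod 2"]) (auto simp: unit_vec_apply)
    then show False using 0 by contradiction
  qed
qed auto

lemma surjective_labelling_alternating:
  assumes k: "3 \<le> k" "even k"
  shows "surjective_labelling (polygon k) 2 (alternating_map k)"
proof (rule surjective_labelling_characteristic_map[OF characteristic_map_alternating[OF k]])
  show "{0, Suc 0 mod k} \<subseteq> facets (polygon k)" "card {0, Suc 0 mod k} = 2" using k by auto
  show "polygon_vertex k (Suc 0) \<in> topspace (points (polygon k))"
    using k by (auto intro!: hull_inc)
  show "polygon_vertex k (Suc 0) \<in> facet (polygon k) F" if "F \<in> {0, Suc 0 mod k}" for F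
    using polygon_vertex_in_facets[of k 0] that k by auto
qed (use closedin_facet_polygon k in auto)

section \<open>The tower of a triangular labelling\<close>

text \<open>The factors are numbered in their new order and the labels are written in the new
  coordinates. The rows \<open>2 * k\<close> and \<open>2 * k + 1\<close> of factor \<open>k\<close>
  show the colour of the side, earlier rows vanish, and later rows are arbitrary.\<close>

locale triangular_labels =
  fixes n :: nat and m :: "nat \<Rightarrow> nat" and A :: "nat \<times> nat \<Rightarrow> nat \<Rightarrow> bit"
  assumes m3: "\<And>k. k < n \<Longrightarrow> 3 \<le> m k" and m_even: "\<And>k. k < n \<Longrightarrow> even (m k)"
    and A_low: "\<And>k j r. k < n \<Longrightarrow> j < m k \<Longrightarrow> r < 2 * k + 2 \<Longrightarrow> A (k, j) r = (if r = 2 * k + j mod 2 then 1 else 0)"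
begin

text \<open>Keeping the first \<open>2 * i\<close> rows divides the acting group by the coordinates
  of the later factors, which leaves the acting group of stage \<open>i\<close>.\<close>

definition stage_label :: "nat \<Rightarrow> nat \<times> nat \<Rightarrow> nat \<Rightarrow> bit" where
  "stage_label i F = (\<lambda>r. if r < 2 * i then A F r else 0)"

definition stage_map :: "nat \<Rightarrow> (nat \<times> nat \<Rightarrow> bit) \<Rightarrow> nat \<Rightarrow> bit" where
  "stage_map i g = (\<Sum>F\<in>facets (polygon_product i m). bscale (g F) (stage_label i F))"

text \<open>At a point, the sides of one factor have different parities, so the leading rows
  \<open>2 * k + j mod 2\<close> of the facets through it are pairwise distinct.\<close>

lemma characteristic_map_stage:
  assumes i: "i \<le> n"
  shows "characteristic_map (polygon_product i m) (2 * i) (stage_map i)"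
  unfolding stage_map_def[abs_def]
proof (rule characteristic_map_combination)
  fix x T assume x: "x \<in> topspace (points (polygon_product i m))" and T: "T \<subseteq> facets_at (polygon_product i m) x"
    and 0: "sum (stage_label i) T = 0"
  have x': "x \<in> (\<Pi>\<^sub>E i\<in>{..<i}. polygon_hull (m i))" using x by simp
  have T': "T \<subseteq> {(k, j). k < i \<and> j < m k \<and> x k \<in> facet (polygon (m k)) j}"
    using T unfolding facets_at_polygon_product[OF x'] .
  show "T = {}"
  proof (rule ccontr)
    assume ne: "T \<noteq> {}"
    have "T \<subseteq> facets (polygon_product i m)" using T by (auto simp: facets_at_def)
    then have "finite T" by (rule finite_subset) simp
    moreover have "inj_on (\<lambda>(k, j). 2 * k + j mod 2) T"
    proof (rule inj_onI)
      fix F G assume FG: "F \<in> T" "G \<in> T" "(\<lambda>(k, j). 2 * k + j mod 2) F = (\<lambda>(k, j). 2 * k + j mod 2) G"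
      obtain k j k' j' where [simp]: "F = (k, j)" "G = (k', j')" by (metis surj_pair)
      have eq: "2 * k + j mod 2 = 2 * k' + j' mod 2" using FG by simp
      then have "k = k'" "j mod 2 = j' mod 2" by presburger+
      moreover have k: "k < n" "x k \<in> polygon_hull (m k)" using FG T' x' i by auto
      ultimately have "j = j'"
        using inj_onD[OF inj_on_parity_facets_at[OF m3[OF k(1)] m_even[OF k(1)] k(2)], of j j'] FG T' by auto
      then show "F = G" using \<open>k = k'\<close> by simp
    qed
    ultimately have "sum (stage_label i) T \<noteq> 0"
    proof (intro sum_nonzero_leading[where l = "\<lambda>(k, j). 2 * k + j mod 2"] ne)
      fix F r assume F: "F \<in> T" "r \<le> (\<lambda>(k, j). 2 * k + j mod 2) F"
      obtain k j where [simp]: "F = (k, j)" by (metis surj_pair)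
      have kj: "k < i" "j < m k" using F T' by auto
      have "r < 2 * k + 2" using F by simp
      then show "stage_label i F r = (if r = (\<lambda>(k, j). 2 * k + j mod 2) F then 1 else 0)"
        using kj i A_low[of k j r] by (auto simp: stage_label_def)
    qed
    then show False using 0 by contradiction
  qed
qed (auto simp: stage_label_def bvec_def)

lemma surjective_labelling_stage:
  assumes "i \<le> n"
  shows "surjective_labelling (polygon_product i m) (2 * i) (stage_map i)"
  using surjective_labelling_polygon_product[OF _ characteristic_map_stage[OF assms]] m3 assms by auto

lemma homeomorphic_map_split:
  "homeomorphic_map (points (polygon_product (Suc i) m))
     (prod_topology (points (polygon_product i m)) (points (polygon (m i)))) (\<lambda>p. (restrict p {..<i}, p i))"
proof -
  let ?X = "\<lambda>i. top_of_set (polygon_hull (m i))"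
  have "homeomorphic_maps (product_topology ?X {..<Suc i}) (prod_topology (product_topology ?X {..<i}) (?X i))
      (\<lambda>p. (restrict p {..<i}, p i)) (\<lambda>(x, y). x(i := y))"
    unfolding homeomorphic_maps_def
  proof (intro conjI ballI)
    show "continuous_map (product_topology ?X {..<Suc i}) (prod_topology (product_topology ?X {..<i}) (?X i))
        (\<lambda>p. (restrict p {..<i}, p i))"
      by (intro continuous_map_pairedI)
        (auto simp: continuous_map_componentwise intro!: continuous_map_product_projection)
    show "continuous_map (prod_topology (product_topology ?X {..<i}) (?X i)) (product_topology ?X {..<Suc i}) (\<lambda>(x, y). x(i := y))"
      unfolding continuous_map_componentwise
    proof (intro conjI ballI)
      show "(\<lambda>(x, y). x(i := y)) ` topspace (prod_topology (product_topology ?X {..<i}) (?X i)) \<subseteq> extensional {..<Suc i}"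
        by (auto simp: extensional_def PiE_def)
      fix k assume k: "k \<in> {..<Suc i}"
      show "continuous_map (prod_topology (product_topology ?X {..<i}) (?X i)) (?X k) (\<lambda>z. (case z of (x, y) \<Rightarrow> x(i := y)) k)"
      proof (cases "k = i")
        case True
        then show ?thesis by (simp add: case_prod_beta continuous_map_snd)
      next
        case False
        then have "continuous_map (prod_topology (product_topology ?X {..<i}) (?X i)) (?X k) ((\<lambda>x. x k) \<circ> fst)"
          using k by (intro continuous_map_compose[OF continuous_map_fst] continuous_map_product_projection) auto
        then show ?thesis using False by (simp add: case_prod_beta comp_def)
      qed
    qed
  next
    fix p assume "p \<in> topspace (product_topology ?X {..<Suc i})"
    then have p: "p \<in> extensional {..<Suc i}" by (simp add: PiE_def)
    show "(case (restrict p {..<i}, p i) of (x, y) \<Rightarrow> x(i := y)) = p"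
    proof
      fix k
      show "(case (restrict p {..<i}, p i) of (x, y) \<Rightarrow> x(i := y)) k = p k"
        using p by (auto simp: extensional_def restrict_def)
    qed
  next
    fix z assume "z \<in> topspace (prod_topology (product_topology ?X {..<i}) (?X i))"
    then obtain x y where z: "z = (x, y)" "x \<in> extensional {..<i}" by (auto simp: PiE_def)
    have "restrict (x(i := y)) {..<i} = x" using z(2) by (auto simp: fun_eq_iff extensional_def restrict_def)
    then show "(restrict (case z of (x, y) \<Rightarrow> x(i := y)) {..<i}, (case z of (x, y) \<Rightarrow> x(i := y)) i) = z"
      by (simp add: z(1))
  qed
  then show ?thesis using homeomorphic_map_maps by (simp del: lessThan_Suc) blast
qed

text \<open>Dropping the last two rows leads from stage \<open>i + 1\<close> to stage
  \<open>i\<close>, since the labels of factor \<open>i\<close> vanish in the remaining rows. In the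
  last two rows these labels are the alternating colouring, and the facets of earlier factors
  contribute the off-diagonal block \<open>\<sigma>\<close>.\<close>

theorem equivariant_bundle_stage:
  assumes i: "i < n"
  shows "\<exists>q. equivariant_bundle (2 * Suc i) (polygon_product (Suc i) m) (stage_map (Suc i))
    (2 * i) (polygon_product i m) (stage_map i) 2 (polygon (m i)) (alternating_map (m i)) q"
proof -
  let ?P = "polygon_product (Suc i) m" and ?Q = "polygon_product i m" and ?R = "polygon (m i)"
  let ?lam = "stage_map (Suc i)" and ?mu = "stage_map i" and ?nu = "alternating_map (m i)"
  define t :: "(nat \<Rightarrow> bit) \<Rightarrow> nat \<Rightarrow> bit" where "t v = (\<lambda>r. if r < 2 * i then v r else 0)" for v
  define s :: "(nat \<Rightarrow> bit) \<Rightarrow> nat \<Rightarrow> bit" where "s v = (\<lambda>r. if r < 2 then v (2 * i + r) else 0)" for v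
  define \<sigma> where "\<sigma> g = (\<Sum>F\<in>facets ?Q. bscale (g F) (s (A F)))" for g
  have t_add: "t (u + v) = t u + t v" and s_add: "s (u + v) = s u + s v" for u v
    by (auto simp: t_def s_def fun_eq_iff)
  have t0: "t 0 = 0" and s0: "s 0 = 0" by (auto simp: t_def s_def fun_eq_iff)
  have t_sum: "t (sum f K) = (\<Sum>k\<in>K. t (f k))" and s_sum: "s (sum f K) = (\<Sum>k\<in>K. s (f k))" for f :: "'x \<Rightarrow> nat \<Rightarrow> bit" and K
    by (induction K rule: infinite_finite_induct) (simp_all only: sum.infinite sum.empty sum.insert t0 s0 t_add s_add not_False_eq_True)
  have t_scale: "t (bscale c v) = bscale c (t v)" and s_scale: "s (bscale c v) = bscale c (s v)" for c v
    by (auto simp: t_def s_def bscale_def fun_eq_iff)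
  have ts_inj: "u = v" if "u \<in> bvec {..<2 * Suc i}" "v \<in> bvec {..<2 * Suc i}" "t u = t v" "s u = s v" for u v
  proof
    fix r
    consider "r < 2 * i" | "2 * i \<le> r" "r < 2 * i + 2" | "2 * Suc i \<le> r" by fastforce
    then show "u r = v r"
    proof cases
      case 1 then show ?thesis using fun_cong[OF that(3), of r] by (simp add: t_def)
    next
      case 2
      then have "r - 2 * i < 2" "2 * i + (r - 2 * i) = r" by auto
      then show ?thesis using fun_cong[OF that(4), of "r - 2 * i"] by (simp add: s_def)
    next
      case 3 then show ?thesis using that by (simp add: bvec_def)
    qed
  qed
  have facets_Suc: "facets ?P = facets ?Q \<union> Pair i ` {..<m i}" by (auto simp: less_Suc_eq)
  have lam_split: "?lam g = (\<Sum>F\<in>facets ?Q. bscale (g F) (stage_label (Suc i) F)) +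
      (\<Sum>j<m i. bscale (g (i, j)) (stage_label (Suc i) (i, j)))" for g
  proof -
    have "?lam g = (\<Sum>F\<in>facets ?Q. bscale (g F) (stage_label (Suc i) F)) +
        (\<Sum>F\<in>Pair i ` {..<m i}. bscale (g F) (stage_label (Suc i) F))"
      unfolding stage_map_def facets_Suc by (intro sum.union_disjoint) auto
    also have "(\<Sum>F\<in>Pair i ` {..<m i}. bscale (g F) (stage_label (Suc i) F)) =
        (\<Sum>j<m i. bscale (g (i, j)) (stage_label (Suc i) (i, j)))"
      by (simp add: sum.reindex inj_on_def)
    finally show ?thesis .
  qed
  have t_lam: "t (?lam g) = ?mu g" for g
  proof -
    have 1: "t (stage_label (Suc i) F) = stage_label i F" for F
      by (auto simp: t_def stage_label_def fun_eq_iff)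
    have 2: "t (stage_label (Suc i) (i, j)) = 0" if "j < m i" for j
      using that i A_low[of i j] by (auto simp: t_def stage_label_def fun_eq_iff)
    have "(\<Sum>j<m i. bscale (g (i, j)) (t (stage_label (Suc i) (i, j)))) = 0"
      using 2 by (intro sum.neutral) auto
    moreover have "(\<Sum>F\<in>facets ?Q. bscale (g F) (t (stage_label (Suc i) F))) = ?mu g"
      unfolding stage_map_def 1 ..
    ultimately show ?thesis unfolding lam_split t_add t_sum t_scale by (simp only: add.right_neutral)
  qed
  have s_lam: "s (?lam g) = \<sigma> g + ?nu (\<lambda>j. g (i, j))" for g
  proof -
    have 1: "s (stage_label (Suc i) F) = s (A F)" for F
      by (auto simp: s_def stage_label_def fun_eq_iff)
    have 2: "s (stage_label (Suc i) (i, j)) = unit_vec (j mod 2)" if "j < m i" for j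
      using that i A_low[of i j] by (auto simp: s_def stage_label_def fun_eq_iff unit_vec_apply)
    have "(\<Sum>F\<in>facets ?Q. bscale (g F) (s (stage_label (Suc i) F))) = \<sigma> g"
      unfolding \<sigma>_def 1 ..
    moreover have "(\<Sum>j<m i. bscale (g (i, j)) (s (stage_label (Suc i) (i, j)))) = ?nu (\<lambda>j. g (i, j))"
      unfolding alternating_map_def polygon_simps using 2 by (intro sum.cong) auto
    ultimately show ?thesis unfolding lam_split s_add s_sum s_scale by (simp only:)
  qed
  have mu_cong: "?mu g = ?mu h" and \<sigma>_cong: "\<sigma> g = \<sigma> h" if "\<And>k j. k < i \<Longrightarrow> g (k, j) = h (k, j)" for g h
    using that by (auto simp: stage_map_def \<sigma>_def intro!: sum.cong)
  have lam_in: "?lam g \<in> bvec {..<2 * Suc i}" for g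
    unfolding stage_map_def by (intro bvec_sum bvec_bscale) (auto simp: stage_label_def bvec_def)
  interpret P: surjective_labelling ?P "2 * Suc i" ?lam using i by (intro surjective_labelling_stage) auto
  interpret Q: surjective_labelling ?Q "2 * i" ?mu using i by (intro surjective_labelling_stage) auto
  interpret R: surjective_labelling ?R 2 ?nu using i m3 m_even by (intro surjective_labelling_alternating) auto
  interpret block_triangular_labelling ?P "2 * Suc i" ?lam ?Q "2 * i" ?mu ?R 2 ?nu
    "\<lambda>p. restrict p {..<i}" "\<lambda>p. p i" t s \<sigma>
  proof
    show "topspace (points ?R) \<noteq> {}" using zero_in_polygon_hull[of "m i"] m3[OF i] by auto
    show "homeomorphic_map (points ?P) (prod_topology (points ?Q) (points ?R)) (\<lambda>p. (restrict p {..<i}, p i))"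
      by (rule homeomorphic_map_split)
    show "t (u + v) = t u + t v" "s (u + v) = s u + s v" for u v by (fact t_add s_add)+
    show "bij_betw (\<lambda>v. (t v, s v)) (bvec {..<2 * Suc i}) (bvec {..<2 * i} \<times> bvec {..<2})"
    proof (rule bij_betwI')
      fix u v assume "u \<in> bvec {..<2 * Suc i}" "v \<in> bvec {..<2 * Suc i}"
      then show "((t u, s u) = (t v, s v)) = (u = v)" using ts_inj by auto
    next
      fix v assume "v \<in> bvec {..<2 * Suc i}"
      show "(t v, s v) \<in> bvec {..<2 * i} \<times> bvec {..<2}" by (auto simp: t_def s_def bvec_def)
    next
      fix y assume "y \<in> bvec {..<2 * i} \<times> (bvec {..<2} :: (nat \<Rightarrow> bit) set)"
      then obtain u w where y: "y = (u, w)" "u \<in> bvec {..<2 * i}" "w \<in> bvec {..<2}" by auto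
      let ?v = "\<lambda>r. if r < 2 * i then u r else w (r - 2 * i)"
      have "?v \<in> bvec {..<2 * Suc i}" using y by (auto simp: bvec_def)
      moreover have "t ?v = u" "s ?v = w" using y by (auto simp: t_def s_def bvec_def fun_eq_iff)
      ultimately show "\<exists>v\<in>bvec {..<2 * Suc i}. y = (t v, s v)" using y(1) by (intro bexI[of _ ?v]) auto
    qed
    show "bit_linear (bvec (facets ?Q)) (bvec {..<2}) \<sigma>"
      unfolding \<sigma>_def[abs_def] by (rule bit_linear_combination) (auto simp: s_def bvec_def)
    show "inj_on ?mu (bvec (facets_at ?Q q))" if "q \<in> topspace (points ?Q)" for q
      using characteristic_map_inj[OF characteristic_map_stage[of i] _ that] i by simp
    show "u \<in> ?lam ` bvec (facets_at ?P p) \<longleftrightarrow>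
        (\<exists>g\<in>bvec (facets_at ?Q (restrict p {..<i})). t u = ?mu g \<and> s u + \<sigma> g \<in> ?nu ` bvec (facets_at ?R (p i)))"
      if p: "p \<in> topspace (points ?P)" and u: "u \<in> bvec {..<2 * Suc i}" for p u
    proof -
      have p': "p \<in> (\<Pi>\<^sub>E i\<in>{..<Suc i}. polygon_hull (m i))" using p by simp
      have rp: "restrict p {..<i} \<in> (\<Pi>\<^sub>E i\<in>{..<i}. polygon_hull (m i))"
        unfolding restrict_PiE_iff using PiE_mem[OF p'] by (meson lessThan_iff less_Suc_eq)
      have atP: "(k, j) \<in> facets_at ?P p \<longleftrightarrow> k \<le> i \<and> j < m k \<and> p k \<in> facet (polygon (m k)) j" for k j
        unfolding facets_at_polygon_product[OF p'] by (simp add: less_Suc_eq_le)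
      have atQ: "(k, j) \<in> facets_at ?Q (restrict p {..<i}) \<longleftrightarrow> k < i \<and> j < m k \<and> p k \<in> facet (polygon (m k)) j" for k j
        unfolding facets_at_polygon_product[OF rp] by (simp cong: conj_cong)
      have atR: "j \<in> facets_at ?R (p i) \<longleftrightarrow> j < m i \<and> p i \<in> facet (polygon (m i)) j" for j
        by (auto simp: facets_at_def)
      show ?thesis
      proof
        assume "u \<in> ?lam ` bvec (facets_at ?P p)"
        then obtain g where g: "g \<in> bvec (facets_at ?P p)" "u = ?lam g" by auto
        \<comment> \<open>Restricting \<open>g\<close> to the earlier factors changes neither the
          base label nor the off-diagonal term.\<close>
        define g' where "g' = (\<lambda>(k, j). if k < i then g (k, j) else 0)"
        have "g' \<in> bvec (facets_at ?Q (restrict p {..<i}))"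
          using g(1) atP atQ by (auto simp: bvec_def g'_def)
        moreover have "(\<lambda>j. g (i, j)) \<in> bvec (facets_at ?R (p i))"
          using g(1) atP atR by (auto simp: bvec_def)
        moreover have "?mu g' = ?mu g" "\<sigma> g' = \<sigma> g"
          by (rule mu_cong \<sigma>_cong; simp add: g'_def)+
        moreover have "s u + \<sigma> g = ?nu (\<lambda>j. g (i, j))" unfolding g(2) s_lam by (simp add: ac_simps)
        ultimately show "\<exists>g\<in>bvec (facets_at ?Q (restrict p {..<i})). t u = ?mu g \<and> s u + \<sigma> g \<in> ?nu ` bvec (facets_at ?R (p i))"
          using t_lam g(2) by (intro bexI[of _ g']) auto
      next
        assume "\<exists>g\<in>bvec (facets_at ?Q (restrict p {..<i})). t u = ?mu g \<and> s u + \<sigma> g \<in> ?nu ` bvec (facets_at ?R (p i))"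
        then obtain g h where g: "g \<in> bvec (facets_at ?Q (restrict p {..<i}))" "t u = ?mu g"
          and h: "h \<in> bvec (facets_at ?R (p i))" "s u + \<sigma> g = ?nu h" by auto
        define f where "f = (\<lambda>(k, j). if k < i then g (k, j) else if k = i then h j else 0)"
        have f: "f \<in> bvec (facets_at ?P p)"
          using g(1) h(1) atP atQ atR by (auto simp: bvec_def f_def)
        have "?mu f = ?mu g" "\<sigma> f = \<sigma> g" by (rule mu_cong \<sigma>_cong; simp add: f_def)+
        moreover have "(\<lambda>j. f (i, j)) = h" by (simp add: f_def)
        ultimately have "t (?lam f) = t u" "s (?lam f) = \<sigma> g + (s u + \<sigma> g)"
          unfolding t_lam s_lam using g(2) h(2) by simp_all
        then have "t (?lam f) = t u" "s (?lam f) = s u"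
          by (simp_all only: bit_vec_ac)
        then have "?lam f = u" using ts_inj[OF lam_in u] by blast
        then show "u \<in> ?lam ` bvec (facets_at ?P p)" using f by blast
      qed
    qed
  qed
  show ?thesis by (rule equivariant_bundle_block_triangular)
qed

end

section \<open>Smooth functions\<close>

lemma Ck_on_has_derivative:
  assumes "open S" "Ck_on (Suc k) S f" "x \<in> S"
  shows "(f has_derivative frechet_derivative f (at x)) (at x)"
proof -
  have "f differentiable at x" using assms by (simp add: differentiable_on_eq_differentiable_at)
  then show ?thesis by (simp add: frechet_derivative_works)
qed

lemma Ck_on_cong:
  assumes "open S" "\<And>x. x \<in> S \<Longrightarrow> f x = g x" "Ck_on k S f"
  shows "Ck_on k S g"
  using assms(2,3)
proof (induction k arbitrary: f g)
  case 0
  then show ?case using continuous_on_cong[of S S f g] by simp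
next
  case (Suc k)
  have deriv: "(g has_derivative frechet_derivative f (at x)) (at x)" if "x \<in> S" for x
    using has_derivative_transform_within_open[OF Ck_on_has_derivative[OF assms(1) Suc.prems(2) that] assms(1) that]
      Suc.prems(1) by blast
  have "g differentiable_on S"
    using deriv unfolding differentiable_on_def differentiable_def by (meson has_derivative_at_withinI)
  moreover have "Ck_on k S (\<lambda>x. frechet_derivative g (at x) v)" for v
  proof (rule Suc.IH)
    show "frechet_derivative f (at x) v = frechet_derivative g (at x) v" if "x \<in> S" for x
      using frechet_derivative_at[OF deriv[OF that]] by simp
    show "Ck_on k S (\<lambda>x. frechet_derivative f (at x) v)" using Suc.prems(2) by simp
  qed
  ultimately show ?case by simp
qed

text \<open>\<open>Ck_on\<close> is phrased with \<open>frechet_derivative\<close>, a chosen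
  derivative; on an open set derivatives are unique, so any explicit formula may replace it.\<close>

lemma Ck_on_SucI:
  assumes "open S" and f: "\<And>x. x \<in> S \<Longrightarrow> (f has_derivative f' x) (at x)"
    and "\<And>v. Ck_on k S (\<lambda>x. f' x v)"
  shows "Ck_on (Suc k) S f"
proof -
  have "f differentiable_on S"
    using f unfolding differentiable_on_def differentiable_def by (meson has_derivative_at_withinI)
  moreover have "Ck_on k S (\<lambda>x. frechet_derivative f (at x) v)" for v
    by (rule Ck_on_cong[OF assms(1) _ assms(3)[of v]]) (simp add: frechet_derivative_at[OF f, symmetric])
  ultimately show ?thesis by simp
qed

lemma Ck_on_Suc_imp: "Ck_on (Suc k) S f \<Longrightarrow> Ck_on k S f"
proof (induction k arbitrary: f)
  case 0
  then show ?case by (simp add: differentiable_imp_continuous_on)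
next
  case (Suc k)
  then show ?case by auto
qed

lemma Ck_on_const: assumes "open S" shows "Ck_on k S (\<lambda>x. c)"
proof (induction k arbitrary: c)
  case (Suc k)
  show ?case by (rule Ck_on_SucI[OF assms has_derivative_const Suc])
qed simp

lemma Ck_on_bounded_linear:
  assumes "open S" "bounded_linear f" shows "Ck_on k S f"
proof (cases k)
  case 0
  then show ?thesis using linear_continuous_on[OF assms(2)] by simp
next
  case (Suc l)
  show ?thesis unfolding Suc
    by (rule Ck_on_SucI[OF assms(1) bounded_linear_imp_has_derivative[OF assms(2)] Ck_on_const[OF assms(1)]])
qed

lemma Ck_on_add:
  assumes "open S" "Ck_on k S f" "Ck_on k S g" shows "Ck_on k S (\<lambda>x. f x + g x)"
  using assms(2,3)
proof (induction k arbitrary: f g)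
  case 0
  then show ?case by (simp add: continuous_on_add)
next
  case (Suc k)
  show ?case
  proof (rule Ck_on_SucI[OF assms(1)])
    show "((\<lambda>x. f x + g x) has_derivative (\<lambda>v. frechet_derivative f (at x) v + frechet_derivative g (at x) v)) (at x)"
      if "x \<in> S" for x
      using Suc.prems that assms(1) by (intro has_derivative_add Ck_on_has_derivative)
    show "Ck_on k S (\<lambda>x. frechet_derivative f (at x) v + frechet_derivative g (at x) v)" for v
      using Suc by simp
  qed
qed

lemma Ck_on_scaleR:
  fixes f :: "'a::real_normed_vector \<Rightarrow> real"
  assumes "open S" "Ck_on k S f" "Ck_on k S g" shows "Ck_on k S (\<lambda>x. f x *\<^sub>R g x)"
  using assms(2,3)
proof (induction k arbitrary: f g)
  case 0
  then show ?case by (simp add: continuous_on_scaleR)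
next
  case (Suc k)
  show ?case
  proof (rule Ck_on_SucI[OF assms(1)])
    show "((\<lambda>x. f x *\<^sub>R g x) has_derivative
        (\<lambda>v. f x *\<^sub>R frechet_derivative g (at x) v + frechet_derivative f (at x) v *\<^sub>R g x)) (at x)"
      if "x \<in> S" for x
      using Suc.prems that assms(1) by (intro has_derivative_scaleR Ck_on_has_derivative)
    show "Ck_on k S (\<lambda>x. f x *\<^sub>R frechet_derivative g (at x) v + frechet_derivative f (at x) v *\<^sub>R g x)" for v
      using Suc Ck_on_Suc_imp[OF Suc.prems(1)] Ck_on_Suc_imp[OF Suc.prems(2)]
      by (intro Ck_on_add[OF assms(1)] Suc.IH) auto
  qed
qed

lemma Ck_on_mult:
  fixes f g :: "'a::real_normed_vector \<Rightarrow> real"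
  assumes "open S" "Ck_on k S f" "Ck_on k S g" shows "Ck_on k S (\<lambda>x. f x * g x)"
  using Ck_on_scaleR[OF assms] by simp

text \<open>The derivative of \<open>1 / sqrt y\<close> is \<open>- 1 / 2\<close> times its own
  cube. So the derivative of the composition is a product of the function itself, which is covered
  by the induction hypothesis, and a derivative of \<open>f\<close>. For the square root alone the
  induction would not close in this way.\<close>

lemma Ck_on_inverse_sqrt:
  fixes f :: "'a::real_normed_vector \<Rightarrow> real"
  assumes "open S" "Ck_on k S f" "\<And>x. x \<in> S \<Longrightarrow> f x > 0"
  shows "Ck_on k S (\<lambda>x. 1 / sqrt (f x))"
  using assms(2)
proof (induction k)
  case 0
  then show ?case using assms(3) by (auto intro!: continuous_intros simp: less_imp_neq[THEN not_sym])
next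
  case (Suc k)
  let ?i = "\<lambda>x. 1 / sqrt (f x)"
  show ?case
  proof (rule Ck_on_SucI[OF assms(1)])
    fix x assume x: "x \<in> S"
    have "((\<lambda>y. 1 / sqrt y) has_real_derivative - 1 / 2 * (?i x * (?i x * ?i x))) (at (f x))"
      using assms(3)[OF x] by (auto intro!: derivative_eq_intros simp: field_simps)
    then have "((\<lambda>y. 1 / sqrt y) has_derivative (*) (- 1 / 2 * (?i x * (?i x * ?i x)))) (at (f x))"
      by (simp add: has_field_derivative_def)
    from has_derivative_compose[OF Ck_on_has_derivative[OF assms(1) Suc.prems x] this]
    show "(?i has_derivative (\<lambda>v. - 1 / 2 * (?i x * (?i x * ?i x)) * frechet_derivative f (at x) v)) (at x)" .
  next
    show "Ck_on k S (\<lambda>x. - 1 / 2 * (?i x * (?i x * ?i x)) * frechet_derivative f (at x) v)" for v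
      using Suc Ck_on_Suc_imp[OF Suc.prems] by (intro Ck_on_mult[OF assms(1)] Ck_on_const[OF assms(1)]) auto
  qed
qed

lemma Ck_on_sqrt:
  fixes f :: "'a::real_normed_vector \<Rightarrow> real"
  assumes "open S" "Ck_on k S f" "\<And>x. x \<in> S \<Longrightarrow> f x > 0"
  shows "Ck_on k S (\<lambda>x. sqrt (f x))"
proof -
  have "f x * (1 / sqrt (f x)) = sqrt (f x)" if "x \<in> S" for x
    using assms(3)[OF that] by (simp add: real_div_sqrt)
  moreover have "Ck_on k S (\<lambda>x. f x * (1 / sqrt (f x)))"
    by (rule Ck_on_mult[OF assms(1,2) Ck_on_inverse_sqrt[OF assms]])
  ultimately show ?thesis by (rule Ck_on_cong[OF assms(1)])
qed

section \<open>Orientability of the small cover over an alternating polygon\<close>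

subsection \<open>Transition maps between corners\<close>

text \<open>The factor \<open>x $ i * (1 / sqrt ((x $ i)\<^sup>2))\<close> is the sign of \<open>x $ i\<close>, written as a composition of
  functions that are smooth where \<open>x $ i \<noteq> 0\<close>.\<close>

definition corner_branch :: "2 \<Rightarrow> bool \<Rightarrow> real \<Rightarrow> real \<Rightarrow> real \<Rightarrow> real \<Rightarrow> real ^ 2 \<Rightarrow> real" where
  "corner_branch i same e \<alpha> \<beta> \<gamma> x =
    (if same then e * x $ i
     else e * (x $ i * (1 / sqrt ((x $ i)\<^sup>2))) * sqrt (\<alpha> + \<beta> * (x $ 1)\<^sup>2 + \<gamma> * (x $ 2)\<^sup>2))"

lemma Ck_on_corner_branch:
  assumes S: "open S"
    and pos: "\<And>x. x \<in> S \<Longrightarrow> \<not> same \<Longrightarrow> x $ i \<noteq> 0 \<and> 0 < \<alpha> + \<beta> * (x $ 1)\<^sup>2 + \<gamma> * (x $ 2)\<^sup>2"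
  shows "Ck_on k S (corner_branch i same e \<alpha> \<beta> \<gamma>)"
proof -
  have nth: "Ck_on k S (\<lambda>x. x $ j)" for j :: 2
    by (rule Ck_on_bounded_linear[OF S bounded_linear_vec_nth])
  note rules = Ck_on_mult[OF S] Ck_on_add[OF S] Ck_on_const[OF S] nth
  show ?thesis
  proof (cases same)
    case True
    then show ?thesis unfolding corner_branch_def[abs_def] if_P[OF True] by (intro rules)
  next
    case False
    then show ?thesis
      unfolding corner_branch_def[abs_def] if_not_P[OF False] power2_eq_square
      using pos[unfolded power2_eq_square]
      by (intro rules Ck_on_inverse_sqrt[OF S] Ck_on_sqrt[OF S])
        (auto simp: zero_less_mult_iff linorder_neq_iff disj_commute)
  qed
qed

lemma has_derivative_corner_branch_same:
  "(corner_branch i True e \<alpha> \<beta> \<gamma> has_derivative (\<lambda>h. e * h $ i)) (at x)"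
proof -
  have "bounded_linear (\<lambda>x :: real ^ 2. e * x $ i)"
    by (intro bounded_linear_mult_right[THEN bounded_linear_compose] bounded_linear_vec_nth)
  then show ?thesis
    unfolding corner_branch_def[abs_def] if_P[OF TrueI] by (rule bounded_linear_imp_has_derivative)
qed

text \<open>Near \<open>x\<close> the sign of coordinate \<open>i\<close> is constant, so the branch
  agrees there with a constant multiple of the square root of a quadratic polynomial.\<close>

lemma has_derivative_corner_branch:
  assumes xi: "x $ i \<noteq> 0" and Q: "0 < \<alpha> + \<beta> * (x $ 1)\<^sup>2 + \<gamma> * (x $ 2)\<^sup>2"
  shows "(corner_branch i False e \<alpha> \<beta> \<gamma> has_derivative
    (\<lambda>h. e * sgn (x $ i) * (\<beta> * x $ 1 * h $ 1 + \<gamma> * x $ 2 * h $ 2) / sqrt (\<alpha> + \<beta> * (x $ 1)\<^sup>2 + \<gamma> * (x $ 2)\<^sup>2))) (at x)"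
proof -
  let ?Q = "\<lambda>x :: real ^ 2. \<alpha> + \<beta> * (x $ 1)\<^sup>2 + \<gamma> * (x $ 2)\<^sup>2"
  let ?S = "{y :: real ^ 2. 0 < y $ i * x $ i}"
  have S: "open ?S" by (intro open_Collect_less continuous_intros)
  have xS: "x \<in> ?S" using xi by (simp add: zero_less_mult_iff linorder_neq_iff disj_commute)
  have nth: "((\<lambda>x :: real ^ 2. x $ j) has_derivative (\<lambda>h. h $ j)) (at x)" for j
    by (rule bounded_linear_imp_has_derivative[OF bounded_linear_vec_nth])
  have nth2: "((\<lambda>x :: real ^ 2. (x $ j)\<^sup>2) has_derivative (\<lambda>h. 2 * (x $ j * h $ j))) (at x)" for j
    using has_derivative_power[OF nth[of j], of 2] by (simp add: ac_simps)
  have Q': "(?Q has_derivative (\<lambda>h. 2 * (\<beta> * x $ 1 * h $ 1 + \<gamma> * x $ 2 * h $ 2))) (at x)"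
  proof -
    have "(?Q has_derivative (\<lambda>h. 0 + \<beta> * (2 * (x $ 1 * h $ 1)) + \<gamma> * (2 * (x $ 2 * h $ 2)))) (at x)"
      by (intro has_derivative_add has_derivative_const has_derivative_mult_right nth2)
    then show ?thesis by (simp add: distrib_left mult.left_commute mult.assoc)
  qed
  have sq: "(sqrt has_derivative (\<lambda>y. y / (2 * sqrt (?Q x)))) (at (?Q x))"
  proof -
    have "(*) (inverse (sqrt q) / 2) = (\<lambda>y. y / (2 * sqrt q))" for q :: real
      by (rule ext) (simp add: divide_simps)
    then show ?thesis using DERIV_real_sqrt[OF Q] by (simp only: has_field_derivative_def)
  qed
  have "((\<lambda>y. sqrt (?Q y)) has_derivative (\<lambda>h. (\<beta> * x $ 1 * h $ 1 + \<gamma> * x $ 2 * h $ 2) / sqrt (?Q x))) (at x)"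
  proof -
    have "(2 * a) / (2 * b) = a / b" for a b :: real by simp
    then show ?thesis using has_derivative_compose[OF Q' sq] by (simp only:)
  qed
  from has_derivative_mult_right[OF this, of "e * sgn (x $ i)"]
  have "((\<lambda>y. e * sgn (x $ i) * sqrt (?Q y)) has_derivative
      (\<lambda>h. e * sgn (x $ i) * (\<beta> * x $ 1 * h $ 1 + \<gamma> * x $ 2 * h $ 2) / sqrt (?Q x))) (at x)" by simp
  then show ?thesis
  proof (rule has_derivative_transform_within_open[OF _ S xS])
    fix y assume "y \<in> ?S"
    then have "y $ i * (1 / sqrt ((y $ i)\<^sup>2)) = sgn (x $ i)"
      by (auto simp: zero_less_mult_iff sgn_if)
    then show "e * sgn (x $ i) * sqrt (?Q y) = corner_branch i False e \<alpha> \<beta> \<gamma> y"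
      by (simp add: corner_branch_def)
  qed
qed

text \<open>The flags say whether two corners share their even or their odd side; the triples
  express the side distances at the new corner through the squared coordinates at the old one.
  \<open>E\<close> collects the orientation signs, which act on the first coordinate only.\<close>

definition corner_transition ::
  "bool \<Rightarrow> bool \<Rightarrow> real \<Rightarrow> real \<times> real \<times> real \<Rightarrow> real \<times> real \<times> real \<Rightarrow> real ^ 2 \<Rightarrow> real ^ 2" where
  "corner_transition same1 same2 E = (\<lambda>(\<alpha>, \<beta>, \<gamma>) (\<alpha>', \<beta>', \<gamma>') x.
    corner_branch 1 same1 E \<alpha> \<beta> \<gamma> x *\<^sub>R axis 1 1 + corner_branch 2 same2 1 \<alpha>' \<beta>' \<gamma>' x *\<^sub>R axis 2 1)"

lemma Ck_on_corner_transition: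
  assumes S: "open S"
    and "\<And>x. x \<in> S \<Longrightarrow> \<not> same1 \<Longrightarrow> x $ 1 \<noteq> 0 \<and> 0 < \<alpha> + \<beta> * (x $ 1)\<^sup>2 + \<gamma> * (x $ 2)\<^sup>2"
    and "\<And>x. x \<in> S \<Longrightarrow> \<not> same2 \<Longrightarrow> x $ 2 \<noteq> 0 \<and> 0 < \<alpha>' + \<beta>' * (x $ 1)\<^sup>2 + \<gamma>' * (x $ 2)\<^sup>2"
  shows "Ck_on k S (corner_transition same1 same2 E (\<alpha>, \<beta>, \<gamma>) (\<alpha>', \<beta>', \<gamma>'))"
  unfolding corner_transition_def prod.case
  by (intro Ck_on_add[OF S] Ck_on_scaleR[OF S] Ck_on_const[OF S] Ck_on_corner_branch[OF S] assms(2,3))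

text \<open>\<open>\<beta> * \<gamma>' - \<gamma> * \<beta>'\<close> is the determinant of the affine map between the side distances at the two
  corners; the squaring maps on both sides contribute positive factors only.\<close>

lemma det_corner_transition_pos:
  assumes p1: "\<not> same1 \<Longrightarrow> x $ 1 \<noteq> 0 \<and> 0 < \<alpha> + \<beta> * (x $ 1)\<^sup>2 + \<gamma> * (x $ 2)\<^sup>2"
    and p2: "\<not> same2 \<Longrightarrow> x $ 2 \<noteq> 0 \<and> 0 < \<alpha>' + \<beta>' * (x $ 1)\<^sup>2 + \<gamma>' * (x $ 2)\<^sup>2"
    and s1: "same1 \<Longrightarrow> \<beta> = 1 \<and> \<gamma> = 0" and s2: "same2 \<Longrightarrow> \<beta>' = 0 \<and> \<gamma>' = 1"
    and E: "0 < E * (\<beta> * \<gamma>' - \<gamma> * \<beta>')"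
    and T: "open S" "x \<in> S" "\<And>y. y \<in> S \<Longrightarrow> corner_transition same1 same2 E (\<alpha>, \<beta>, \<gamma>) (\<alpha>', \<beta>', \<gamma>') y = f y"
  shows "0 < det (matrix (frechet_derivative f (at x)))"
proof -
  let ?Q1 = "sqrt (\<alpha> + \<beta> * (x $ 1)\<^sup>2 + \<gamma> * (x $ 2)\<^sup>2)" and ?Q2 = "sqrt (\<alpha>' + \<beta>' * (x $ 1)\<^sup>2 + \<gamma>' * (x $ 2)\<^sup>2)"
  define d1 where "d1 = (\<lambda>h :: real ^ 2. if same1 then E * h $ 1 else E * sgn (x $ 1) * (\<beta> * x $ 1 * h $ 1 + \<gamma> * x $ 2 * h $ 2) / ?Q1)"
  define d2 where "d2 = (\<lambda>h :: real ^ 2. if same2 then h $ 2 else sgn (x $ 2) * (\<beta>' * x $ 1 * h $ 1 + \<gamma>' * x $ 2 * h $ 2) / ?Q2)"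
  have D1: "(corner_branch 1 same1 E \<alpha> \<beta> \<gamma> has_derivative d1) (at x)"
    using has_derivative_corner_branch_same[of 1 E] has_derivative_corner_branch[of x 1] p1
    by (cases same1) (simp_all add: d1_def[abs_def])
  have D2: "(corner_branch 2 same2 1 \<alpha>' \<beta>' \<gamma>' has_derivative d2) (at x)"
    using has_derivative_corner_branch_same[of 2 1] has_derivative_corner_branch[of x 2 _ _ _ 1] p2
    by (cases same2) (simp_all add: d2_def[abs_def])
  have "(corner_transition same1 same2 E (\<alpha>, \<beta>, \<gamma>) (\<alpha>', \<beta>', \<gamma>') has_derivative
      (\<lambda>h. d1 h *\<^sub>R axis 1 1 + d2 h *\<^sub>R axis 2 1)) (at x)"
    unfolding corner_transition_def prod.case
    by (intro has_derivative_add has_derivative_scaleR_left D1 D2)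
  then have "(f has_derivative (\<lambda>h. d1 h *\<^sub>R axis 1 1 + d2 h *\<^sub>R axis 2 1)) (at x)"
    by (rule has_derivative_transform_within_open[OF _ T(1,2)]) (rule T(3))
  from frechet_derivative_at[OF this]
  have fr: "frechet_derivative f (at x) = (\<lambda>h. d1 h *\<^sub>R axis 1 1 + d2 h *\<^sub>R axis 2 1)" by (rule sym)
  have det: "det (matrix (frechet_derivative f (at x))) = d1 (axis 1 1) * d2 (axis 2 1) - d1 (axis 2 1) * d2 (axis 1 1)"
    unfolding fr det_2 matrix_def by (simp add: axis_def)
  have sg: "sgn a * a = \<bar>a\<bar>" for a :: real by (simp add: sgn_if)
  show ?thesis
  proof (cases same1)
    case True
    note s = s1[OF True]
    have d1: "d1 (axis 1 1) = E" "d1 (axis 2 1) = 0" by (simp_all add: d1_def True axis_def)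
    show ?thesis
    proof (cases same2)
      case True
      then show ?thesis unfolding det d1 using E s s2 by (simp add: d2_def axis_def)
    next
      case False
      have "d2 (axis 2 1) = \<gamma>' * (\<bar>x $ 2\<bar> / ?Q2)"
        using False sg[of "x $ 2"] by (simp add: d2_def axis_def algebra_simps)
      moreover have "0 < \<bar>x $ 2\<bar> / ?Q2" using p2[OF False] by simp
      moreover have "0 < E * \<gamma>'" using E s by simp
      ultimately show ?thesis unfolding det d1 by (simp add: mult.assoc[symmetric] del: times_divide_eq_right)
    qed
  next
    case False
    note n1 = this
    have k1: "0 < \<bar>x $ 1\<bar>" "0 < ?Q1" using p1[OF False] by simp_all
    have d1: "d1 (axis 1 1) = E * \<beta> * (\<bar>x $ 1\<bar> / ?Q1)" "d1 (axis 2 1) = E * \<gamma> * (sgn (x $ 1) * x $ 2 / ?Q1)"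
      using False sg[of "x $ 1"] by (simp_all add: d1_def axis_def algebra_simps)
    show ?thesis
    proof (cases same2)
      case True
      have d2: "d2 (axis 1 1) = 0" "d2 (axis 2 1) = 1" by (simp_all add: d2_def True axis_def)
      have "0 < E * \<beta>" using E s2[OF True] by simp
      then show ?thesis unfolding det d1 d2 using k1 by (simp add: zero_less_mult_iff zero_less_divide_iff)
    next
      case False
      have k2: "0 < \<bar>x $ 2\<bar>" "0 < ?Q2" using p2[OF False] by simp_all
      have d2: "d2 (axis 2 1) = \<gamma>' * (\<bar>x $ 2\<bar> / ?Q2)" "d2 (axis 1 1) = \<beta>' * (sgn (x $ 2) * x $ 1 / ?Q2)"
        using False sg[of "x $ 2"] by (simp_all add: d2_def axis_def algebra_simps)
      \<comment> \<open>The off-diagonal product contains the same signs and coordinates as the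
        diagonal one, only paired differently, so the determinant factors.\<close>
      have "(sgn (x $ 1) * x $ 2 / ?Q1) * (sgn (x $ 2) * x $ 1 / ?Q2) = (sgn (x $ 1) * x $ 1) * (sgn (x $ 2) * x $ 2) / (?Q1 * ?Q2)"
        by (simp add: ac_simps)
      also have "\<dots> = (\<bar>x $ 1\<bar> / ?Q1) * (\<bar>x $ 2\<bar> / ?Q2)" unfolding sg by simp
      finally have prod: "(sgn (x $ 1) * x $ 2 / ?Q1) * (sgn (x $ 2) * x $ 1 / ?Q2) = (\<bar>x $ 1\<bar> / ?Q1) * (\<bar>x $ 2\<bar> / ?Q2)" .
      have "E * \<beta> * a * (\<gamma>' * b) - E * \<gamma> * a' * (\<beta>' * b') = E * (\<beta> * \<gamma>' - \<gamma> * \<beta>') * (a * b)"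
        if "a' * b' = a * b" for a b a' b' :: real
      proof -
        have eq: "E * \<gamma> * a' * (\<beta>' * b') = E * \<gamma> * \<beta>' * (a' * b')" by (simp only: ac_simps)
        show ?thesis unfolding eq that by (simp add: algebra_simps)
      qed
      from this[OF prod] have "det (matrix (frechet_derivative f (at x))) =
          E * (\<beta> * \<gamma>' - \<gamma> * \<beta>') * ((\<bar>x $ 1\<bar> / ?Q1) * (\<bar>x $ 2\<bar> / ?Q2))"
        unfolding det d1 d2 .
      moreover have "0 < (\<bar>x $ 1\<bar> / ?Q1) * (\<bar>x $ 2\<bar> / ?Q2)" using k1 k2 by (intro mult_pos_pos divide_pos_pos)
      ultimately show ?thesis using E by (simp only: mult_pos_pos)
    qed
  qed
qed

subsection \<open>Affine coordinates at a corner\<close>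

text \<open>The determinant of two plane vectors, that is, the oriented area they span.\<close>

definition cross :: "complex \<Rightarrow> complex \<Rightarrow> real" where
  "cross u v = Re u * Im v - Im u * Re v"

text \<open>Cramer's rule for the coordinates of \<open>w\<close> in the frame \<open>u\<close>,
  \<open>v\<close>.\<close>

lemma cross_decompose:
  assumes "cross u v \<noteq> 0"
  shows "w = (cross w v / cross u v) *\<^sub>R u + (cross u w / cross u v) *\<^sub>R v"
proof -
  have "cross u v *\<^sub>R w = cross w v *\<^sub>R u + cross u w *\<^sub>R v"
    by (simp add: complex_eq_iff cross_def algebra_simps)
  then have "(1 / cross u v) *\<^sub>R (cross u v *\<^sub>R w) = (1 / cross u v) *\<^sub>R (cross w v *\<^sub>R u + cross u w *\<^sub>R v)" by simp
  then show ?thesis using assms by (simp add: scaleR_add_right)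
qed

lemma cross_combination:
  "cross (a *\<^sub>R u + b *\<^sub>R v) (c *\<^sub>R u + d *\<^sub>R v) = (a * d - b * c) * cross u v"
  by (simp add: cross_def algebra_simps)

lemma cross_cis: "cross (cis a) (cis b) = sin (b - a)"
  by (simp add: cross_def sin_diff)

text \<open>The even and the odd side at the corner between the sides \<open>c\<close> and \<open>c + 1\<close>.\<close>

definition even_side :: "nat \<Rightarrow> nat \<Rightarrow> nat" where
  "even_side k c = (if even c then c else Suc c mod k)"

definition odd_side :: "nat \<Rightarrow> nat \<Rightarrow> nat" where
  "odd_side k c = (if even c then Suc c mod k else c)"

text \<open>Passing the even side before the odd one is anticlockwise at even corners and clockwise at odd
  ones.\<close>

definition corner_sign :: "nat \<Rightarrow> real" where
  "corner_sign c = (if even c then 1 else - 1)"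

definition bit_sign :: "bit \<Rightarrow> real" where
  "bit_sign b = (if b = 0 then 1 else - 1)"

lemma corner_sign_sq: "corner_sign c * corner_sign c = 1"
  by (simp add: corner_sign_def)

locale even_polygon =
  fixes k :: nat
  assumes k3: "3 \<le> k" and k_even: "even k"
begin

abbreviation "D \<equiv> side_distance k"
abbreviation "nrm \<equiv> side_normal k"
abbreviation "ev \<equiv> even_side k"
abbreviation "od \<equiv> odd_side k"
abbreviation "H \<equiv> polygon_hull k"

lemma even_Suc_mod: "even (Suc c mod k) \<longleftrightarrow> odd c"
  using k_even by (metis dvd_mod_iff even_Suc)

lemma sides: assumes "c < k" shows "ev c < k" "od c < k" "even (ev c)" "odd (od c)" "{ev c, od c} = {c, Suc c mod k}"
  using assms even_Suc_mod by (auto simp: even_side_def odd_side_def)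

text \<open>Consecutive normals turn anticlockwise by \<open>2 * pi / real k\<close>, an angle below
  \<open>pi\<close>; \<open>corner_sign\<close> undoes the exchange of the two normals at odd
  corners.\<close>

lemma cross_sides_pos: "0 < corner_sign c * cross (nrm (ev c)) (nrm (od c))"
proof -
  have k0: "0 < k" using k3 by simp
  have "(2 * real (Suc c) + 1) * pi / real k - (2 * real c + 1) * pi / real k = 2 * pi / real k"
    by (simp add: diff_divide_distrib[symmetric] algebra_simps)
  then have 1: "cross (nrm c) (nrm (Suc c mod k)) = sin (2 * pi / real k)"
    unfolding side_normal_mod[OF k0] by (simp only: side_normal_def cross_cis)
  have "2 * pi / real k < pi" using k3 by (simp add: field_simps)
  then have "0 < sin (2 * pi / real k)" using k3 by (intro sin_gt_zero) auto
  moreover have "cross (nrm (Suc c mod k)) (nrm c) = - cross (nrm c) (nrm (Suc c mod k))"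
    by (simp add: cross_def)
  ultimately show ?thesis using 1 by (simp add: corner_sign_def even_side_def odd_side_def)
qed

lemma cross_sides_neq_0: "cross (nrm (ev c)) (nrm (od c)) \<noteq> 0"
  using cross_sides_pos[of c] by auto

definition cofactor1 where "cofactor1 c j = cross (nrm j) (nrm (od c)) / cross (nrm (ev c)) (nrm (od c))"
definition cofactor2 where "cofactor2 c j = cross (nrm (ev c)) (nrm j) / cross (nrm (ev c)) (nrm (od c))"
definition offset where "offset c j = cos (pi / real k) * (1 - cofactor1 c j - cofactor2 c j)"

lemma nrm_decompose: "nrm j = cofactor1 c j *\<^sub>R nrm (ev c) + cofactor2 c j *\<^sub>R nrm (od c)"
  unfolding cofactor1_def cofactor2_def by (rule cross_decompose[OF cross_sides_neq_0])

text \<open>The linear relation between the normals becomes an affine one between the distances; as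
  all sides have the same apothem, its constant term is \<open>offset\<close>.\<close>

lemma side_distance_affine: "D j z = offset c j + cofactor1 c j * D (ev c) z + cofactor2 c j * D (od c) z"
proof -
  have "inner (nrm j) z = cofactor1 c j * inner (nrm (ev c)) z + cofactor2 c j * inner (nrm (od c)) z"
    by (subst nrm_decompose[of j c]) (simp add: inner_add_left)
  then show ?thesis by (simp add: side_distance_def offset_def algebra_simps)
qed

lemma cofactors_ev: "cofactor1 c (ev c) = 1" "cofactor2 c (ev c) = 0"
  and cofactors_od: "cofactor1 c (od c) = 0" "cofactor2 c (od c) = 1"
  using cross_sides_neq_0[of c] by (simp_all add: cofactor1_def cofactor2_def) (simp_all add: cross_def)

text \<open>The bracket is the determinant that expresses the normals at \<open>d\<close> through
  those at \<open>c\<close>, hence a quotient of two oriented areas, whose signs are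
  \<open>corner_sign d\<close> and \<open>corner_sign c\<close>.\<close>

lemma determinant_pos:
  "0 < corner_sign d * corner_sign c *
    (cofactor1 c (ev d) * cofactor2 c (od d) - cofactor2 c (ev d) * cofactor1 c (od d))"
  (is "0 < _ * ?det")
proof -
  let ?x = "cross (nrm (ev c)) (nrm (od c))" and ?y = "cross (nrm (ev d)) (nrm (od d))"
  have "?y = ?det * ?x"
    unfolding nrm_decompose[of "ev d" c] nrm_decompose[of "od d" c] by (rule cross_combination)
  then have eq: "corner_sign d * ?y = (corner_sign d * corner_sign c * ?det) * (corner_sign c * ?x)"
    using corner_sign_sq[of c] by (simp add: mult.assoc mult.left_commute)
  have "0 < (corner_sign d * corner_sign c * ?det) * (corner_sign c * ?x)"
    unfolding eq[symmetric] by (rule cross_sides_pos)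
  then show ?thesis using cross_sides_pos[of c] by (simp only: zero_less_mult_pos2)
qed

text \<open>Cramer's rule again: the point with prescribed distances \<open>a\<close> and
  \<open>b\<close> to the two sides at the corner. It provides preimages for the chart.\<close>

definition corner_point :: "nat \<Rightarrow> real \<Rightarrow> real \<Rightarrow> complex" where
  "corner_point c a b = (let u = nrm (ev c); v = nrm (od c); p = cos (pi / real k) - a; q = cos (pi / real k) - b in
    Complex ((p * Im v - q * Im u) / cross u v) ((q * Re u - p * Re v) / cross u v))"

lemma corner_point_distances: "D (ev c) (corner_point c a b) = a" "D (od c) (corner_point c a b) = b"
proof -
  have *: "Re u * ((p * Im v - q * Im u) / cross u v) + Im u * ((q * Re u - p * Re v) / cross u v) = p"
    "Re v * ((p * Im v - q * Im u) / cross u v) + Im v * ((q * Re u - p * Re v) / cross u v) = q"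
    if "cross u v \<noteq> 0" for u v p q
  proof -
    have "Re u * (p * Im v - q * Im u) + Im u * (q * Re u - p * Re v) = p * cross u v"
      "Re v * (p * Im v - q * Im u) + Im v * (q * Re u - p * Re v) = q * cross u v"
      by (simp_all add: cross_def algebra_simps)
    then show "Re u * ((p * Im v - q * Im u) / cross u v) + Im u * ((q * Re u - p * Re v) / cross u v) = p"
      "Re v * ((p * Im v - q * Im u) / cross u v) + Im v * ((q * Re u - p * Re v) / cross u v) = q"
      using that by (simp_all add: add_divide_distrib[symmetric])
  qed
  show "D (ev c) (corner_point c a b) = a" "D (od c) (corner_point c a b) = b"
    using *[OF cross_sides_neq_0[of c]]
    by (simp_all add: side_distance_def corner_point_def Let_def inner_complex_def)
qed

lemma distances_inj:
  assumes "D (ev c) z = D (ev c) w" "D (od c) z = D (od c) w" shows "z = w"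
proof -
  let ?u = "nrm (ev c)" and ?v = "nrm (od c)"
  have "inner ?u (z - w) = 0" "inner ?v (z - w) = 0"
    using assms by (simp_all add: side_distance_def inner_diff_right)
  then have *: "Re ?u * Re (z - w) + Im ?u * Im (z - w) = 0" "Re ?v * Re (z - w) + Im ?v * Im (z - w) = 0"
    by (simp_all only: inner_complex_def)
  have "cross ?u ?v * Re (z - w) = Im ?v * (Re ?u * Re (z - w) + Im ?u * Im (z - w)) - Im ?u * (Re ?v * Re (z - w) + Im ?v * Im (z - w))"
    "cross ?u ?v * Im (z - w) = Re ?u * (Re ?v * Re (z - w) + Im ?v * Im (z - w)) - Re ?v * (Re ?u * Re (z - w) + Im ?u * Im (z - w))"
    by (simp_all add: cross_def algebra_simps)
  then have "cross ?u ?v * Re (z - w) = 0" "cross ?u ?v * Im (z - w) = 0" unfolding * by simp_all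
  then have "z - w = 0" using cross_sides_neq_0[of c] by (simp add: complex_eq_iff)
  then show ?thesis by simp
qed

lemma continuous_side_distance: "continuous_on S (D j)"
  unfolding side_distance_def[abs_def] by (intro continuous_intros)

lemma hull_iff: "z \<in> H \<longleftrightarrow> (\<forall>j<k. 0 \<le> D j z)"
  using polygon_hull_eq[OF k3] by auto

subsection \<open>Corner charts\<close>

abbreviation "P \<equiv> polygon k"
abbreviation "nu \<equiv> alternating_map k"
abbreviation "M \<equiv> small_cover P nu"
abbreviation "Psi \<equiv> cover_point P nu"

sublocale labelling: surjective_labelling P 2 nu
  by (rule surjective_labelling_alternating[OF k3 k_even])

text \<open>The open star of the corner in the polygon.\<close>

definition corner_star :: "nat \<Rightarrow> complex set" where
  "corner_star c = {z \<in> H. \<forall>j<k. j \<noteq> ev c \<and> j \<noteq> od c \<longrightarrow> D j z \<noteq> 0}"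

definition corner_domain :: "nat \<Rightarrow> ((nat \<Rightarrow> bit) \<times> complex) set" where
  "corner_domain c = bvec {..<2} \<times> corner_star c"

text \<open>The bits of the group element serve as signs: the generator of a colour flips the
  corresponding coordinate, as a reflection in the side of that colour. A change of corner involves
  the distance to a third side, which is affine in the two old distances: it is smooth in
  coordinates whose squares are these distances, but would have a kink in signed distances. The
  factor \<open>corner_sign\<close> corrects the orientation at odd corners.\<close>

definition corner_coords :: "nat \<Rightarrow> (nat \<Rightarrow> bit) \<times> complex \<Rightarrow> real ^ 2" where
  "corner_coords c x = vector [corner_sign c * bit_sign (fst x 0) * sqrt (D (ev c) (snd x)),
     bit_sign (fst x 1) * sqrt (D (od c) (snd x))]"

lemma facets_at_iff: "z \<in> H \<Longrightarrow> j \<in> facets_at P z \<longleftrightarrow> j < k \<and> D j z = 0"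
  using facet_polygon[OF k3] by (auto simp: facets_at_def)

lemma alternating_apply:
  "nu g 0 = (\<Sum>j\<in>{j. j < k \<and> even j}. g j)" "nu g (Suc 0) = (\<Sum>j\<in>{j. j < k \<and> odd j}. g j)"
proof -
  have "nu g r = (\<Sum>j<k. if r = j mod 2 then g j else 0)" for r
    by (simp add: alternating_map_def sum_fun_apply bscale_apply unit_vec_apply if_distrib cong: if_cong)
  also have "(\<Sum>j<k. if r = j mod 2 then g j else 0) = (\<Sum>j\<in>{j \<in> {..<k}. r = j mod 2}. g j)" for r
    by (rule sum.inter_filter[symmetric]) simp
  finally have *: "nu g r = (\<Sum>j\<in>{j \<in> {..<k}. r = j mod 2}. g j)" for r .
  have "{j \<in> {..<k}. 0 = j mod 2} = {j. j < k \<and> even j}" "{j \<in> {..<k}. Suc 0 = j mod 2} = {j. j < k \<and> odd j}"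
    by (auto simp: even_iff_mod_2_eq_zero odd_iff_mod_2_eq_one)
  then show "nu g 0 = (\<Sum>j\<in>{j. j < k \<and> even j}. g j)" "nu g (Suc 0) = (\<Sum>j\<in>{j. j < k \<and> odd j}. g j)"
    unfolding * by simp_all
qed

lemma bvec2_eq_iff: "u \<in> bvec {..<2} \<Longrightarrow> v \<in> bvec {..<2} \<Longrightarrow> u = v \<longleftrightarrow> u 0 = v 0 \<and> u (Suc 0) = v (Suc 0)"
proof
  assume u: "u \<in> bvec {..<2}" "v \<in> bvec {..<2}" "u 0 = v 0 \<and> u (Suc 0) = v (Suc 0)"
  show "u = v"
  proof
    fix r :: nat
    consider "r = 0" | "r = Suc 0" | "2 \<le> r" by linarith
    then show "u r = v r" using u by cases (auto simp: bvec_def)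
  qed
qed simp

text \<open>In the star only the two sides at the corner occur. The even one acts on bit 0 and the
  odd one on bit 1, so the condition splits into two.\<close>

lemma corner_stabilizer:
  assumes c: "c < k" and z: "z \<in> corner_star c" and u: "u \<in> bvec {..<2}"
  shows "u \<in> nu ` bvec (facets_at P z) \<longleftrightarrow>
    (u 0 = 0 \<or> D (ev c) z = 0) \<and> (u (Suc 0) = 0 \<or> D (od c) z = 0)"
proof -
  have zH: "z \<in> H" using z by (simp add: corner_star_def)
  have at: "facets_at P z \<subseteq> {ev c, od c}"
    using z facets_at_iff[OF zH] by (auto simp: corner_star_def)
  note sd = sides[OF c]
  have vals: "nu g 0 = g (ev c)" "nu g (Suc 0) = g (od c)" if g: "g \<in> bvec {ev c, od c}" for g
  proof -
    have g0: "g i = 0" if "i \<noteq> ev c" "i \<noteq> od c" for i using g that by (simp add: bvec_def)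
    have "(\<Sum>j\<in>{j. j < k \<and> even j}. g j) = (\<Sum>j\<in>{ev c}. g j)"
      using sd(1-4) by (intro sum.mono_neutral_right ballI g0) auto
    moreover have "(\<Sum>j\<in>{j. j < k \<and> odd j}. g j) = (\<Sum>j\<in>{od c}. g j)"
      using sd(1-4) by (intro sum.mono_neutral_right ballI g0) auto
    ultimately show "nu g 0 = g (ev c)" "nu g (Suc 0) = g (od c)" unfolding alternating_apply by simp_all
  qed
  have nu_in: "nu g \<in> bvec {..<2}" for g
    unfolding alternating_map_def by (intro bvec_sum bvec_bscale) auto
  show ?thesis
  proof
    assume "u \<in> nu ` bvec (facets_at P z)"
    then obtain g where g: "g \<in> bvec (facets_at P z)" "u = nu g" by auto
    then have g': "g \<in> bvec {ev c, od c}" using bvec_mono[OF at] by blast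
    have "g (ev c) = 0 \<or> D (ev c) z = 0" "g (od c) = 0 \<or> D (od c) z = 0"
      using g(1) facets_at_iff[OF zH] by (auto simp: bvec_def)
    then show "(u 0 = 0 \<or> D (ev c) z = 0) \<and> (u (Suc 0) = 0 \<or> D (od c) z = 0)"
      unfolding g(2) vals[OF g'] by blast
  next
    assume u0: "(u 0 = 0 \<or> D (ev c) z = 0) \<and> (u (Suc 0) = 0 \<or> D (od c) z = 0)"
    define g where "g j = (if j = ev c then u 0 else if j = od c then u (Suc 0) else 0)" for j
    have ne: "ev c \<noteq> od c" using sd by auto
    have "g \<in> bvec {ev c, od c}" by (simp add: g_def bvec_def)
    then have "nu g = u" using vals[of g] ne bvec2_eq_iff[OF nu_in u] by (simp add: g_def)
    moreover have "g \<in> bvec (facets_at P z)"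
      unfolding bvec_def
    proof (rule CollectI, intro allI impI)
      fix j assume "j \<notin> facets_at P z"
      then have "\<not> (j < k \<and> D j z = 0)" using facets_at_iff[OF zH] by blast
      then show "g j = 0" using u0 sd by (auto simp: g_def)
    qed
    ultimately show "u \<in> nu ` bvec (facets_at P z)" by blast
  qed
qed

lemma corner_coords_nth:
  "corner_coords c (v, z) $ 1 = corner_sign c * bit_sign (v 0) * sqrt (D (ev c) z)"
  "corner_coords c (v, z) $ 2 = bit_sign (v (Suc 0)) * sqrt (D (od c) z)"
  by (simp_all add: corner_coords_def)

lemma bit_sign_sq: "bit_sign b * bit_sign b = 1"
  by (simp add: bit_sign_def)

lemma corner_coords_sq:
  assumes "c < k" "z \<in> H"
  shows "(corner_coords c (v, z) $ 1)\<^sup>2 = D (ev c) z" "(corner_coords c (v, z) $ 2)\<^sup>2 = D (od c) z"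
proof -
  have "(corner_sign c)\<^sup>2 = 1" "(bit_sign b)\<^sup>2 = 1" for b
    by (simp_all add: power2_eq_square corner_sign_sq bit_sign_sq)
  moreover have "0 \<le> D (ev c) z" "0 \<le> D (od c) z" using assms sides hull_iff by auto
  ultimately show "(corner_coords c (v, z) $ 1)\<^sup>2 = D (ev c) z" "(corner_coords c (v, z) $ 2)\<^sup>2 = D (od c) z"
    by (simp_all add: corner_coords_nth power_mult_distrib)
qed

lemma corner_coords_determine:
  assumes "c < k" "z \<in> H" "w \<in> H" "corner_coords c (u, z) = corner_coords c (v, w)"
  shows "z = w"
  using corner_coords_sq[OF assms(1,2), of u] corner_coords_sq[OF assms(1,3), of v] assms(4)
  by (intro distances_inj[of c]) auto

text \<open>A sign is invisible exactly where its square root vanishes, and this is where the side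
  glues the two copies.\<close>

lemma corner_coords_eq_iff:
  assumes c: "c < k" and x: "(u, z) \<in> corner_domain c" and y: "(v, w) \<in> corner_domain c"
  shows "corner_coords c (u, z) = corner_coords c (v, w) \<longleftrightarrow> Psi (u, z) = Psi (v, w)"
proof -
  have uv: "u \<in> bvec {..<2}" "v \<in> bvec {..<2}" "z \<in> corner_star c" "w \<in> corner_star c"
    using x y by (auto simp: corner_domain_def)
  then have zw: "z \<in> H" "w \<in> H" by (auto simp: corner_star_def)
  have "Psi (u, z) = Psi (v, w) \<longleftrightarrow> z = w \<and> u + v \<in> nu ` bvec (facets_at P z)"
    using uv zw by (intro labelling.cover_point_eq_iff) auto
  also have "\<dots> \<longleftrightarrow> z = w \<and> (u 0 = v 0 \<or> D (ev c) z = 0) \<and> (u (Suc 0) = v (Suc 0) \<or> D (od c) z = 0)"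
  proof -
    have b: "a + b = 0 \<longleftrightarrow> a = b" for a b :: bit by (cases a; cases b) auto
    show ?thesis using corner_stabilizer[OF c uv(3), of "u + v"] uv by (auto simp: b)
  qed
  also have "\<dots> \<longleftrightarrow> corner_coords c (u, z) = corner_coords c (v, w)"
  proof (cases "z = w")
    case True
    have s: "bit_sign a = bit_sign b \<longleftrightarrow> a = b" for a b by (cases a; cases b) (auto simp: bit_sign_def)
    have nz: "corner_sign c \<noteq> 0" by (simp add: corner_sign_def)
    show ?thesis unfolding vec_eq_iff forall_2 corner_coords_nth True using nz by (auto simp: s)
  next
    case False
    then show ?thesis using corner_coords_determine[OF c zw] by blast
  qed
  finally show ?thesis by (rule sym)
qed

text \<open>The other distances are affine in the squares of the coordinates, so the conditions
  defining the star become strict polynomial inequalities. They show that the image is open.\<close>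

lemma corner_image:
  assumes c: "c < k"
  shows "corner_coords c ` corner_domain c =
    {x. \<forall>j<k. j \<noteq> ev c \<and> j \<noteq> od c \<longrightarrow> 0 < offset c j + cofactor1 c j * (x $ 1)\<^sup>2 + cofactor2 c j * (x $ 2)\<^sup>2}"
  (is "_ = ?V")
proof
  show "corner_coords c ` corner_domain c \<subseteq> ?V"
  proof
    fix x assume "x \<in> corner_coords c ` corner_domain c"
    then obtain v z where z: "z \<in> corner_star c" "x = corner_coords c (v, z)" by (auto simp: corner_domain_def)
    then have zH: "z \<in> H" by (simp add: corner_star_def)
    have "0 < D j z" if "j < k" "j \<noteq> ev c \<and> j \<noteq> od c" for j
      using that z(1) zH hull_iff by (force simp: corner_star_def less_le)
    then show "x \<in> ?V"
      by (simp only: z(2) corner_coords_sq[OF c zH] side_distance_affine[of _ z c, symmetric] mem_Collect_eq) blast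
  qed
  show "?V \<subseteq> corner_coords c ` corner_domain c"
  proof
    fix x :: "real ^ 2" assume x: "x \<in> ?V"
    define z where "z = corner_point c ((x $ 1)\<^sup>2) ((x $ 2)\<^sup>2)"
    have d: "D (ev c) z = (x $ 1)\<^sup>2" "D (od c) z = (x $ 2)\<^sup>2" by (simp_all add: z_def corner_point_distances)
    have pos: "0 < D j z" if "j < k" "j \<noteq> ev c \<and> j \<noteq> od c" for j
      using x that unfolding side_distance_affine[of j z c] d by blast
    have "0 \<le> D j z" if "j < k" for j
    proof (cases "j = ev c \<or> j = od c")
      case True
      then show ?thesis using d by auto
    next
      case False
      then show ?thesis using pos[OF that] by simp
    qed
    then have zH: "z \<in> H" using hull_iff by blast
    then have zs: "z \<in> corner_star c" using pos by (force simp: corner_star_def)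
    \<comment> \<open>The bits are read off from the signs of \<open>x\<close>; at a coordinate 0
      either bit would do, and 0 is taken.\<close>
    define v :: "nat \<Rightarrow> bit" where "v r = (if r = 0 then if corner_sign c * x $ 1 < 0 then 1 else 0
      else if r = Suc 0 then if x $ 2 < 0 then 1 else 0 else 0)" for r
    have "v \<in> bvec {..<2}" by (auto simp: bvec_def v_def)
    moreover have "corner_coords c (v, z) = x"
      unfolding vec_eq_iff forall_2 corner_coords_nth d by (auto simp: v_def bit_sign_def corner_sign_def)
    ultimately show "x \<in> corner_coords c ` corner_domain c" using zs by (force simp: corner_domain_def)
  qed
qed

lemma open_corner_image: "c < k \<Longrightarrow> open (corner_coords c ` corner_domain c)"
proof -
  assume c: "c < k"
  have "{x :: real ^ 2. \<forall>j<k. j \<noteq> ev c \<and> j \<noteq> od c \<longrightarrow> 0 < offset c j + cofactor1 c j * (x $ 1)\<^sup>2 + cofactor2 c j * (x $ 2)\<^sup>2} =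
      (\<Inter>j\<in>{j. j < k \<and> j \<noteq> ev c \<and> j \<noteq> od c}. {x. 0 < offset c j + cofactor1 c j * (x $ 1)\<^sup>2 + cofactor2 c j * (x $ 2)\<^sup>2})"
    by auto
  also have "open \<dots>" by (intro open_INT ballI open_Collect_less continuous_intros) auto
  finally show ?thesis unfolding corner_image[OF c] .
qed

lemma corner_domain_sub: "corner_domain c \<subseteq> topspace (copies 2 P)"
  by (auto simp: topspace_copies corner_domain_def corner_star_def)

text \<open>The domain restricts only the polygon point, on which all preimages of a point of the
  small cover agree; so it is saturated.\<close>

lemma corner_domain_iff:
  assumes "x \<in> topspace (copies 2 P)"
  shows "Psi x \<in> Psi ` corner_domain c \<longleftrightarrow> x \<in> corner_domain c"
proof
  assume "Psi x \<in> Psi ` corner_domain c"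
  then obtain y where y: "y \<in> corner_domain c" "Psi x = Psi y" by auto
  obtain u z v w where [simp]: "x = (u, z)" "y = (v, w)" by (metis surj_pair)
  have u: "u \<in> bvec {..<2}" "z \<in> H" using assms by (auto simp: topspace_copies)
  have v: "v \<in> bvec {..<2}" "w \<in> H" using y(1) by (auto simp: corner_domain_def corner_star_def)
  have "z = w" using y(2) labelling.cover_point_eq_iff[of u v z w] u v by auto
  then show "x \<in> corner_domain c" using y(1) u by (auto simp: corner_domain_def)
qed auto

lemma open_corner_domain: "openin (copies 2 P) (corner_domain c)"
proof -
  have "corner_star c = H - (\<Union>j\<in>{j. j < k \<and> j \<noteq> ev c \<and> j \<noteq> od c}. facet P j)"
    using facet_polygon[OF k3] by (auto simp: corner_star_def)
  moreover have "closedin (points P) (\<Union>j\<in>{j. j < k \<and> j \<noteq> ev c \<and> j \<noteq> od c}. facet P j)"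
    using closedin_facet_polygon[OF k3] by (intro closedin_Union) auto
  ultimately have "openin (points P) (corner_star c)"
    using openin_diff[of "points P" H] openin_topspace[of "points P"] by simp
  then show ?thesis unfolding corner_domain_def copies_def openin_prod_Times_iff by simp
qed

lemma open_corner_chart: "openin M (Psi ` corner_domain c)"
proof -
  have pre: "{x \<in> topspace (copies 2 P). Psi x \<in> Psi ` corner_domain c} = corner_domain c"
    using corner_domain_iff[of _ c] corner_domain_sub[of c] by blast
  have "Psi ` corner_domain c \<subseteq> topspace M"
    unfolding labelling.topspace_small_cover
    using corner_domain_sub[of c] unfolding topspace_copies by (intro image_mono) simp
  then have "openin (copies 2 P) {x \<in> topspace (copies 2 P). Psi x \<in> Psi ` corner_domain c} =
      openin M (Psi ` corner_domain c)"
    using labelling.quotient_map_cover_point unfolding quotient_map_def by blast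
  then show ?thesis unfolding pre using open_corner_domain[of c] by blast
qed

lemma continuous_corner_coords: "continuous_map (copies 2 P) euclidean (corner_coords c)"
proof -
  have fst_cont: "continuous_map (copies 2 P) (discrete_topology (bvec {..<2})) fst"
    and snd_cont: "continuous_map (copies 2 P) (top_of_set H) snd"
    by (simp_all add: copies_def continuous_map_fst continuous_map_snd)
  have disc: "continuous_map (copies 2 P) euclidean (f \<circ> fst)" for f :: "(nat \<Rightarrow> bit) \<Rightarrow> real"
    by (rule continuous_map_compose[OF fst_cont]) auto
  have poly: "continuous_map (copies 2 P) euclidean ((\<lambda>z. sqrt (D j z)) \<circ> snd)" for j
    by (rule continuous_map_compose[OF snd_cont]) (auto intro!: continuous_intros continuous_side_distance)
  have axis: "continuous_map (copies 2 P) euclidean (\<lambda>x. f x *\<^sub>R axis i (1::real))"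
    if "continuous_map (copies 2 P) euclidean f" for f :: "(nat \<Rightarrow> bit) \<times> complex \<Rightarrow> real" and i :: 2
  proof -
    have "continuous_map (copies 2 P) euclidean ((\<lambda>r. r *\<^sub>R axis i (1::real)) \<circ> f)"
      using continuous_on_scaleR[OF continuous_on_id continuous_on_const]
      by (intro continuous_map_compose[OF that]) simp
    then show ?thesis by (simp add: comp_def)
  qed
  have "corner_coords c x = (corner_sign c * bit_sign (fst x 0) * sqrt (D (ev c) (snd x))) *\<^sub>R axis 1 1 +
      (bit_sign (fst x 1) * sqrt (D (od c) (snd x))) *\<^sub>R axis 2 1" for x
    unfolding vec_eq_iff forall_2 by (simp add: corner_coords_def axis_def)
  moreover have "continuous_map (copies 2 P) euclidean
      (\<lambda>x. (corner_sign c * bit_sign (fst x 0) * sqrt (D (ev c) (snd x))) *\<^sub>R axis 1 1 +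
        (bit_sign (fst x 1) * sqrt (D (od c) (snd x))) *\<^sub>R axis 2 1 :: real ^ 2)"
    using continuous_map_real_mult[OF disc[of "\<lambda>v. corner_sign c * bit_sign (v 0)"] poly[of "ev c"]]
      continuous_map_real_mult[OF disc[of "\<lambda>v. bit_sign (v 1)"] poly[of "od c"]]
    by (intro continuous_map_add axis) (simp_all add: comp_def)
  ultimately show ?thesis by presburger
qed

text \<open>The coordinates are defined on all copies, which form a compact space, and so give a
  closed map into the plane. Closedness survives restriction because the coordinates determine the
  polygon point, which makes the domain a full preimage. The open set in \<open>M\<close> and the
  image in the plane are then quotients of the domain with the same fibers.\<close>

lemma corner_chart:
  assumes c: "c < k"
  obtains h where "homeomorphic_map (subtopology M (Psi ` corner_domain c)) (top_of_set (corner_coords c ` corner_domain c)) h"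
    "\<And>x. x \<in> corner_domain c \<Longrightarrow> h (Psi x) = corner_coords c x"
proof -
  let ?X = "corner_domain c"
  have Psi_X: "quotient_map (subtopology (copies 2 P) ?X) (subtopology M (Psi ` ?X)) Psi"
  proof (rule quotient_map_restriction[OF labelling.quotient_map_cover_point])
    show "{x \<in> topspace (copies 2 P). Psi x \<in> Psi ` ?X} = ?X"
      using corner_domain_iff[of _ c] corner_domain_sub[of c] by blast
    show "openin M (Psi ` ?X) \<or> closedin M (Psi ` ?X)" using open_corner_chart by blast
  qed
  have "compact H" by (simp add: compact_convex_hull finite_imp_compact)
  then have "compact_space (copies 2 P)"
    unfolding copies_def compact_space_prod_topology
    by (simp add: compact_space_discrete_topology finite_bvec compact_space_subtopology)
  then have "closed_map (copies 2 P) euclidean (corner_coords c)"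
    by (intro T1_Spaces.continuous_imp_closed_map continuous_corner_coords) simp_all
  moreover have pre: "{x \<in> topspace (copies 2 P). corner_coords c x \<in> corner_coords c ` ?X} = ?X"
  proof
    show "{x \<in> topspace (copies 2 P). corner_coords c x \<in> corner_coords c ` ?X} \<subseteq> ?X"
    proof
      fix x assume x: "x \<in> {x \<in> topspace (copies 2 P). corner_coords c x \<in> corner_coords c ` ?X}"
      then obtain y where y: "y \<in> ?X" "corner_coords c x = corner_coords c y" by auto
      obtain u z v w where [simp]: "x = (u, z)" "y = (v, w)" by (metis surj_pair)
      have "z \<in> H" "w \<in> H" using x y(1) by (auto simp: topspace_copies corner_domain_def corner_star_def)
      then have "z = w" using corner_coords_determine[OF c] y(2) by simp
      then show "x \<in> ?X" using x y(1) by (auto simp: corner_domain_def topspace_copies)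
    qed
  qed (use corner_domain_sub in blast)
  ultimately have "closed_map (subtopology (copies 2 P) ?X) (top_of_set (corner_coords c ` ?X)) (corner_coords c)"
    by (rule closed_map_restriction)
  moreover have "continuous_map (subtopology (copies 2 P) ?X) (top_of_set (corner_coords c ` ?X)) (corner_coords c)"
    using continuous_map_from_subtopology[OF continuous_corner_coords]
    by (simp add: continuous_map_in_subtopology image_mono)
  moreover have "corner_coords c ` topspace (subtopology (copies 2 P) ?X) = topspace (top_of_set (corner_coords c ` ?X))"
    using corner_domain_sub[of c] by (simp add: inf_absorb2)
  ultimately have coords_X: "quotient_map (subtopology (copies 2 P) ?X) (top_of_set (corner_coords c ` ?X)) (corner_coords c)"
    by (intro continuous_closed_imp_quotient_map)
  have top: "topspace (subtopology (copies 2 P) ?X) = ?X" using corner_domain_sub[of c] by (simp add: inf_absorb2)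
  have "Psi x = Psi y \<longleftrightarrow> corner_coords c x = corner_coords c y" if "x \<in> ?X" "y \<in> ?X" for x y
    using corner_coords_eq_iff[OF c] that by (metis surj_pair)
  then obtain h where "homeomorphic_map (subtopology M (Psi ` ?X)) (top_of_set (corner_coords c ` ?X)) h"
    "\<And>x. x \<in> topspace (subtopology (copies 2 P) ?X) \<Longrightarrow> h (Psi x) = corner_coords c x"
    using quotient_maps_same_fibers[OF Psi_X coords_X] unfolding top by blast
  then show ?thesis using that unfolding top by blast
qed

definition transition :: "nat \<Rightarrow> nat \<Rightarrow> real ^ 2 \<Rightarrow> real ^ 2" where
  "transition c d = corner_transition (ev d = ev c) (od d = od c) (corner_sign d * corner_sign c)
     (offset c (ev d), cofactor1 c (ev d), cofactor2 c (ev d)) (offset c (od d), cofactor1 c (od d), cofactor2 c (od d))"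

text \<open>A side belonging to only one of the two corners has positive distance at a point of both
  stars, which covers every square root and every sign quotient in the transition. Parity prevents
  an even side of one corner from being the odd side of the other.\<close>

lemma transition_corner_coords:
  fixes v :: "nat \<Rightarrow> bit"
  assumes c: "c < k" and d: "d < k" and z: "z \<in> corner_star c" "z \<in> corner_star d"
  defines "x \<equiv> corner_coords c (v, z)"
  shows "ev d \<noteq> ev c \<Longrightarrow> x $ 1 \<noteq> 0 \<and> 0 < offset c (ev d) + cofactor1 c (ev d) * (x $ 1)\<^sup>2 + cofactor2 c (ev d) * (x $ 2)\<^sup>2"
    and "od d \<noteq> od c \<Longrightarrow> x $ 2 \<noteq> 0 \<and> 0 < offset c (od d) + cofactor1 c (od d) * (x $ 1)\<^sup>2 + cofactor2 c (od d) * (x $ 2)\<^sup>2"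
    and "transition c d x = corner_coords d (v, z)"
proof -
  have zH: "z \<in> H" using z by (simp add: corner_star_def)
  note sc = sides(1-4)[OF c] and sd = sides(1-4)[OF d]
  have x_sq: "(x $ 1)\<^sup>2 = D (ev c) z" "(x $ 2)\<^sup>2 = D (od c) z" using corner_coords_sq[OF c zH] by (simp_all only: x_def)
  have x_nth: "x $ 1 = corner_sign c * bit_sign (v 0) * sqrt (D (ev c) z)" "x $ 2 = bit_sign (v (Suc 0)) * sqrt (D (od c) z)"
    by (simp_all only: x_def corner_coords_nth)
  have Q: "offset c j + cofactor1 c j * (x $ 1)\<^sup>2 + cofactor2 c j * (x $ 2)\<^sup>2 = D j z" for j
    unfolding x_sq by (rule side_distance_affine[symmetric])
  have pos: "0 < D j z" if "j < k" "D j z \<noteq> 0" for j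
    using zH hull_iff that by (simp add: less_le)
  have ev_pos: "0 < D (ev c) z" "0 < D (ev d) z" if "ev d \<noteq> ev c"
  proof -
    have "ev c \<noteq> od d" "ev d \<noteq> od c" using sc sd by metis+
    then have "D (ev c) z \<noteq> 0" "D (ev d) z \<noteq> 0" using z that sc(1) sd(1) by (auto simp: corner_star_def)
    then show "0 < D (ev c) z" "0 < D (ev d) z" using pos sc(1) sd(1) by blast+
  qed
  have od_pos: "0 < D (od c) z" "0 < D (od d) z" if "od d \<noteq> od c"
  proof -
    have "od c \<noteq> ev d" "od d \<noteq> ev c" using sc sd by metis+
    then have "D (od c) z \<noteq> 0" "D (od d) z \<noteq> 0" using z that sc(2) sd(2) by (auto simp: corner_star_def)
    then show "0 < D (od c) z" "0 < D (od d) z" using pos sc(2) sd(2) by blast+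
  qed
  show "x $ 1 \<noteq> 0 \<and> 0 < offset c (ev d) + cofactor1 c (ev d) * (x $ 1)\<^sup>2 + cofactor2 c (ev d) * (x $ 2)\<^sup>2" if "ev d \<noteq> ev c"
    unfolding Q using ev_pos[OF that] x_sq(1) by auto
  show "x $ 2 \<noteq> 0 \<and> 0 < offset c (od d) + cofactor1 c (od d) * (x $ 1)\<^sup>2 + cofactor2 c (od d) * (x $ 2)\<^sup>2" if "od d \<noteq> od c"
    unfolding Q using od_pos[OF that] x_sq(2) by auto
  have b1: "corner_branch 1 (ev d = ev c) (corner_sign d * corner_sign c) (offset c (ev d)) (cofactor1 c (ev d)) (cofactor2 c (ev d)) x
      = corner_coords d (v, z) $ 1"
  proof (cases "ev d = ev c")
    case True
    have "corner_sign d * corner_sign c * (corner_sign c * bit_sign (v 0) * sqrt (D (ev c) z)) =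
        (corner_sign c * corner_sign c) * (corner_sign d * bit_sign (v 0) * sqrt (D (ev c) z))"
      by (simp only: ac_simps)
    then show ?thesis
      unfolding corner_branch_def corner_coords_nth x_nth corner_sign_sq using True by simp
  next
    case False
    have "x $ 1 * (1 / sqrt ((x $ 1)\<^sup>2)) = corner_sign c * bit_sign (v 0)"
      unfolding x_sq unfolding x_nth using ev_pos(1)[OF False] by simp
    then have "corner_branch 1 (ev d = ev c) (corner_sign d * corner_sign c) (offset c (ev d)) (cofactor1 c (ev d)) (cofactor2 c (ev d)) x
        = corner_sign d * corner_sign c * (corner_sign c * bit_sign (v 0)) * sqrt (D (ev d) z)"
      unfolding corner_branch_def Q using False by (simp only: if_False)
    also have "\<dots> = (corner_sign c * corner_sign c) * (corner_sign d * bit_sign (v 0) * sqrt (D (ev d) z))"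
      by (simp only: ac_simps)
    finally show ?thesis unfolding corner_coords_nth corner_sign_sq by simp
  qed
  have b2: "corner_branch 2 (od d = od c) 1 (offset c (od d)) (cofactor1 c (od d)) (cofactor2 c (od d)) x
      = corner_coords d (v, z) $ 2"
  proof (cases "od d = od c")
    case True
    then show ?thesis unfolding corner_branch_def corner_coords_nth x_nth by simp
  next
    case False
    have "x $ 2 * (1 / sqrt ((x $ 2)\<^sup>2)) = bit_sign (v (Suc 0))"
      unfolding x_sq unfolding x_nth using od_pos(1)[OF False] by simp
    then show ?thesis
      unfolding corner_branch_def Q corner_coords_nth using False by (simp only: if_False mult_1_left)
  qed
  show "transition c d x = corner_coords d (v, z)"
    unfolding transition_def corner_transition_def prod.case b1 b2 vec_eq_iff forall_2
    by (simp add: axis_def)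
qed

text \<open>The stars cover the polygon because the sides through any point are among the two sides
  of some corner. The sign condition on the Jacobians reduces to
  \<open>determinant_pos\<close>.\<close>

theorem orientable_small_cover: "orientable_surface M"
proof -
  let ?U = "\<lambda>c. Psi ` corner_domain c"
  have "\<forall>c. \<exists>h. c < k \<longrightarrow> homeomorphic_map (subtopology M (?U c)) (top_of_set (corner_coords c ` corner_domain c)) h \<and>
      (\<forall>x\<in>corner_domain c. h (Psi x) = corner_coords c x)"
    using corner_chart by metis
  then obtain h where hom: "\<And>c. c < k \<Longrightarrow> homeomorphic_map (subtopology M (?U c)) (top_of_set (corner_coords c ` corner_domain c)) (h c)"
    and h: "\<And>c x. c < k \<Longrightarrow> x \<in> corner_domain c \<Longrightarrow> h c (Psi x) = corner_coords c x"
    by metis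
  have U_sub: "?U c \<subseteq> topspace M" for c using open_corner_chart by (rule openin_subset)
  have img: "h c ` ?U c = corner_coords c ` corner_domain c" if "c < k" for c
    using h[OF that] by (simp add: image_image cong: image_cong)
  have inj: "inj_on (h c) (?U c)" if "c < k" for c
    using homeomorphic_imp_injective_map[OF hom[OF that]] U_sub[of c] by (simp add: inf_absorb2)
  have chart: "surface_chart M (?U c) (h c)" if "c < k" for c
    unfolding surface_chart_def img[OF that] using open_corner_chart open_corner_image[OF that] hom[OF that] by blast
  have cover: "topspace M = (\<Union>c\<in>{..<k}. ?U c)"
  proof
    show "(\<Union>c\<in>{..<k}. ?U c) \<subseteq> topspace M" using U_sub by blast
    show "topspace M \<subseteq> (\<Union>c\<in>{..<k}. ?U c)"
    proof
      fix y assume "y \<in> topspace M"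
      then obtain v z where y: "v \<in> bvec {..<2}" "z \<in> H" "y = Psi (v, z)"
        by (auto simp: labelling.topspace_small_cover)
      obtain c where c: "c < k" "{j. j < k \<and> z \<in> facet P j} \<subseteq> {c, Suc c mod k}"
        using polygon_facets_at[OF k3 y(2)] .
      have "D j z \<noteq> 0" if "j < k" "j \<noteq> ev c" "j \<noteq> od c" for j
      proof
        assume "D j z = 0"
        then have "j \<in> {c, Suc c mod k}" using c(2) that(1) y(2) facet_polygon[OF k3 that(1)] by blast
        then show False using sides(5)[OF c(1)] that by blast
      qed
      then have "(v, z) \<in> corner_domain c" using y by (simp add: corner_domain_def corner_star_def)
      then show "y \<in> (\<Union>c\<in>{..<k}. ?U c)" using y(3) c(1) by blast
    qed
  qed
  have trans: "(\<forall>r. Ck_on r (h c ` (?U c \<inter> ?U d)) (h d \<circ> inv_into (?U c) (h c))) \<and>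
      (\<forall>x\<in>h c ` (?U c \<inter> ?U d). 0 < det (matrix (frechet_derivative (h d \<circ> inv_into (?U c) (h c)) (at x))))"
    if c: "c < k" and d: "d < k" for c d
  proof -
    let ?S = "h c ` (?U c \<inter> ?U d)" and ?f = "h d \<circ> inv_into (?U c) (h c)"
    have S: "open ?S"
    proof -
      have "openin M (?U c \<inter> ?U d)" using open_corner_chart by blast
      then have "openin (subtopology M (?U c)) (?U c \<inter> ?U d)"
        by (simp add: openin_subset_topspace_eq openin_subtopology_Int2 openin_subtopology) blast
      then have "openin (top_of_set (corner_coords c ` corner_domain c)) ?S"
        using homeomorphic_imp_open_map[OF hom[OF c]] by (simp add: open_map_def)
      then show ?thesis using open_corner_image[OF c] openin_open_trans by (metis openin_open_eq)
    qed
    \<comment> \<open>A point of the overlap is represented by the same pair \<open>(v, z)\<close>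
      in both charts, so the transition map can be computed on copies of the polygon.\<close>
    have pt: "\<exists>v z. z \<in> corner_star c \<and> z \<in> corner_star d \<and> x = corner_coords c (v, z) \<and> ?f x = corner_coords d (v, z)"
      if x: "x \<in> ?S" for x
    proof -
      obtain y where y: "y \<in> ?U c" "y \<in> ?U d" "x = h c y" using x by auto
      then obtain p where p: "p \<in> corner_domain c" "y = Psi p" by auto
      have "p \<in> corner_domain d" using corner_domain_iff[of p d] corner_domain_sub p y(2) by blast
      moreover have "inv_into (?U c) (h c) x = y" using y inj[OF c] by simp
      moreover obtain v z where "p = (v, z)" by (metis surj_pair)
      ultimately show ?thesis
        using p y h[OF c p(1)] h[OF d, of p] by (intro exI[of _ v] exI[of _ z]) (auto simp: corner_domain_def)
    qed
    have eq: "transition c d x = ?f x" if "x \<in> ?S" for x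
      using pt[OF that] transition_corner_coords(3)[OF c d] by metis
    have p1: "x $ 1 \<noteq> 0 \<and> 0 < offset c (ev d) + cofactor1 c (ev d) * (x $ 1)\<^sup>2 + cofactor2 c (ev d) * (x $ 2)\<^sup>2"
      if "x \<in> ?S" "ev d \<noteq> ev c" for x
      using pt[OF that(1)] transition_corner_coords(1)[OF c d _ _ that(2)] by metis
    have p2: "x $ 2 \<noteq> 0 \<and> 0 < offset c (od d) + cofactor1 c (od d) * (x $ 1)\<^sup>2 + cofactor2 c (od d) * (x $ 2)\<^sup>2"
      if "x \<in> ?S" "od d \<noteq> od c" for x
      using pt[OF that(1)] transition_corner_coords(2)[OF c d _ _ that(2)] by metis
    have "Ck_on r ?S (transition c d)" for r
      unfolding transition_def using p1 p2 by (intro Ck_on_corner_transition[OF S]) auto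
    then have "Ck_on r ?S ?f" for r
      by (rule Ck_on_cong[OF S, rotated]) (rule eq)
    moreover have "0 < det (matrix (frechet_derivative ?f (at x)))" if x: "x \<in> ?S" for x
    proof (rule det_corner_transition_pos[OF p1[OF x] p2[OF x] _ _ determinant_pos S x])
      show "corner_transition (ev d = ev c) (od d = od c) (corner_sign d * corner_sign c)
          (offset c (ev d), cofactor1 c (ev d), cofactor2 c (ev d)) (offset c (od d), cofactor1 c (od d), cofactor2 c (od d)) y = ?f y"
        if "y \<in> ?S" for y using eq[OF that] by (simp add: transition_def)
    qed (simp_all add: cofactors_ev cofactors_od)
    ultimately show ?thesis by blast
  qed
  show ?thesis
    unfolding orientable_surface_def
  proof (intro exI[of _ "(\<lambda>c. (?U c, h c)) ` {..<k}"] conjI)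
    show "\<forall>(U, h)\<in>(\<lambda>c. (?U c, h c)) ` {..<k}. surface_chart M U h" using chart by auto
    show "topspace M = (\<Union>(U, h)\<in>(\<lambda>c. (?U c, h c)) ` {..<k}. U)" using cover by simp
    show "\<forall>(U, g)\<in>(\<lambda>c. (?U c, h c)) ` {..<k}. \<forall>(V, l)\<in>(\<lambda>c. (?U c, h c)) ` {..<k}.
        (\<forall>r. Ck_on r (g ` (U \<inter> V)) (l \<circ> inv_into U g)) \<and>
        (\<forall>x\<in>g ` (U \<inter> V). 0 < det (matrix (frechet_derivative (l \<circ> inv_into U g) (at x))))"
      using trans by auto
  qed
qed

end

section \<open>Regrouping the square factors\<close>

text \<open>The vertices of \<open>polygon 4\<close> are the fourth roots of unity, so its sides are
  diagonal. In these rotated and scaled coordinates it is the square of side length 2 centered at 0,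
  and coordinate \<open>e\<close> runs between the sides \<open>e\<close> and
  \<open>e + 2\<close>.\<close>

definition square_coord :: "nat \<Rightarrow> complex \<Rightarrow> real" where
  "square_coord e z = (if e = 0 then Re z + Im z else Im z - Re z)"

definition square_point :: "real \<Rightarrow> real \<Rightarrow> complex" where
  "square_point a b = a *\<^sub>R Complex (1 / 2) (1 / 2) + b *\<^sub>R Complex (- 1 / 2) (1 / 2)"

lemma square_coord_point [simp]:
  "square_coord 0 (square_point a b) = a" "square_coord (Suc 0) (square_point a b) = b"
  by (simp_all add: square_coord_def square_point_def field_simps)

lemma square_point_coord [simp]: "square_point (square_coord 0 z) (square_coord (Suc 0) z) = z"
  by (simp add: square_coord_def square_point_def complex_eq_iff field_simps)

lemma side_distance_square:
  assumes "e < 2"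
  shows "side_distance 4 e z = sqrt 2 / 2 * (1 - square_coord e z)"
    and "side_distance 4 (e + 2) z = sqrt 2 / 2 * (1 + square_coord e z)"
proof -
  have n0: "side_normal 4 0 = Complex (sqrt 2 / 2) (sqrt 2 / 2)"
    by (simp add: side_normal_def complex_eq_iff cos_45 sin_45)
  have shift: "side_normal 4 (j + 2) = - side_normal 4 j" for j
  proof -
    have "(2 * real (j + 2) + 1) * pi / 4 = (2 * real j + 1) * pi / 4 + pi" by (simp add: field_simps)
    then have "cis ((2 * real (j + 2) + 1) * pi / 4) = - cis ((2 * real j + 1) * pi / 4)"
      by (simp only:) (simp add: complex_eq_iff)
    then show ?thesis by (simp add: side_normal_def)
  qed
  have n1: "side_normal 4 (Suc 0) = Complex (- sqrt 2 / 2) (sqrt 2 / 2)"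
  proof -
    have "(2 * real (Suc 0) + 1) * pi / 4 = pi / 4 + pi / 2" by simp
    then have "cis ((2 * real (Suc 0) + 1) * pi / 4) = cis (pi / 4 + pi / 2)" by (simp only:)
    also have "\<dots> = Complex (- sqrt 2 / 2) (sqrt 2 / 2)"
      unfolding complex_eq_iff cis.sel cos_add sin_add cos_45 sin_45 by simp
    finally show ?thesis by (simp only: side_normal_def of_nat_numeral)
  qed
  have c4: "cos (pi / real 4) = sqrt 2 / 2" by (simp add: cos_45)
  have "e = 0 \<or> e = Suc 0" using assms by auto
  then show "side_distance 4 e z = sqrt 2 / 2 * (1 - square_coord e z)"
    and "side_distance 4 (e + 2) z = sqrt 2 / 2 * (1 + square_coord e z)"
    unfolding side_distance_def shift c4
    by (auto simp: n0 n1 square_coord_def inner_complex_def algebra_simps)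
qed

lemma polygon_hull_square: "polygon_hull 4 = {z. \<forall>e<2. \<bar>square_coord e z\<bar> \<le> 1}"
proof -
  have "(\<forall>j<4. 0 \<le> side_distance 4 j z) \<longleftrightarrow> (\<forall>e<2. 0 \<le> side_distance 4 e z \<and> 0 \<le> side_distance 4 (e + 2) z)" for z
  proof (intro iffI allI impI)
    fix j :: nat assume *: "\<forall>e<2. 0 \<le> side_distance 4 e z \<and> 0 \<le> side_distance 4 (e + 2) z" and j: "j < 4"
    show "0 \<le> side_distance 4 j z"
    proof (cases "j < 2")
      case False
      then have "j - 2 < 2" "j = (j - 2) + 2" using j by auto
      then show ?thesis using * by metis
    qed (use * in blast)
  qed auto
  moreover have "(0 \<le> side_distance 4 e z \<and> 0 \<le> side_distance 4 (e + 2) z) \<longleftrightarrow> \<bar>square_coord e z\<bar> \<le> 1" if "e < 2" for e z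
    unfolding side_distance_square[OF that] by (auto simp: zero_le_mult_iff)
  ultimately show ?thesis unfolding polygon_hull_eq[of 4, simplified] by auto
qed

text \<open>End \<open>b = 0\<close> of a direction is the value 1, because the outward normal of
  side \<open>e\<close> points in the positive direction of coordinate \<open>e\<close>.\<close>

lemma facet_square:
  assumes "e < 2" "b < 2"
  shows "z \<in> facet (polygon 4) (e + 2 * b) \<longleftrightarrow> z \<in> polygon_hull 4 \<and> square_coord e z = (if b = 0 then 1 else - 1)"
proof -
  have "e + 2 * b < 4" using assms by simp
  then have "z \<in> facet (polygon 4) (e + 2 * b) \<longleftrightarrow> z \<in> polygon_hull 4 \<and> side_distance 4 (e + 2 * b) z = 0"
    using facet_polygon[of 4 "e + 2 * b"] by simp
  moreover have "b = 0 \<or> b = 1" using assms by auto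
  ultimately show ?thesis
    using side_distance_square[OF assms(1), of z] by (auto simp: add_eq_0_iff)
qed

locale regrouping =
  fixes n :: nat and m :: "nat \<Rightarrow> nat" and s :: "nat \<times> nat \<Rightarrow> nat \<times> nat"
  assumes m3: "\<forall>i<n. 3 \<le> m i" and s: "s permutes directions n m"
begin

abbreviation "PP \<equiv> polygon_product n m"
abbreviation "\<tau> \<equiv> regroup_facet m s"

text \<open>Coordinate \<open>e\<close> of the new square \<open>i\<close> is taken from the old
  interval direction \<open>t (i, e)\<close>. The permutation is a parameter because the inverse map
  is the same construction with \<open>inv s\<close>.\<close>

definition regroup_point :: "(nat \<times> nat \<Rightarrow> nat \<times> nat) \<Rightarrow> (nat \<Rightarrow> complex) \<Rightarrow> nat \<Rightarrow> complex" where
  "regroup_point t x = (\<lambda>i\<in>{..<n}. if m i = 4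
     then square_point (square_coord (snd (t (i, 0))) (x (fst (t (i, 0))))) (square_coord (snd (t (i, 1))) (x (fst (t (i, 1)))))
     else x i)"

lemma direction_image:
  assumes "t permutes directions n m" "i < n" "m i = 4" "e < 2"
  shows "fst (t (i, e)) < n" "m (fst (t (i, e))) = 4" "snd (t (i, e)) < 2"
proof -
  have "t (i, e) \<in> directions n m"
    unfolding permutes_in_image[OF assms(1)] using assms by (simp add: directions_def)
  then show "fst (t (i, e)) < n" "m (fst (t (i, e))) = 4" "snd (t (i, e)) < 2" by (auto simp: directions_def)
qed

lemma regroup_point_coord:
  assumes "i < n" "m i = 4" "e < 2"
  shows "square_coord e (regroup_point t x i) = square_coord (snd (t (i, e))) (x (fst (t (i, e))))"
proof -
  have "e = 0 \<or> e = Suc 0" using assms by auto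
  then show ?thesis using assms by (auto simp: regroup_point_def)
qed

lemma regroup_point_in:
  assumes t: "t permutes directions n m" and x: "x \<in> (\<Pi>\<^sub>E i\<in>{..<n}. polygon_hull (m i))"
  shows "regroup_point t x \<in> (\<Pi>\<^sub>E i\<in>{..<n}. polygon_hull (m i))"
proof (rule PiE_I)
  fix i assume i: "i \<in> {..<n}"
  show "regroup_point t x i \<in> polygon_hull (m i)"
  proof (cases "m i = 4")
    case True
    have "\<bar>square_coord e (regroup_point t x i)\<bar> \<le> 1" if e: "e < 2" for e
    proof -
      have "x (fst (t (i, e))) \<in> polygon_hull 4"
        using PiE_mem[OF x, of "fst (t (i, e))"] direction_image[OF t _ True e] i by simp
      then show ?thesis
        using regroup_point_coord[OF _ True e] direction_image(3)[OF t _ True e] i by (simp add: polygon_hull_square)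
    qed
    then show ?thesis unfolding True polygon_hull_square by blast
  next
    case False
    then show ?thesis using i PiE_mem[OF x] by (simp add: regroup_point_def)
  qed
qed (simp add: regroup_point_def)

lemma regroup_point_inverse:
  assumes t: "t permutes directions n m" and tu: "\<And>z. t (u z) = z" and u: "u permutes directions n m"
    and x: "x \<in> (\<Pi>\<^sub>E i\<in>{..<n}. polygon_hull (m i))"
  shows "regroup_point u (regroup_point t x) = x"
proof
  fix i
  show "regroup_point u (regroup_point t x) i = x i"
  proof (cases "i < n \<and> m i = 4")
    case True
    have "square_coord e (regroup_point u (regroup_point t x) i) = square_coord e (x i)" if e: "e < 2" for e
    proof -
      have d: "fst (u (i, e)) < n" "m (fst (u (i, e))) = 4" "snd (u (i, e)) < 2"
        using direction_image[OF u] True e by auto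
      have "square_coord e (regroup_point u (regroup_point t x) i) =
          square_coord (snd (u (i, e))) (regroup_point t x (fst (u (i, e))))"
        using True e by (intro regroup_point_coord) auto
      also have "\<dots> = square_coord (snd (t (u (i, e)))) (x (fst (t (u (i, e)))))"
        using regroup_point_coord[OF d] by simp
      finally show ?thesis unfolding tu by simp
    qed
    from this[of 0] this[of "Suc 0"]
    have "square_coord 0 (regroup_point u (regroup_point t x) i) = square_coord 0 (x i)"
      "square_coord (Suc 0) (regroup_point u (regroup_point t x) i) = square_coord (Suc 0) (x i)" by simp_all
    then show ?thesis by (metis square_point_coord)
  next
    case False
    then show ?thesis using PiE_arb[OF x, of i] by (auto simp: regroup_point_def)
  qed
qed

lemma continuous_regroup_point:
  assumes t: "t permutes directions n m"
  shows "continuous_map (points PP) (points PP) (regroup_point t)"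
  unfolding polygon_product_simps continuous_map_componentwise
proof (intro conjI ballI)
  let ?X = "product_topology (\<lambda>i. top_of_set (polygon_hull (m i))) {..<n}"
  show "regroup_point t ` topspace ?X \<subseteq> extensional {..<n}"
    by (auto simp: regroup_point_def)
  fix i assume i: "i \<in> {..<n}"
  have proj: "continuous_map ?X (top_of_set (polygon_hull (m a))) (\<lambda>x. x a)" if "a < n" for a
    using continuous_map_product_projection[of a "{..<n}" "\<lambda>i. top_of_set (polygon_hull (m i))"] that by simp
  show "continuous_map ?X (top_of_set (polygon_hull (m i))) (\<lambda>x. regroup_point t x i)"
  proof (cases "m i = 4")
    case False
    then show ?thesis using proj[of i] i by (simp add: regroup_point_def)
  next
    case True
    have coord: "continuous_map ?X euclidean (\<lambda>x. square_coord (snd (t (i, e))) (x (fst (t (i, e)))) *\<^sub>R c)"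
      if e: "e < 2" for e and c :: complex
    proof -
      have "continuous_map ?X euclidean ((\<lambda>z. square_coord (snd (t (i, e))) z *\<^sub>R c) \<circ> (\<lambda>x. x (fst (t (i, e)))))"
      proof (rule continuous_map_compose[OF proj])
        show "fst (t (i, e)) < n" using direction_image[OF t _ True e] i by simp
        show "continuous_map (top_of_set (polygon_hull (m (fst (t (i, e)))))) euclidean (\<lambda>z. square_coord (snd (t (i, e))) z *\<^sub>R c)"
          unfolding square_coord_def by (cases "snd (t (i, e)) = 0") (auto intro!: continuous_intros)
      qed
      then show ?thesis by (simp add: comp_def)
    qed
    have "continuous_map ?X euclidean (\<lambda>x. regroup_point t x i)"
      using continuous_map_add[OF coord[of 0] coord[of 1]] i True by (simp add: regroup_point_def square_point_def)
    moreover have "(\<lambda>x. regroup_point t x i) ` topspace ?X \<subseteq> polygon_hull (m i)"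
      using PiE_mem[OF regroup_point_in[OF t]] i by auto
    ultimately show ?thesis by (simp add: continuous_map_in_subtopology image_subset_iff_funcset)
  qed
qed

lemma regroup_facet_square: "m i = 4 \<Longrightarrow> \<tau> (i, j) = (fst (s (i, j mod 2)), snd (s (i, j mod 2)) + 2 * (j div 2))"
  by (simp add: regroup_facet_def case_prod_beta Let_def)

lemma regroup_facet_other: "m i \<noteq> 4 \<Longrightarrow> \<tau> (i, j) = (i, j)"
  by (simp add: regroup_facet_def)

text \<open>A side of a square is a direction \<open>e < 2\<close> together with an end
  \<open>b\<close>, coded as \<open>e + 2 * b\<close>. The code is unique and \<open>s\<close>
  permutes the directions, so the map is injective on a finite set that it preserves.\<close>

lemma bij_betw_regroup_facet: "bij_betw \<tau> (facets PP) (facets PP)"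
proof -
  have sub: "\<tau> ` facets PP \<subseteq> facets PP"
  proof
    fix F assume "F \<in> \<tau> ` facets PP"
    then obtain i j where ij: "i < n" "j < m i" "F = \<tau> (i, j)" by auto
    show "F \<in> facets PP"
    proof (cases "m i = 4")
      case True
      have "j mod 2 < 2" "j div 2 < 2" using ij True by auto
      then show ?thesis
        using direction_image[OF s ij(1) True, of "j mod 2"] by (simp add: ij(3) regroup_facet_square[OF True])
    next
      case False
      then show ?thesis using ij by (simp add: regroup_facet_other)
    qed
  qed
  have "inj_on \<tau> (facets PP)"
  proof (rule inj_onI)
    fix F G assume FG: "F \<in> facets PP" "G \<in> facets PP" "\<tau> F = \<tau> G"
    obtain i j k l where [simp]: "F = (i, j)" "G = (k, l)" by (metis surj_pair)
    have ij: "i < n" "j < m i" "k < n" "l < m k" using FG by auto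
    have m_fst: "m (fst (\<tau> (i, j))) = 4 \<longleftrightarrow> m i = 4" if "i < n" for i j
      using direction_image[OF s that, of "j mod 2"]
      by (cases "m i = 4") (simp_all add: regroup_facet_square regroup_facet_other)
    have iff: "m i = 4 \<longleftrightarrow> m k = 4" using m_fst ij FG(3) by (metis \<open>F = (i, j)\<close> \<open>G = (k, l)\<close>)
    show "F = G"
    proof (cases "m i = 4")
      case True
      then have k4: "m k = 4" using iff by simp
      let ?p = "s (i, j mod 2)" and ?q = "s (k, l mod 2)"
      have lt: "snd ?p < 2" "snd ?q < 2" using direction_image(3)[OF s] ij True k4 by auto
      have "fst ?p = fst ?q" "snd ?p + 2 * (j div 2) = snd ?q + 2 * (l div 2)"
        using FG(3) by (simp_all add: regroup_facet_square True k4)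
      moreover from this(2) lt have "snd ?p = snd ?q" "j div 2 = l div 2" by presburger+
      ultimately have "?p = ?q" "j div 2 = l div 2" by (simp_all add: prod_eq_iff)
      then have "i = k" "j mod 2 = l mod 2" using permutes_inj[OF s] by (auto dest: injD)
      then show ?thesis using \<open>j div 2 = l div 2\<close> by simp (metis div_mult_mod_eq)
    next
      case False
      then show ?thesis using FG(3) iff by (simp add: regroup_facet_other)
    qed
  qed
  then show ?thesis using endo_inj_surj[OF _ sub] by (simp add: bij_betw_def)
qed

text \<open>For a square, both memberships say that the coordinate along the old direction
  \<open>s (i, j mod 2)\<close> has the extreme value belonging to end
  \<open>j div 2\<close>.\<close>

lemma regroup_point_facet:
  assumes x: "x \<in> (\<Pi>\<^sub>E i\<in>{..<n}. polygon_hull (m i))" and F: "F \<in> facets PP"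
  shows "x \<in> facet PP (\<tau> F) \<longleftrightarrow> regroup_point s x \<in> facet PP F"
proof -
  obtain i j where ij: "F = (i, j)" "i < n" "j < m i" using F by auto
  note fx = regroup_point_in[OF s x]
  show ?thesis
  proof (cases "m i = 4")
    case False
    have "regroup_point s x i = x i" using ij False by (simp add: regroup_point_def)
    then show ?thesis
      unfolding ij(1) regroup_facet_other[OF False] polygon_product_simps using x fx by simp
  next
    case True
    let ?e = "j mod 2" and ?b = "j div 2"
    have e: "?e < 2" "?b < 2" "?e + 2 * ?b = j" using ij True by auto
    obtain a d where ad: "s (i, ?e) = (a, d)" by (metis surj_pair)
    have ad': "a < n" "m a = 4" "d < 2" using direction_image[OF s ij(2) True e(1)] ad by auto
    have "\<tau> F = (a, d + 2 * ?b)" unfolding ij(1) regroup_facet_square[OF True] ad by simp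
    then have "x \<in> facet PP (\<tau> F) \<longleftrightarrow> x a \<in> facet (polygon 4) (d + 2 * ?b)"
      using x ad' by simp
    also have "\<dots> \<longleftrightarrow> square_coord d (x a) = (if ?b = 0 then 1 else - 1)"
      using facet_square[OF ad'(3) e(2), of "x a"] PiE_mem[OF x, of a] ad' by simp
    also have "\<dots> \<longleftrightarrow> square_coord ?e (regroup_point s x i) = (if ?b = 0 then 1 else - 1)"
      using regroup_point_coord[OF ij(2) True e(1), of s x] ad by simp
    also have "\<dots> \<longleftrightarrow> regroup_point s x i \<in> facet (polygon 4) (?e + 2 * ?b)"
      using facet_square[OF e(1,2), of "regroup_point s x i"] PiE_mem[OF fx, of i] ij True by simp
    also have "\<dots> \<longleftrightarrow> regroup_point s x \<in> facet PP F"
      unfolding e(3) using fx ij True by simp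
    finally show ?thesis .
  qed
qed

lemma facet_homeo_regroup: "facet_homeo PP PP \<tau> (regroup_point s)"
  unfolding facet_homeo_def
proof (intro conjI ballI bij_betw_regroup_facet)
  let ?T = "\<Pi>\<^sub>E i\<in>{..<n}. polygon_hull (m i)"
  have s': "inv s permutes directions n m" using s by (rule permutes_inv)
  have left: "regroup_point (inv s) (regroup_point s x) = x" if "x \<in> ?T" for x
    by (rule regroup_point_inverse[OF s permutes_inverses(1)[OF s] s' that])
  have right: "regroup_point s (regroup_point (inv s) x) = x" if "x \<in> ?T" for x
    by (rule regroup_point_inverse[OF s' permutes_inverses(2)[OF s] s that])
  have "homeomorphic_maps (points PP) (points PP) (regroup_point s) (regroup_point (inv s))"
    unfolding homeomorphic_maps_def
    using continuous_regroup_point[OF s] continuous_regroup_point[OF s'] left right by simp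
  then show "homeomorphic_map (points PP) (points PP) (regroup_point s)"
    using homeomorphic_map_maps by blast
  fix F assume F: "F \<in> facets PP"
  have sub: "facet PP G \<subseteq> ?T" for G by (cases G) auto
  show "regroup_point s ` facet PP (\<tau> F) = facet PP F"
  proof
    show "regroup_point s ` facet PP (\<tau> F) \<subseteq> facet PP F"
      using regroup_point_facet[OF _ F] sub by blast
    show "facet PP F \<subseteq> regroup_point s ` facet PP (\<tau> F)"
    proof
      fix y assume y: "y \<in> facet PP F"
      then have yT: "y \<in> ?T" using sub by blast
      have "regroup_point (inv s) y \<in> facet PP (\<tau> F)"
        using regroup_point_facet[OF regroup_point_in[OF s' yT] F] y right[OF yT] by simp
      then show "y \<in> regroup_point s ` facet PP (\<tau> F)" using right[OF yT] by force
    qed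
  qed
qed

end

section \<open>Functionals from the row space, changes of coordinates and relabelled
  nonsingularity\<close>

lemma row_space_functional:
  assumes "w \<in> row_space P d lam"
  obtains c where "\<And>F. F \<in> facets P \<Longrightarrow> w F = (\<Sum>r<d. c r * lam (unit_vec F) r)"
proof -
  \<comment> \<open>The pullbacks of functionals on the target, with coefficients \<open>c\<close>,
    compared on facets only. They form a subspace that contains the rows.\<close>
  let ?V = "{w. \<exists>c. \<forall>F\<in>facets P. w F = (\<Sum>r<d. c r * lam (unit_vec F) r)}"
  have "bitvec.subspace ?V"
    unfolding bitvec.subspace_def
  proof (intro conjI ballI allI)
    show "0 \<in> ?V" by (rule CollectI, rule exI[of _ "\<lambda>_. 0"]) simp
    fix x y assume "x \<in> ?V" "y \<in> ?V"
    then obtain c c' where "\<forall>F\<in>facets P. x F = (\<Sum>r<d. c r * lam (unit_vec F) r)"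
      "\<forall>F\<in>facets P. y F = (\<Sum>r<d. c' r * lam (unit_vec F) r)" by auto
    then show "x + y \<in> ?V"
      by (intro CollectI exI[of _ "\<lambda>r. c r + c' r"]) (simp add: distrib_right sum.distrib)
  next
    fix b x assume "x \<in> ?V"
    then obtain c where "\<forall>F\<in>facets P. x F = (\<Sum>r<d. c r * lam (unit_vec F) r)" by auto
    then show "bscale b x \<in> ?V"
      by (intro CollectI exI[of _ "\<lambda>r. b * c r"]) (simp add: bscale_apply sum_distrib_left mult.assoc)
  qed
  moreover have "(\<lambda>r F. if F \<in> facets P then lam (unit_vec F) r else 0) ` {..<d} \<subseteq> ?V"
  proof (rule image_subsetI)
    fix r assume r: "r \<in> {..<d}"
    have "(\<Sum>q<d. (if q = r then 1 else 0) * lam (unit_vec F) q) = lam (unit_vec F) r" for F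
    proof -
      have "(\<Sum>q<d. (if q = r then 1 else 0) * lam (unit_vec F) q) = (\<Sum>q<d. if q = r then lam (unit_vec F) q else 0)"
        by (rule sum.cong) auto
      then show ?thesis using r by simp
    qed
    then show "(\<lambda>F. if F \<in> facets P then lam (unit_vec F) r else 0) \<in> ?V"
      by (intro CollectI exI[of _ "\<lambda>q. if q = r then 1 else 0"]) simp
  qed
  ultimately have "row_space P d lam \<subseteq> ?V"
    unfolding row_space_def by (intro bitvec.span_minimal)
  then show ?thesis using assms that by blast
qed

text \<open>The two small covers are equal as spaces, since the characteristic maps have the same kernel.\<close>

lemma DJ_equivalent_automorphism:
  assumes lin: "bit_linear (bvec {..<d}) (bvec {..<d}) \<beta>" and bij: "bij_betw \<beta> (bvec {..<d}) (bvec {..<d})"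
    and lam: "\<And>g. g \<in> bvec (facets P) \<Longrightarrow> lam g \<in> bvec {..<d}"
    and eq: "\<And>g. g \<in> bvec (facets P) \<Longrightarrow> \<beta> (lam g) = lam' g"
  shows "DJ_equivalent d P lam lam'"
proof -
  have iff: "lam' g = \<beta> v \<longleftrightarrow> lam g = v" if "g \<in> bvec (facets P)" "v \<in> bvec {..<d}" for g v
    using inj_on_eq_iff[OF bij_betw_imp_inj_on[OF bij] lam[OF that(1)] that(2)] eq[OF that(1)] by simp
  have "char_kernel P lam = char_kernel P lam'"
    using iff[OF _ bvec_0] bit_linear_0[OF lin] by (auto simp: char_kernel_def)
  then have cover: "small_cover P lam = small_cover P lam'" by (simp add: small_cover_def)
  have act: "small_cover_act P lam v x = small_cover_act P lam' (\<beta> v) x" if "v \<in> bvec {..<d}" for v x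
    using iff[OF _ that] unfolding small_cover_act_def by blast
  have "homeomorphic_map (small_cover P lam) (small_cover P lam') (\<lambda>x. x)"
    unfolding cover by (simp add: homeomorphic_map_def quotient_map_def)
      (use openin_subset in \<open>auto simp: Int_absorb1 Collect_conj_eq\<close>)
  then have "weakly_equivariant_homeo d P lam P lam' (\<lambda>p. p) (\<lambda>x. x)"
    unfolding weakly_equivariant_homeo_def using lin bij act by blast
  then show ?thesis unfolding DJ_equivalent_def by blast
qed

text \<open>Nonsingularity of the relabelled map at a point of \<open>Q\<close> is that of
  \<open>lam\<close> at the corresponding point of \<open>P\<close>, since \<open>\<tau>\<close>
  matches the facets.\<close>

lemma relabel_independent:
  assumes char: "characteristic_map P d lam" and finP: "finite (facets P)" and finQ: "finite (facets Q)"
    and f: "facet_homeo P Q \<tau> f" and sub: "\<And>F. F \<in> facets P \<Longrightarrow> facet P F \<subseteq> topspace (points P)"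
    and q: "q \<in> topspace (points Q)" and T: "T \<subseteq> facets_at Q q"
    and 0: "(\<Sum>F\<in>T. relabel Q \<tau> lam (unit_vec F)) = 0"
  shows "T = {}"
proof -
  have hom: "homeomorphic_map (points P) (points Q) f" and bij: "bij_betw \<tau> (facets Q) (facets P)"
    using f by (auto simp: facet_homeo_def)
  have "q \<in> f ` topspace (points P)"
    using q unfolding homeomorphic_imp_surjective_map[OF hom] .
  then obtain p where p: "p \<in> topspace (points P)" "f p = q" by auto
  have TQ: "T \<subseteq> facets Q" using T by (auto simp: facets_at_def)
  then have inj: "inj_on \<tau> T" using bij_betw_imp_inj_on[OF bij] by (rule inj_on_subset[rotated])
  have "\<tau> ` T \<subseteq> facets_at P p"
    using facets_at_facet_homeo[OF f sub p(1)] T p(2) by blast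
  moreover have "(\<Sum>G\<in>\<tau> ` T. lam (unit_vec G)) = 0"
  proof -
    have "(\<Sum>F\<in>T. relabel Q \<tau> lam (unit_vec F)) = (\<Sum>F\<in>T. lam (unit_vec (\<tau> F)))"
      using relabel_unit_vec[OF finQ] TQ by (intro sum.cong) auto
    then show ?thesis using 0 unfolding sum.reindex[OF inj] comp_def by (simp only:)
  qed
  ultimately have "\<tau> ` T = {}" by (rule characteristic_map_independent[OF char finP p(1)])
  then show ?thesis by simp
qed

lemma factor_weight_apply: "factor_weight m i (k, l) = (if k = i \<and> l < m i then 1 else 0)"
proof -
  have "factor_weight m i (k, l) = (\<Sum>j<m i. if j = l then (if k = i then 1 else 0) else 0)"
    unfolding factor_weight_def sum_fun_apply by (rule sum.cong) (auto simp: unit_vec_apply)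
  then show ?thesis by simp
qed

lemma direction_weight_apply:
  assumes "snd p < 2" "e < 2" "b < 2"
  shows "direction_weight p (a, e + 2 * b) = (if p = (a, e) then 1 else 0)"
proof -
  have "b = 0 \<or> b = 1" using assms by auto
  then show ?thesis using assms by (cases p) (auto simp: direction_weight_def unit_vec_apply)
qed

context regrouping
begin

text \<open>The weight of factor \<open>i\<close> after regrouping, read through
  \<open>\<tau>\<close>, is the indicator function of the facets of factor \<open>i\<close>, and
  membership in the row space writes it as a functional applied to the labels. For a square this
  uses injectivity of \<open>s\<close>: its two directions occur in no other square.\<close>

lemma compatible_functional:
  assumes compat: "compatible_regrouping n m lam s" and i: "i < n"
  obtains c where "\<And>k j. k < n \<Longrightarrow> j < m k \<Longrightarrow>
    (\<Sum>r<2 * n. c r * lam (unit_vec (\<tau> (k, j))) r) = (if i = k then 1 else 0)"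
proof -
  have in_facets: "\<tau> (k, j) \<in> facets PP" if "k < n" "j < m k" for k j
    using bij_betw_regroup_facet that by (auto simp: bij_betw_def)
  have square: "fst (s (k, j mod 2)) < n" "m (fst (s (k, j mod 2))) = 4" "snd (s (k, j mod 2)) < 2"
    if "k < n" "m k = 4" for k j
    using direction_image[OF s that, of "j mod 2"] by simp_all
  show ?thesis
  proof (cases "m i = 4")
    case False
    then have "factor_weight m i \<in> row_space PP (2 * n) lam"
      using compat i by (simp add: compatible_regrouping_def)
    then obtain c where c: "\<And>F. F \<in> facets PP \<Longrightarrow> factor_weight m i F = (\<Sum>r<2 * n. c r * lam (unit_vec F) r)"
      using row_space_functional by blast
    have "factor_weight m i (\<tau> (k, j)) = (if i = k then 1 else 0)" if kj: "k < n" "j < m k" for k j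
    proof (cases "m k = 4")
      case True
      then have "i \<noteq> k" "fst (s (k, j mod 2)) \<noteq> i" using False square(2)[OF kj(1) True, of j] by auto
      then show ?thesis by (simp add: regroup_facet_square[OF True] factor_weight_apply)
    next
      case False
      then show ?thesis using kj by (auto simp: regroup_facet_other factor_weight_apply)
    qed
    note val = this
    show ?thesis
    proof (rule that)
      fix k j assume kj: "k < n" "j < m k"
      show "(\<Sum>r<2 * n. c r * lam (unit_vec (\<tau> (k, j))) r) = (if i = k then 1 else 0)"
        by (rule trans[OF c[OF in_facets[OF kj], symmetric] val[OF kj]])
    qed
  next
    case True
    then have "direction_weight (s (i, 0)) + direction_weight (s (i, 1)) \<in> row_space PP (2 * n) lam"
      using compat i by (simp add: compatible_regrouping_def)
    then obtain c where c: "\<And>F. F \<in> facets PP \<Longrightarrow>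
        (direction_weight (s (i, 0)) + direction_weight (s (i, 1))) F = (\<Sum>r<2 * n. c r * lam (unit_vec F) r)"
      using row_space_functional by blast
    have sn: "snd (s (i, 0)) < 2" "snd (s (i, 1)) < 2" using direction_image(3)[OF s i True] by simp_all
    have sf: "m (fst (s (i, 0))) = 4" "m (fst (s (i, 1))) = 4" using direction_image(2)[OF s i True] by simp_all
    have "(direction_weight (s (i, 0)) + direction_weight (s (i, 1))) (\<tau> (k, j)) = (if i = k then 1 else 0)"
      if kj: "k < n" "j < m k" for k j
    proof (cases "m k = 4")
      case k4: True
      have s_inj: "s x = s y \<longleftrightarrow> x = y" for x y using permutes_inj[OF s] by (auto dest: injD)
      have "j div 2 < 2" using kj k4 by simp
      then have dw: "direction_weight p (\<tau> (k, j)) = (if p = s (k, j mod 2) then 1 else 0)" if "snd p < 2" for p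
        unfolding regroup_facet_square[OF k4] using square(3)[OF kj(1) k4] that by (subst direction_weight_apply) simp_all
      have "j mod 2 = 0 \<or> j mod 2 = 1" by auto
      then show ?thesis unfolding plus_fun_apply dw[OF sn(1)] dw[OF sn(2)] s_inj by auto
    next
      case False
      then have "k \<noteq> fst (s (i, 0))" "k \<noteq> fst (s (i, 1))" "i \<noteq> k" using sf True by auto
      then show ?thesis
        unfolding regroup_facet_other[OF False]
        by (simp add: direction_weight_def case_prod_beta unit_vec_apply prod_eq_iff)
    qed
    note val = this
    show ?thesis
    proof (rule that)
      fix k j assume kj: "k < n" "j < m k"
      show "(\<Sum>r<2 * n. c r * lam (unit_vec (\<tau> (k, j))) r) = (if i = k then 1 else 0)"
        by (rule trans[OF c[OF in_facets[OF kj], symmetric] val[OF kj]])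
    qed
  qed
qed

end

text \<open>The conclusion holds for every compatible regrouping, and factor-compatibility says that
  there is one. The regrouped map inherits nonsingularity at vertices through
  \<open>facet_homeo_regroup\<close>, so its labels satisfy the assumptions of
  \<open>balanced_vectors\<close>.\<close>

theorem corollary6p6:
  fixes n :: nat and m :: "nat \<Rightarrow> nat"
    and lam :: "(nat \<times> nat \<Rightarrow> bit) \<Rightarrow> nat \<Rightarrow> bit"
  assumes "\<forall>i<n. 3 \<le> m i"
    and "characteristic_map (polygon_product n m) (2 * n) lam"
    and "factor_compatible n m lam"
  shows "\<forall>s. compatible_regrouping n m lam s \<longrightarrow>
           regrouping_identifies n m s lam \<and>
           iterated_orientable_bundle n m (regrouped n m s lam)"
proof (intro allI impI)
  fix s assume compat: "compatible_regrouping n m lam s"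
  interpret regrouping n m s
    using assms(1) compat by unfold_locales (auto simp: compatible_regrouping_def)
  let ?mu = "regrouped n m s lam"
  have fin: "finite (facets PP)" by simp
  have sub: "facet PP F \<subseteq> topspace (points PP)" for F by (cases F) auto
  have labelling: "surjective_labelling PP (2 * n) lam"
    by (rule surjective_labelling_polygon_product[OF assms(1,2)])
  obtain h where "weakly_equivariant_homeo (2 * n) PP lam PP ?mu (regroup_point s) h"
    using weakly_equivariant_homeo_facet_homeo[OF labelling facet_homeo_regroup fin closedin_facet_polygon_product[OF assms(1)]]
    unfolding regrouped_def by blast
  then have ident: "regrouping_identifies n m s lam"
    unfolding regrouping_identifies_def using facet_homeo_regroup by blast
  have lin_lam: "bit_linear (bvec (facets PP)) (bvec {..<2 * n}) lam"
    using assms(2) by (simp only: characteristic_map_def)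
  have lin_mu: "bit_linear (bvec (facets PP)) (bvec {..<2 * n}) ?mu"
    unfolding regrouped_def using bij_betw_regroup_facet by (intro bit_linear_relabel[OF lin_lam]) (simp only: bij_betw_def)
  define v where "v F = ?mu (unit_vec F)" for F
  have v_eq: "v F = lam (unit_vec (\<tau> F))" if "F \<in> facets PP" for F
    unfolding v_def regrouped_def by (rule relabel_unit_vec[OF fin that])
  have "\<forall>i. \<exists>c. i < n \<longrightarrow> (\<forall>k j. k < n \<longrightarrow> j < m k \<longrightarrow>
      (\<Sum>r<2 * n. c r * lam (unit_vec (\<tau> (k, j))) r) = (if i = k then 1 else 0))"
    using compatible_functional[OF compat] by metis
  then obtain C where C: "\<And>i k j. i < n \<Longrightarrow> k < n \<Longrightarrow> j < m k \<Longrightarrow>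
      (\<Sum>r<2 * n. C i r * lam (unit_vec (\<tau> (k, j))) r) = (if i = k then 1 else 0)" by metis
  interpret balanced_vectors n m v "\<lambda>i x. \<Sum>r<2 * n. C i r * x r"
  proof
    show "3 \<le> m k" if "k < n" for k using assms(1) that by blast
    show "v (k, j) \<in> bvec {..<2 * n}" if "k < n" "j < m k" for k j
      unfolding v_def using that by (intro bit_linear_in[OF lin_mu]) simp
    show "(\<Sum>r<2 * n. C k r * (x + y) r) = (\<Sum>r<2 * n. C k r * x r) + (\<Sum>r<2 * n. C k r * y r)" for k x y
      by (simp add: distrib_left sum.distrib)
    show "(\<Sum>r<2 * n. C i r * v (k, j) r) = (if i = k then 1 else 0)" if "i < n" "k < n" "j < m k" for i k j
      using C[OF that] v_eq[of "(k, j)"] that by simp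
    show "T = {}" if c: "\<forall>k<n. c k < m k" and T: "T \<subseteq> (SIGMA k:{..<n}. {c k, Suc (c k) mod m k})" and 0: "sum v T = 0" for c T
    proof -
      from polygon_product_vertex[OF assms(1) c] obtain x where x: "x \<in> topspace (points PP)"
        "\<And>F. F \<in> (SIGMA k:{..<n}. {c k, Suc (c k) mod m k}) \<Longrightarrow> x \<in> facet PP F"
        "(SIGMA k:{..<n}. {c k, Suc (c k) mod m k}) \<subseteq> facets PP" by blast
      have "T \<subseteq> facets_at PP x" unfolding facets_at_def using T x(2,3) by blast
      then show ?thesis
        using relabel_independent[OF assms(2) fin fin facet_homeo_regroup sub x(1)] 0 unfolding v_def regrouped_def by blast
    qed
  qed
  obtain \<pi> \<beta> where \<pi>: "\<pi> permutes {..<n}"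
    and \<beta>: "bit_linear (bvec {..<2 * n}) (bvec {..<2 * n}) \<beta>" "bij_betw \<beta> (bvec {..<2 * n}) (bvec {..<2 * n})"
    and even: "\<And>i. i < n \<Longrightarrow> even (m (\<pi> i))"
    and low: "\<And>i j. i < n \<Longrightarrow> j < m (\<pi> i) \<Longrightarrow> \<exists>A\<in>bvec {..<2 * n}. \<beta> A = v (\<pi> i, j) \<and>
       (\<forall>r<2 * i + 2. A r = (if r = 2 * i + j mod 2 then 1 else 0))"
    by (rule triangular_form) blast
  have \<pi>n: "\<pi> i < n" if "i < n" for i using permutes_in_image[OF \<pi>, of i] that by simp
  \<comment> \<open>The labels in the coordinates of \<open>\<beta>\<close>, now indexed by the
    facets of the product with permuted factors.\<close>
  have "\<forall>F. \<exists>A. fst F < n \<longrightarrow> snd F < m (\<pi> (fst F)) \<longrightarrow> A \<in> bvec {..<2 * n} \<and> \<beta> A = v (\<pi> (fst F), snd F) \<and>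
      (\<forall>r<2 * fst F + 2. A r = (if r = 2 * fst F + snd F mod 2 then 1 else 0))"
    using low by blast
  then obtain A where A': "\<And>F. fst F < n \<Longrightarrow> snd F < m (\<pi> (fst F)) \<Longrightarrow> A F \<in> bvec {..<2 * n} \<and> \<beta> (A F) = v (\<pi> (fst F), snd F) \<and>
      (\<forall>r<2 * fst F + 2. A F r = (if r = 2 * fst F + snd F mod 2 then 1 else 0))"
    by metis
  have A: "A (i, j) \<in> bvec {..<2 * n}" "\<beta> (A (i, j)) = v (\<pi> i, j)"
    "r < 2 * i + 2 \<Longrightarrow> A (i, j) r = (if r = 2 * i + j mod 2 then 1 else 0)" if "i < n" "j < m (\<pi> i)" for i j r
    using A'[of "(i, j)"] that by simp_all
  interpret T: triangular_labels n "m \<circ> \<pi>" A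
    using assms(1) \<pi>n even A(3) by unfold_locales simp_all
  let ?P = "polygon_product n (m \<circ> \<pi>)"
  let ?mu' = "relabel ?P (\<lambda>(i, j). (\<pi> i, j)) ?mu"
  have fin': "finite (facets ?P)" by simp
  have lin_mu': "bit_linear (bvec (facets ?P)) (bvec {..<2 * n}) ?mu'"
    by (rule bit_linear_relabel[OF lin_mu]) (use \<pi>n in auto)
  have lin_stage: "bit_linear (bvec (facets ?P)) (bvec {..<2 * n}) (T.stage_map n)"
    using T.characteristic_map_stage[of n] by (simp add: characteristic_map_def)
  \<comment> \<open>At the top stage truncation to \<open>2 * n\<close> rows changes nothing, so
    \<open>\<beta>\<close> carries the stage labels to those of the permuted regrouped map; a change
    of coordinates in the acting group is a Davis--Januszkiewicz equivalence.\<close>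
  have "DJ_equivalent (2 * n) ?P (T.stage_map n) ?mu'"
  proof (rule DJ_equivalent_automorphism[OF \<beta>])
    show "T.stage_map n g \<in> bvec {..<2 * n}" if "g \<in> bvec (facets ?P)" for g
      using bit_linear_in[OF lin_stage that] .
    show "\<beta> (T.stage_map n g) = ?mu' g" if g: "g \<in> bvec (facets ?P)" for g
    proof -
      have label: "T.stage_label n F \<in> bvec {..<2 * n}" "\<beta> (T.stage_label n F) = ?mu' (unit_vec F)" if F: "F \<in> facets ?P" for F
      proof -
        obtain i j where ij: "F = (i, j)" "i < n" "j < m (\<pi> i)" using F by auto
        have "T.stage_label n F = A F"
          using A(1)[OF ij(2,3)] by (auto simp: T.stage_label_def fun_eq_iff bvec_def ij(1))
        moreover have "?mu' (unit_vec F) = ?mu (unit_vec (\<pi> i, j))"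
          unfolding relabel_unit_vec[OF fin' F] unfolding ij(1) prod.case ..
        ultimately show "T.stage_label n F \<in> bvec {..<2 * n}" "\<beta> (T.stage_label n F) = ?mu' (unit_vec F)"
          using A(1,2)[OF ij(2,3)] by (simp_all only: ij(1) v_def)
      qed
      have "\<beta> (T.stage_map n g) = (\<Sum>F\<in>facets ?P. \<beta> (bscale (g F) (T.stage_label n F)))"
        unfolding T.stage_map_def using label(1) by (intro bit_linear_sum[OF \<beta>(1)]) (rule bvec_bscale)
      also have "\<dots> = (\<Sum>F\<in>facets ?P. bscale (g F) (?mu' (unit_vec F)))"
        using label by (intro sum.cong refl) (simp only: bit_linear_bscale[OF \<beta>(1)])
      also have "\<dots> = ?mu' g" by (rule bit_linear_expand[OF lin_mu' fin' g, symmetric])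
      finally show ?thesis .
    qed
  qed
  moreover have "\<exists>q. \<forall>i<n. equivariant_bundle (2 * Suc i) (polygon_product (Suc i) (m \<circ> \<pi>)) (T.stage_map (Suc i))
      (2 * i) (polygon_product i (m \<circ> \<pi>)) (T.stage_map i) 2 (polygon (m (\<pi> i))) (alternating_map (m (\<pi> i))) (q i)"
  proof -
    have "\<forall>i. \<exists>q. i < n \<longrightarrow> equivariant_bundle (2 * Suc i) (polygon_product (Suc i) (m \<circ> \<pi>)) (T.stage_map (Suc i))
      (2 * i) (polygon_product i (m \<circ> \<pi>)) (T.stage_map i) 2 (polygon (m (\<pi> i))) (alternating_map (m (\<pi> i))) q"
      using T.equivariant_bundle_stage by (auto simp: comp_def)
    then show ?thesis by (rule choice[THEN exE]) blast
  qed
  then obtain q where q: "\<And>i. i < n \<Longrightarrow> equivariant_bundle (2 * Suc i) (polygon_product (Suc i) (m \<circ> \<pi>)) (T.stage_map (Suc i))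
      (2 * i) (polygon_product i (m \<circ> \<pi>)) (T.stage_map i) 2 (polygon (m (\<pi> i))) (alternating_map (m (\<pi> i))) (q i)" by blast
  have fiber: "characteristic_map (polygon (m (\<pi> i))) 2 (alternating_map (m (\<pi> i)))"
    "orientable_surface (small_cover (polygon (m (\<pi> i))) (alternating_map (m (\<pi> i))))" if "i < n" for i
  proof -
    interpret even_polygon "m (\<pi> i)"
      using assms(1) \<pi>n even that by unfold_locales auto
    show "characteristic_map (polygon (m (\<pi> i))) 2 (alternating_map (m (\<pi> i)))"
      by (rule characteristic_map_alternating[OF k3 k_even])
    show "orientable_surface (small_cover (polygon (m (\<pi> i))) (alternating_map (m (\<pi> i))))"
      by (rule orientable_small_cover)
  qed
  ultimately have "iterated_orientable_bundle n m ?mu"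
    unfolding iterated_orientable_bundle_def
    using \<pi> T.characteristic_map_stage
    by (intro exI[of _ \<pi>] exI[of _ T.stage_map] exI[of _ "\<lambda>i. alternating_map (m (\<pi> i))"] exI[of _ q] conjI allI impI)
      (assumption | erule q | erule fiber | blast)+
  then show "regrouping_identifies n m s lam \<and> iterated_orientable_bundle n m ?mu" using ident by blast
qed

end
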